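(* Let $H$ be a graded connected Hopf algebra over $\Bbbk$ with finite-dimensional homogeneous components $H_m$. For all scalars $n\in\Bbbk$, $$\sum_{m\ge 0}\operatorname{trace}\bigl(\Psi_n|_{H_m}\bigr)\,t^m=\prod_{i\ge1}(1-nt^i)^{-g_i}$$ as formal power series in $t$.
   Context: $\Bbbk$ is a field of characteristic zero. A graded connected Hopf algebra is a bialgebra $H$ with unit map $\iota$, counit $\varepsilon$, product $\mu$, coproduct $\Delta$ and a decomposition $H=\bigoplus_{m\ge 0}H_m$ such that $\mu(H_p\otimes H_q)\subseteq H_{p+q}$, $\Delta(H_m)\subseteq\bigoplus_{p+q=m}H_p\otimes H_q$, $1\in H_0$, $\varepsilon(H_m)=0$ for $m>0$, and $\dim H_0=1$ (it then automatically has an antipode, which preserves the grading). The convolution product on linear endomorphisms of $H$ is $P\ast Q=\mu\circ(P\otimes Q)\circ\Delta$, with unit $\iota\circ\varepsilon$. For every scalar $n\in\Bbbk$ the Adams operator is $\Psi_n=\sum_{k\ge 0}\binom{n}{k}(\mathrm{id}-\iota\circ\varepsilon)^{\ast k}$, where $\binom nk=n(n-1)\cdots(n-k+1)/k!$; on $H_m$ only the terms with $k\le m$ are nonzero, and $\Psi_n$ preserves $H_m$. For integers $n$, $\Psi_n=\mathrm{id}^{\ast n}$. Let $H^{(0)}\subseteq H^{(1)}\subseteq\cdots$ be the coradical filtration of $H$ and $\mathrm{gr}\,H=H^{(0)}\oplus\bigoplus_{j\ge1}H^{(j)}/H^{(j-1)}$ the associated graded Hopf algebra. It carries a second grading $(\mathrm{gr}\,H)_m=(H^{(0)}\cap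 H_m)\oplus\bigoplus_{j\ge 1}(H^{(j)}\cap H_m)/(H^{(j-1)}\cap H_m)$. Let $\widetilde H=\bigoplus_m ((\mathrm{gr}\,H)_m)^*$ be the graded dual of $\mathrm{gr}\,H$ with respect to this second grading; it is a graded connected cocommutative Hopf algebra. Let $\mathfrak g=\{x\in\widetilde H:\Delta(x)=1\otimes x+x\otimes 1\}$ be its graded Lie algebra of primitive elements and $g_i=\dim\mathfrak g_i$ for $i\ge1$. Equivalently, the sequence of integers $(g_i)_{i\ge1}$ is determined by the dimension sequence of $H$ through $1+\sum_{m\ge1}(\dim H_m)\,t^m=\prod_{i\ge1}(1-t^i)^{-g_i}$. *)

theory Defs
  imports
    "HOL-Analysis.Analysis"
    "HOL-Library.Function_Algebras"
    "HOL-Library.Groups_Big_Fun"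
begin

section \<open>Vector spaces with an explicit carrier\<close>

text \<open>
  A vector space is a linear subspace \<open>car V\<close> of an ambient type on which \<open>scl V\<close> is a vector
  space structure.  Quotients, tensor products and duals live in function types, with pointwise
  operations.
\<close>

record ('k, 'a) vspace =
  scl :: "'k \<Rightarrow> 'a \<Rightarrow> 'a"
  car :: "'a set"

definition is_vspace :: "('k::field, 'a::ab_group_add, 'z) vspace_scheme \<Rightarrow> bool" where
  "is_vspace V \<longleftrightarrow> vector_space (scl V) \<and> module.subspace (scl V) (car V)"

definition subsp :: "('k, 'a, 'z) vspace_scheme \<Rightarrow> 'a set \<Rightarrow> ('k, 'a) vspace" where
  "subsp V A = \<lparr>scl = scl V, car = A\<rparr>"

definition ground :: "('k::field, 'k) vspace" where
  "ground = \<lparr>scl = (*), car = UNIV\<rparr>"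

definition fun_scale :: "'k::field \<Rightarrow> ('x \<Rightarrow> 'k) \<Rightarrow> 'x \<Rightarrow> 'k" where
  "fun_scale c f = (\<lambda>x. c * f x)"

lemma vector_space_fun_scale: "vector_space fun_scale"
  by unfold_locales (auto simp: fun_scale_def algebra_simps)

definition vspan :: "('k::field, 'a::ab_group_add, 'z) vspace_scheme \<Rightarrow> 'a set \<Rightarrow> 'a set" where
  "vspan V S = module.span (scl V) S"

definition vdim :: "('k::field, 'a::ab_group_add, 'z) vspace_scheme \<Rightarrow> nat" where
  "vdim V = vector_space.dim (scl V) (car V)"

definition finite_dim :: "('k::field, 'a::ab_group_add, 'z) vspace_scheme \<Rightarrow> bool" where
  "finite_dim V \<longleftrightarrow> (\<exists>B. finite B \<and> vspan V B = car V)"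

definition lin_map ::
  "('k::field, 'a::ab_group_add, 'y) vspace_scheme \<Rightarrow> ('k, 'b::ab_group_add, 'z) vspace_scheme
    \<Rightarrow> ('a \<Rightarrow> 'b) \<Rightarrow> bool" where
  "lin_map V W f \<longleftrightarrow>
     (\<forall>x\<in>car V. f x \<in> car W) \<and>
     (\<forall>x\<in>car V. \<forall>y\<in>car V. f (x + y) = f x + f y) \<and>
     (\<forall>c. \<forall>x\<in>car V. f (scl V c x) = scl W c (f x))"

definition bilin_map ::
  "('k::field, 'a::ab_group_add, 'x) vspace_scheme \<Rightarrow> ('k, 'b::ab_group_add, 'y) vspace_scheme
    \<Rightarrow> ('k, 'c::ab_group_add, 'z) vspace_scheme \<Rightarrow> ('a \<Rightarrow> 'b \<Rightarrow> 'c) \<Rightarrow> bool" where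
  "bilin_map V W U \<beta> \<longleftrightarrow>
     (\<forall>b\<in>car W. lin_map V U (\<lambda>a. \<beta> a b)) \<and> (\<forall>a\<in>car V. lin_map W U (\<beta> a))"

text \<open>Trace of an endomorphism of a finite-dimensional space: the sum of the diagonal matrix
  entries with respect to a basis.\<close>

definition trace_on :: "('k::field, 'a::ab_group_add, 'z) vspace_scheme \<Rightarrow> ('a \<Rightarrow> 'a) \<Rightarrow> 'k" where
  "trace_on V f =
     (let B = (SOME B. \<not> module.dependent (scl V) B \<and> vspan V B = car V)
      in \<Sum>b\<in>B. module.representation (scl V) B (f b) b)"

definition direct_sum ::
  "('k::field, 'a::ab_group_add, 'z) vspace_scheme \<Rightarrow> (nat \<Rightarrow> 'a set) \<Rightarrow> bool" where
  "direct_sum V D \<longleftrightarrow>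
     (\<forall>m. module.subspace (scl V) (D m) \<and> D m \<subseteq> car V) \<and>
     (\<forall>x\<in>car V. \<exists>!f. (\<forall>m. f m \<in> D m) \<and> finite {m. f m \<noteq> 0} \<and> x = (\<Sum>m | f m \<noteq> 0. f m))"


section \<open>Tensor products\<close>

text \<open>
  Over a field, \<open>V \<otimes> W\<close> embeds into the dual of the space of bilinear forms, \<open>a \<otimes> b\<close> being
  evaluation at \<open>(a, b)\<close>.  The forms are taken on the ambient types; every bilinear form on a
  pair of subspaces extends to these, so that for subspaces \<open>A\<close> of \<open>V\<close> and \<open>B\<close> of \<open>W\<close> the
  space \<open>A \<otimes> B\<close> is literally a subspace of \<open>V \<otimes> W\<close>.
\<close>

type_synonym ('a, 'b, 'k) tensor = "('a \<Rightarrow> 'b \<Rightarrow> 'k) \<Rightarrow> 'k"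

definition pure_tensor ::
  "('k::field, 'a::ab_group_add, 'y) vspace_scheme \<Rightarrow> ('k, 'b::ab_group_add, 'z) vspace_scheme
    \<Rightarrow> 'a \<Rightarrow> 'b \<Rightarrow> ('a, 'b, 'k) tensor" where
  "pure_tensor V W a b =
     (\<lambda>\<beta>. if bilin_map (subsp V UNIV) (subsp W UNIV) ground \<beta> then \<beta> a b else 0)"

definition tensor_space ::
  "('k::field, 'a::ab_group_add, 'y) vspace_scheme \<Rightarrow> ('k, 'b::ab_group_add, 'z) vspace_scheme
    \<Rightarrow> ('k, ('a, 'b, 'k) tensor) vspace" where
  "tensor_space V W =
     \<lparr>scl = fun_scale,
      car = module.span fun_scale {pure_tensor V W a b | a b. a \<in> car V \<and> b \<in> car W}\<rparr>"

text \<open>For \<open>\<beta>\<close> bilinear on \<open>car V \<times> car W\<close>, the linear map with \<open>a \<otimes> b \<mapsto> \<beta> a b\<close>.\<close>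

definition tensor_lift ::
  "('k::field, 'a::ab_group_add, 'y) vspace_scheme \<Rightarrow> ('k, 'b::ab_group_add, 'z) vspace_scheme
    \<Rightarrow> ('a \<Rightarrow> 'b \<Rightarrow> 'c::ab_group_add) \<Rightarrow> ('a, 'b, 'k) tensor \<Rightarrow> 'c" where
  "tensor_lift V W \<beta> t =
     (THE v. \<exists>ps. set ps \<subseteq> car V \<times> car W \<and>
        t = (\<Sum>(a, b)\<leftarrow>ps. pure_tensor V W a b) \<and> v = (\<Sum>(a, b)\<leftarrow>ps. \<beta> a b))"

text \<open>Linear forms separate points, so this does not depend on how \<open>t\<close> is written as a sum.\<close>

lemma separating_form:
  fixes s :: "'k::field \<Rightarrow> 'a::ab_group_add \<Rightarrow> 'a"
  assumes "vector_space s" "module.subspace s W" "v \<notin> W"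
  obtains \<phi> where "Vector_Spaces.linear s (*) \<phi>" "\<And>w. w \<in> W \<Longrightarrow> \<phi> w = (0::'k)" "\<phi> v = 1"
proof -
  interpret vector_space s by fact
  interpret g: vector_space "(*) :: 'k \<Rightarrow> 'k \<Rightarrow> 'k" by unfold_locales (auto simp: algebra_simps)
  interpret P: vector_space_pair s "(*) :: 'k \<Rightarrow> 'k \<Rightarrow> 'k" ..
  obtain B where B: "B \<subseteq> W" "independent B" "W \<subseteq> span B" using maximal_independent_subset by blast
  have sB: "span B = W" using B assms(2) by (metis span_subspace)
  have ind: "independent (insert v B)" using B sB assms(3) by (simp add: independent_insert)
  obtain \<phi> where \<phi>: "Vector_Spaces.linear s (*) \<phi>" "\<forall>x\<in>insert v B. \<phi> x = (if x = v then 1 else 0::'k)"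
    using P.linear_independent_extend[OF ind, of "\<lambda>x. if x = v then 1 else 0"] by blast
  interpret L: Vector_Spaces.linear s "(*)" \<phi> by fact
  have "v \<notin> B" using sB assms(3) span_superset by blast
  have "\<phi> w = 0" if "w \<in> W" for w
  proof -
    have "w \<in> span B" using that sB by simp
    moreover have "\<And>b. b \<in> B \<Longrightarrow> \<phi> b = 0" using \<phi>(2) \<open>v \<notin> B\<close> by auto
    ultimately show ?thesis using L.eq_0_on_span by blast
  qed
  then show ?thesis using that \<phi> by simp
qed

lemma projection_onto_carrier:
  assumes "is_vspace V"
  obtains p where "Vector_Spaces.linear (scl V) (scl V) p" "\<And>x. p x \<in> car V" "\<And>x. x \<in> car V \<Longrightarrow> p x = x"
proof -
  interpret vector_space "scl V" using assms by (simp add: is_vspace_def)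
  interpret P: vector_space_pair "scl V" "scl V" ..
  have sub: "subspace (car V)" using assms by (simp add: is_vspace_def)
  obtain B where B: "B \<subseteq> car V" "independent B" "car V \<subseteq> span B" using maximal_independent_subset by blast
  have "span B = car V" using span_subspace[OF B(1) B(3) sub] .
  obtain p where p: "Vector_Spaces.linear (scl V) (scl V) p" "\<forall>x\<in>B. p x = id x"
      "range p = span (id ` B)"
    using P.linear_independent_extend_subspace[OF B(2), of id] by blast
  have "p x = x" if "x \<in> car V" for x
  proof -
    have "x \<in> span B" using that \<open>span B = car V\<close> by simp
    then have "p x = id x" using P.linear_eq_on[OF p(1) linear_id, of x B] p(2) by blast
    then show ?thesis by simp
  qed
  moreover have "p x \<in> car V" for x
  proof -
    have "p x \<in> range p" by simp
    then show ?thesis using p(3) \<open>span B = car V\<close> by simp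
  qed
  ultimately show ?thesis using that[OF p(1)] by simp
qed

lemma sum_pure_tensor_apply: "(\<Sum>(a, b)\<leftarrow>ps. pure_tensor V W a b) \<beta> =
   (if bilin_map (subsp V UNIV) (subsp W UNIV) ground \<beta> then (\<Sum>(a, b)\<leftarrow>ps. \<beta> a b) else 0)"
  by (induction ps) (auto simp: pure_tensor_def)

lemma tensor_lift_well_defined:
  fixes V :: "('k::field, 'a::ab_group_add, 'y) vspace_scheme"
  assumes V: "is_vspace V" and W: "is_vspace W" and U: "is_vspace U" and b: "bilin_map V W U \<beta>"
    and ps: "set ps \<subseteq> car V \<times> car W" and qs: "set qs \<subseteq> car V \<times> car W"
    and eq: "(\<Sum>(a, b)\<leftarrow>ps. pure_tensor V W a b) = (\<Sum>(a, b)\<leftarrow>qs. pure_tensor V W a b)"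
  shows "(\<Sum>(a, b)\<leftarrow>ps. \<beta> a b) = (\<Sum>(a, b)\<leftarrow>qs. \<beta> a b)"
proof (rule ccontr)
  assume ne: "\<not> ?thesis"
  let ?d = "(\<Sum>(a, b)\<leftarrow>ps. \<beta> a b) - (\<Sum>(a, b)\<leftarrow>qs. \<beta> a b)"
  interpret vector_space "scl U" using U by (simp add: is_vspace_def)
  obtain \<phi> where \<phi>: "Vector_Spaces.linear (scl U) (*) \<phi>" "\<phi> ?d = 1"
  proof -
    have "?d \<notin> {0}" using ne by simp
    from separating_form[OF vector_space_axioms subspace_single_0 this] that show ?thesis by blast
  qed
  obtain p where p: "Vector_Spaces.linear (scl V) (scl V) p" "\<And>x. p x \<in> car V" "\<And>x. x \<in> car V \<Longrightarrow> p x = x" using projection_onto_carrier[OF V] by blast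
  obtain q where q: "Vector_Spaces.linear (scl W) (scl W) q" "\<And>x. q x \<in> car W" "\<And>x. x \<in> car W \<Longrightarrow> q x = x" using projection_onto_carrier[OF W] by blast
  interpret F: Vector_Spaces.linear "scl U" "(*)" \<phi> by fact
  interpret Pp: Vector_Spaces.linear "scl V" "scl V" p by fact
  interpret Q: Vector_Spaces.linear "scl W" "scl W" q by fact
  let ?g = "\<lambda>a b. \<phi> (\<beta> (p a) (q b))"
  have bil: "bilin_map (subsp V UNIV) (subsp W UNIV) ground ?g"
    using b p(2) q(2) by (auto simp: bilin_map_def lin_map_def subsp_def ground_def Pp.add Pp.scale Q.add Q.scale F.add F.scale)
  have e: "(\<Sum>(a, b)\<leftarrow>ps. ?g a b) = (\<Sum>(a, b)\<leftarrow>qs. ?g a b)"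
    using fun_cong[OF eq, of ?g] bil by (simp add: sum_pure_tensor_apply)
  have ex: "(\<Sum>(a, b)\<leftarrow>rs. ?g a b) = \<phi> (\<Sum>(a, b)\<leftarrow>rs. \<beta> a b)" if "set rs \<subseteq> car V \<times> car W" for rs
    using that by (induction rs) (auto simp: F.zero F.add p(3) q(3))
  have "\<phi> ?d = 0" using e ex[OF ps] ex[OF qs] by (simp add: F.diff)
  then show False using \<phi>(2) by simp
qed

lemma tensor_lift_sum:
  fixes V :: "('k::field, 'a::ab_group_add, 'y) vspace_scheme"
  assumes V: "is_vspace V" and W: "is_vspace W" and U: "is_vspace U" and b: "bilin_map V W U \<beta>"
    and ps: "set ps \<subseteq> car V \<times> car W"
  shows "tensor_lift V W \<beta> (\<Sum>(a, b)\<leftarrow>ps. pure_tensor V W a b) = (\<Sum>(a, b)\<leftarrow>ps. \<beta> a b)"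
  unfolding tensor_lift_def
proof (rule the_equality)
  fix v
  assume "\<exists>qs. set qs \<subseteq> car V \<times> car W \<and>
      (\<Sum>(a, b)\<leftarrow>ps. pure_tensor V W a b) = (\<Sum>(a, b)\<leftarrow>qs. pure_tensor V W a b) \<and>
      v = (\<Sum>(a, b)\<leftarrow>qs. \<beta> a b)"
  then obtain qs where qs: "set qs \<subseteq> car V \<times> car W"
      "(\<Sum>(a, b)\<leftarrow>ps. pure_tensor V W a b) = (\<Sum>(a, b)\<leftarrow>qs. pure_tensor V W a b)"
      "v = (\<Sum>(a, b)\<leftarrow>qs. \<beta> a b)"
    by (elim exE conjE)
  show "v = (\<Sum>(a, b)\<leftarrow>ps. \<beta> a b)"
    using tensor_lift_well_defined[OF V W U b ps qs(1,2)] qs(3) by simp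
qed (intro exI[of _ ps] conjI ps refl)

definition tensor_map ::
  "('k::field, 'a::ab_group_add, 'w) vspace_scheme \<Rightarrow> ('k, 'b::ab_group_add, 'x) vspace_scheme
    \<Rightarrow> ('k, 'c::ab_group_add, 'y) vspace_scheme \<Rightarrow> ('k, 'd::ab_group_add, 'z) vspace_scheme
    \<Rightarrow> ('a \<Rightarrow> 'c) \<Rightarrow> ('b \<Rightarrow> 'd) \<Rightarrow> ('a, 'b, 'k) tensor \<Rightarrow> ('c, 'd, 'k) tensor" where
  "tensor_map V W V' W' f g = tensor_lift V W (\<lambda>a b. pure_tensor V' W' (f a) (g b))"

text \<open>The canonical isomorphism \<open>(V \<otimes> V) \<otimes> V \<rightarrow> V \<otimes> (V \<otimes> V)\<close>.\<close>

definition tensor_assoc ::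
  "('k::field, 'a::ab_group_add, 'z) vspace_scheme
    \<Rightarrow> (('a, 'a, 'k) tensor, 'a, 'k) tensor \<Rightarrow> ('a, ('a, 'a, 'k) tensor, 'k) tensor" where
  "tensor_assoc V =
     tensor_lift (tensor_space V V) V
       (\<lambda>u c. tensor_lift V V (\<lambda>a b. pure_tensor V (tensor_space V V) a (pure_tensor V V b c)) u)"


section \<open>Graded connected Hopf algebras\<close>

record ('k, 'a) hopf = "('k, 'a) vspace" +
  hunit :: 'a
  prd :: "'a \<Rightarrow> 'a \<Rightarrow> 'a"
  counit :: "'a \<Rightarrow> 'k"
  coprd :: "'a \<Rightarrow> ('a, 'a, 'k) tensor"
  hdeg :: "nat \<Rightarrow> 'a set"

definition tensor_prd ::
  "('k::field, 'a::ab_group_add) hopf \<Rightarrow> ('a, 'a, 'k) tensor \<Rightarrow> ('a, 'a, 'k) tensor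
    \<Rightarrow> ('a, 'a, 'k) tensor" where
  "tensor_prd H u v =
     tensor_lift H H (\<lambda>a b. tensor_lift H H (\<lambda>c d. pure_tensor H H (prd H a c) (prd H b d)) v) u"

locale unital_algebra =
  fixes H :: "('k::field, 'a::ab_group_add) hopf"
  assumes vspace: "is_vspace H"
    and unit_closed: "hunit H \<in> car H"
    and prd_bilin: "bilin_map H H H (prd H)"
    and prd_assoc: "\<lbrakk>a \<in> car H; b \<in> car H; c \<in> car H\<rbrakk>
      \<Longrightarrow> prd H (prd H a b) c = prd H a (prd H b c)"
    and unit_left: "a \<in> car H \<Longrightarrow> prd H (hunit H) a = a"
    and unit_right: "a \<in> car H \<Longrightarrow> prd H a (hunit H) = a"

locale coalgebra =
  fixes H :: "('k::field, 'a::ab_group_add) hopf"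
  assumes vspace: "is_vspace H"
    and counit_lin: "lin_map H ground (counit H)"
    and coprd_lin: "lin_map H (tensor_space H H) (coprd H)"
    and coassoc: "x \<in> car H \<Longrightarrow>
      tensor_assoc H (tensor_map H H (tensor_space H H) H (coprd H) id (coprd H x))
        = tensor_map H H H (tensor_space H H) id (coprd H) (coprd H x)"
    and counit_left: "x \<in> car H \<Longrightarrow> tensor_lift H H (\<lambda>a b. scl H (counit H a) b) (coprd H x) = x"
    and counit_right: "x \<in> car H \<Longrightarrow> tensor_lift H H (\<lambda>a b. scl H (counit H b) a) (coprd H x) = x"

locale bialgebra = unital_algebra H + coalgebra H
  for H :: "('k::field, 'a::ab_group_add) hopf" +
  assumes counit_unit: "counit H (hunit H) = 1"
    and counit_prd: "\<lbrakk>a \<in> car H; b \<in> car H\<rbrakk> \<Longrightarrow> counit H (prd H a b) = counit H a * counit H b"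
    and coprd_unit: "coprd H (hunit H) = pure_tensor H H (hunit H) (hunit H)"
    and coprd_prd: "\<lbrakk>a \<in> car H; b \<in> car H\<rbrakk>
      \<Longrightarrow> coprd H (prd H a b) = tensor_prd H (coprd H a) (coprd H b)"

text \<open>The antipode of a graded connected bialgebra exists and is unique, hence is not part of
  the data.\<close>

locale graded_connected_hopf_algebra = bialgebra H
  for H :: "('k::field, 'a::ab_group_add) hopf" +
  assumes grading: "direct_sum H (hdeg H)"
    and prd_deg: "\<lbrakk>a \<in> hdeg H p; b \<in> hdeg H q\<rbrakk> \<Longrightarrow> prd H a b \<in> hdeg H (p + q)"
    and coprd_deg: "x \<in> hdeg H m \<Longrightarrow>
      coprd H x \<in> vspan (tensor_space H H)
        (\<Union>p\<in>{..m}. car (tensor_space (subsp H (hdeg H p)) (subsp H (hdeg H (m - p)))))"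
    and unit_deg: "hunit H \<in> hdeg H 0"
    and counit_deg: "\<lbrakk>x \<in> hdeg H m; m > 0\<rbrakk> \<Longrightarrow> counit H x = 0"
    and connected: "vdim (subsp H (hdeg H 0)) = 1"


section \<open>Convolution and Adams operators\<close>

definition unit_counit :: "('k::field, 'a::ab_group_add) hopf \<Rightarrow> 'a \<Rightarrow> 'a" where
  "unit_counit H x = scl H (counit H x) (hunit H)"

definition conv :: "('k::field, 'a::ab_group_add) hopf \<Rightarrow> ('a \<Rightarrow> 'a) \<Rightarrow> ('a \<Rightarrow> 'a) \<Rightarrow> 'a \<Rightarrow> 'a" where
  "conv H P Q = tensor_lift H H (prd H) \<circ> tensor_map H H H H P Q \<circ> coprd H"

fun conv_pow :: "('k::field, 'a::ab_group_add) hopf \<Rightarrow> ('a \<Rightarrow> 'a) \<Rightarrow> nat \<Rightarrow> 'a \<Rightarrow> 'a" where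
  "conv_pow H P 0 = unit_counit H"
| "conv_pow H P (Suc k) = conv H P (conv_pow H P k)"

text \<open>At every \<open>x\<close> only finitely many terms are nonzero; \<open>Sum_any\<close> is the sum over these.\<close>

definition adams :: "('k::field_char_0, 'a::ab_group_add) hopf \<Rightarrow> 'k \<Rightarrow> 'a \<Rightarrow> 'a" where
  "adams H n x =
     Sum_any (\<lambda>k. scl H (n gchoose k) (conv_pow H (\<lambda>y. y - unit_counit H y) k x))"


section \<open>The coradical filtration and the associated graded Hopf algebra\<close>

definition subcoalgebra :: "('k::field, 'a::ab_group_add) hopf \<Rightarrow> 'a set \<Rightarrow> bool" where
  "subcoalgebra H D \<longleftrightarrow> module.subspace (scl H) D \<and> D \<subseteq> car H \<and>
     (\<forall>x\<in>D. coprd H x \<in> car (tensor_space (subsp H D) (subsp H D)))"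

definition simple_subcoalgebra :: "('k::field, 'a::ab_group_add) hopf \<Rightarrow> 'a set \<Rightarrow> bool" where
  "simple_subcoalgebra H D \<longleftrightarrow> subcoalgebra H D \<and> D \<noteq> {0} \<and>
     (\<forall>E. subcoalgebra H E \<and> E \<subseteq> D \<longrightarrow> E = {0} \<or> E = D)"

definition coradical :: "('k::field, 'a::ab_group_add) hopf \<Rightarrow> 'a set" where
  "coradical H = vspan H (\<Union>{D. simple_subcoalgebra H D})"

fun corad_filt :: "('k::field, 'a::ab_group_add) hopf \<Rightarrow> nat \<Rightarrow> 'a set" where
  "corad_filt H 0 = coradical H"
| "corad_filt H (Suc j) =
     {x \<in> car H. \<exists>u \<in> car (tensor_space H (subsp H (corad_filt H j))).
                 \<exists>v \<in> car (tensor_space (subsp H (coradical H)) H). coprd H x = u + v}"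

definition corad_filt_pred :: "('k::field, 'a::ab_group_add) hopf \<Rightarrow> nat \<Rightarrow> 'a set" where
  "corad_filt_pred H j = (case j of 0 \<Rightarrow> {0} | Suc i \<Rightarrow> corad_filt H i)"

text \<open>
  The class of \<open>x\<close> in \<open>H\<^sup>(\<^sup>j\<^sup>) / H\<^sup>(\<^sup>j\<^sup>-\<^sup>1\<^sup>)\<close>, placed in the \<open>j\<close>-th summand of \<open>gr H\<close>.  A quotient
  \<open>V / W\<close> embeds into the dual of the annihilator of \<open>W\<close>: two vectors are congruent modulo \<open>W\<close>
  iff all linear forms vanishing on \<open>W\<close> agree on them.
\<close>

type_synonym ('k, 'a) gr = "nat \<times> ('a \<Rightarrow> 'k) \<Rightarrow> 'k"

definition gr_class :: "('k::field, 'a::ab_group_add) hopf \<Rightarrow> nat \<Rightarrow> 'a \<Rightarrow> ('k, 'a) gr" where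
  "gr_class H j x =
     (\<lambda>(i, \<phi>). if i = j \<and> lin_map (subsp H UNIV) ground \<phi> \<and> (\<forall>y\<in>corad_filt_pred H j. \<phi> y = 0)
               then \<phi> x else 0)"

lemma gr_class_eq_iff:
  assumes "vector_space (scl H)" "module.subspace (scl H) (corad_filt_pred H j)"
  shows "gr_class H j x = gr_class H j y \<longleftrightarrow> x - y \<in> corad_filt_pred H j"
proof -
  interpret vector_space "scl H" by fact
  have L: "lin_map (subsp H UNIV) ground \<phi> \<longleftrightarrow> Vector_Spaces.linear (scl H) (*) \<phi>" for \<phi>
  proof -
    have g: "vector_space ((*) :: 'a \<Rightarrow> 'a \<Rightarrow> 'a)" by unfold_locales (auto simp: algebra_simps)
    show ?thesis using g vector_space_axioms
      by (auto simp: lin_map_def subsp_def ground_def Vector_Spaces.linear_iff)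
  qed
  show ?thesis
  proof
    assume e: "gr_class H j x = gr_class H j y"
    show "x - y \<in> corad_filt_pred H j"
    proof (rule ccontr)
      assume "x - y \<notin> corad_filt_pred H j"
      then obtain \<phi> where p: "Vector_Spaces.linear (scl H) (*) \<phi>" "\<And>w. w \<in> corad_filt_pred H j \<Longrightarrow> \<phi> w = 0" "\<phi> (x - y) = 1"
        using separating_form[OF assms] by blast
      interpret F: Vector_Spaces.linear "scl H" "(*)" \<phi> by fact
      show False using fun_cong[OF e, of "(j,\<phi>)"] p by (simp add: gr_class_def L F.diff)
    qed
  next
    assume m: "x - y \<in> corad_filt_pred H j"
    show "gr_class H j x = gr_class H j y"
    proof (rule ext, clarify)
      fix i \<phi>
      show "gr_class H j x (i, \<phi>) = gr_class H j y (i, \<phi>)"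
      proof (cases "Vector_Spaces.linear (scl H) (*) \<phi> \<and> (\<forall>y\<in>corad_filt_pred H j. \<phi> y = 0)")
        case True
        then interpret F: Vector_Spaces.linear "scl H" "(*)" \<phi> by blast
        have "\<phi> (x-y) = 0" using True m by blast
        then show ?thesis by (auto simp: gr_class_def F.diff)
      qed (auto simp: gr_class_def L)
    qed
  qed
qed

definition gr_space :: "('k::field, 'a::ab_group_add) hopf \<Rightarrow> ('k, ('k, 'a) gr) vspace" where
  "gr_space H =
     \<lparr>scl = fun_scale, car = module.span fun_scale (\<Union>j. gr_class H j ` corad_filt H j)\<rparr>"

text \<open>The linear map on \<open>gr H\<close> sending the class of \<open>x\<close> in the \<open>j\<close>-th summand to \<open>F j x\<close>.\<close>

definition gr_lift ::
  "('k::field, 'a::ab_group_add) hopf \<Rightarrow> (nat \<Rightarrow> 'a \<Rightarrow> 'c::ab_group_add) \<Rightarrow> ('k, 'a) gr \<Rightarrow> 'c" where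
  "gr_lift H F u =
     (THE v. \<exists>ps. (\<forall>(j, x)\<in>set ps. x \<in> corad_filt H j) \<and>
        u = (\<Sum>(j, x)\<leftarrow>ps. gr_class H j x) \<and> v = (\<Sum>(j, x)\<leftarrow>ps. F j x))"

text \<open>\<open>\<Delta>\<close> maps \<open>H\<^sup>(\<^sup>k\<^sup>)\<close> into the sum of the \<open>H\<^sup>(\<^sup>i\<^sup>) \<otimes> H\<^sup>(\<^sup>k\<^sup>-\<^sup>i\<^sup>)\<close>; pass to classes in each summand.\<close>

definition gr_coprd_class ::
  "('k::field, 'a::ab_group_add) hopf \<Rightarrow> nat \<Rightarrow> 'a \<Rightarrow> (('k, 'a) gr, ('k, 'a) gr, 'k) tensor" where
  "gr_coprd_class H k x =
     (THE t. \<exists>ps.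
        (\<forall>(i, a, b)\<in>set ps. i \<le> k \<and> a \<in> corad_filt H i \<and> b \<in> corad_filt H (k - i)) \<and>
        coprd H x = (\<Sum>(i, a, b)\<leftarrow>ps. pure_tensor H H a b) \<and>
        t = (\<Sum>(i, a, b)\<leftarrow>ps.
               pure_tensor (gr_space H) (gr_space H) (gr_class H i a) (gr_class H (k - i) b)))"

text \<open>The degree is the one inherited from \<open>H\<close>, not the filtration index.\<close>

definition gr_hopf :: "('k::field, 'a::ab_group_add) hopf \<Rightarrow> ('k, ('k, 'a) gr) hopf" where
  "gr_hopf H =
     \<lparr>scl = fun_scale,
      car = car (gr_space H),
      hunit = gr_class H 0 (hunit H),
      prd = (\<lambda>u v. gr_lift H (\<lambda>i x. gr_lift H (\<lambda>j y. gr_class H (i + j) (prd H x y)) v) u),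
      counit = gr_lift H (\<lambda>j x. if j = 0 then counit H x else 0),
      coprd = gr_lift H (gr_coprd_class H),
      hdeg = (\<lambda>m. module.span fun_scale (\<Union>j. gr_class H j ` (corad_filt H j \<inter> hdeg H m)))\<rparr>"


section \<open>Graded duals and primitive elements\<close>

text \<open>Linear forms on \<open>car A\<close> are represented by functions vanishing outside \<open>car A\<close>, and
  \<open>(A\<^sub>m)\<^sup>*\<close> by the forms vanishing on all other homogeneous components.\<close>

definition dual_deg :: "('k::field, 'a::ab_group_add) hopf \<Rightarrow> nat \<Rightarrow> ('a \<Rightarrow> 'k) set" where
  "dual_deg A m =
     {f. lin_map A ground f \<and> (\<forall>x. x \<notin> car A \<longrightarrow> f x = 0) \<and>
         (\<forall>l. l \<noteq> m \<longrightarrow> (\<forall>x\<in>hdeg A l. f x = 0))}"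

definition dual_space :: "('k::field, 'a::ab_group_add) hopf \<Rightarrow> ('k, 'a \<Rightarrow> 'k) vspace" where
  "dual_space A = \<lparr>scl = fun_scale, car = module.span fun_scale (\<Union>m. dual_deg A m)\<rparr>"

text \<open>The product is dual to the coproduct of \<open>A\<close>, the coproduct dual to the product of \<open>A\<close>.\<close>

definition graded_dual :: "('k::field, 'a::ab_group_add) hopf \<Rightarrow> ('k, 'a \<Rightarrow> 'k) hopf" where
  "graded_dual A =
     \<lparr>scl = fun_scale,
      car = car (dual_space A),
      hunit = (\<lambda>x. if x \<in> car A then counit A x else 0),
      prd = (\<lambda>f g x. if x \<in> car A then tensor_lift A A (\<lambda>a b. f a * g b) (coprd A x) else 0),
      counit = (\<lambda>f. f (hunit A)),
      coprd = (\<lambda>f. THE t. t \<in> car (tensor_space (dual_space A) (dual_space A)) \<and>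
         (\<forall>a\<in>car A. \<forall>b\<in>car A.
            tensor_lift (dual_space A) (dual_space A) (\<lambda>g h. g a * h b) t = f (prd A a b))),
      hdeg = dual_deg A\<rparr>"

definition primitives :: "('k::field, 'a::ab_group_add) hopf \<Rightarrow> 'a set" where
  "primitives H =
     {x \<in> car H. coprd H x = pure_tensor H H (hunit H) x + pure_tensor H H x (hunit H)}"

definition prim_dim :: "('k::field, 'a::ab_group_add) hopf \<Rightarrow> nat \<Rightarrow> nat" where
  "prim_dim H i =
     (let H' = graded_dual (gr_hopf H) in vdim (subsp H' (primitives H' \<inter> hdeg H' i)))"

end

theory Submission
  imports Defs
begin

text \<open>
  Write \<open>F\<^sub>0 \<subseteq> F\<^sub>1 \<subseteq> \<dots>\<close> for the coradical filtration of \<open>H\<close>.  It is stable under \<open>\<Psi>\<^sub>n\<close>, so the trace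
  of \<open>\<Psi>\<^sub>n\<close> on \<open>H\<^sub>m\<close> can be read off on \<open>gr H\<close>.  What makes \<open>gr H\<close> accessible is that it is
  commutative: its primitive elements all have filtration index \<open>1\<close>, whereas a commutator of elements
  of positive indices \<open>i\<close> and \<open>j\<close> is, by induction, primitive of index \<open>i + j \<ge> 2\<close>, hence \<open>0\<close>.

  On a commutative Hopf algebra \<open>\<Psi>\<^sub>n\<close> is multiplicative.  Let \<open>I\<close> be the augmentation ideal.  For
  \<open>x \<in> I\<close> the coproduct is \<open>x \<otimes> 1 + 1 \<otimes> x\<close> plus terms in \<open>I \<otimes> I\<close>, so \<open>\<Psi>\<^sub>n\<close> is multiplication by \<open>n\<close>
  on \<open>I / I\<^sup>2\<close>, and by \<open>n\<^sup>k\<close> on \<open>I\<^sup>k / I\<^sup>k\<^sup>+\<^sup>1\<close>.  In characteristic zero \<open>gr H\<close> is a polynomial algebra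
  on a homogeneous basis of \<open>I / I\<^sup>2\<close>: a linear form on \<open>I / I\<^sup>2\<close> that is dual to a generator \<open>x\<close> induces a
  derivation, which differentiates a monomial in generators of degree at most \<open>deg x\<close> with respect
  to \<open>x\<close>, and a nontrivial polynomial relation of least degree would be turned into a smaller one.
  So the trace of \<open>\<Psi>\<^sub>n\<close> in degree \<open>m\<close> is the sum of \<open>n\<close> to the power of the length over all monomials of
  degree \<open>m\<close>, and the generating function of these sums is the product of the \<open>(1 - n t\<^sup>i)\<^sup>-\<^sup>1\<close> over all
  generators, \<open>i\<close> being the degree of the generator.  Finally, a form in the graded dual of \<open>gr H\<close> is
  primitive iff it vanishes on \<open>1\<close> and on \<open>I\<^sup>2\<close>, so that \<open>g\<^sub>i\<close> is the number of generators of degree \<open>i\<close>.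

  Except for the last point everything takes place in \<open>H\<close> itself, in congruences modulo lower
  filtration: products of generators are taken in \<open>H\<close>, and a monomial is determined by its
  multiset of factors only up to lower terms.  The filtration is accessible through linear forms
  (\<open>fil_step\<close>): an element lies in \<open>F\<^sub>k\<^sub>+\<^sub>1\<close> iff it is killed by all convolution products of a form
  vanishing on \<open>1\<close> with a form vanishing on \<open>F\<^sub>k\<close>.  From this follow \<open>cop_fil\<close> (the coproduct respects
  the filtration), \<open>fil_mul_commutator_hom\<close> (so does the product, and it is commutative modulo lower
  terms) and \<open>bm_independent_mod\<close> (independence of the monomials).  The eigenvalues are found in
  \<open>psi_prodl\<close> for natural numbers \<open>n\<close> and in \<open>adams_bm_diag\<close> for all scalars; \<open>prim_dim_eq\<close> counts
  the generators.
\<close>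

section \<open>The generating function of monomials\<close>

definition wmon :: "('a \<Rightarrow> nat) \<Rightarrow> 'a set \<Rightarrow> nat \<Rightarrow> 'a multiset set" where
  "wmon d X m = {M. set_mset M \<subseteq> X \<and> (\<Sum>x\<in>#M. d x) = m}"

lemma finite_wmon:
  assumes "finite X" "\<And>x. x \<in> X \<Longrightarrow> d x > 0"
  shows "finite (wmon d X m)"
proof -
  have size: "size M \<le> (\<Sum>x\<in>#M. d x)" if "set_mset M \<subseteq> X" for M
    using that
  proof (induction M)
    case (add x M)
    then show ?case using assms(2)[of x] by auto
  qed simp
  have "wmon d X m \<subseteq> mset ` {ys. set ys \<subseteq> X \<and> length ys \<le> m}"
  proof
    fix M assume M: "M \<in> wmon d X m"
    obtain ys where "mset ys = M" using ex_mset by blast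
    then show "M \<in> mset ` {ys. set ys \<subseteq> X \<and> length ys \<le> m}"
      using M size[of M] by (auto simp: wmon_def)
  qed
  then show ?thesis by (rule finite_subset) (intro finite_imageI finite_lists_length_le assms(1))
qed

text \<open>A monomial either does not involve \<open>x\<close> or is \<open>x\<close> times a monomial of degree \<open>m - d x\<close>.\<close>

lemma sum_wmon_insert:
  fixes c :: "'k::comm_ring_1"
  assumes X: "finite X" "x \<notin> X" and d: "\<And>y. y \<in> insert x X \<Longrightarrow> d y > 0"
  shows "(\<Sum>M\<in>wmon d (insert x X) m. c ^ size M) =
    (\<Sum>M\<in>wmon d X m. c ^ size M)
      + (if m < d x then 0 else c * (\<Sum>M\<in>wmon d (insert x X) (m - d x). c ^ size M))"
proof -
  let ?S = "wmon d (insert x X)"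
  let ?T = "{M \<in> ?S m. x \<in># M}"
  have fin: "finite (?S l)" for l using X(1) d by (intro finite_wmon) auto
  have "?S m = wmon d X m \<union> ?T" "wmon d X m \<inter> ?T = {}" using X(2) by (auto simp: wmon_def)
  then have "(\<Sum>M\<in>?S m. c ^ size M) = (\<Sum>M\<in>wmon d X m. c ^ size M) + (\<Sum>M\<in>?T. c ^ size M)"
    using fin[of m] by (metis (no_types, lifting) finite_Un sum.union_disjoint)
  moreover have "(\<Sum>M\<in>?T. c ^ size M) = (if m < d x then 0 else c * (\<Sum>M\<in>?S (m - d x). c ^ size M))"
  proof (cases "m < d x")
    case True
    have "M \<notin> ?T" for M
    proof
      assume M: "M \<in> ?T"
      then have "M = add_mset x (M - {#x#})" by simp
      then have "(\<Sum>y\<in>#M. d y) = d x + (\<Sum>y\<in>#M - {#x#}. d y)"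
        by (metis image_mset_add_mset sum_mset.add_mset)
      then show False using M True by (auto simp: wmon_def)
    qed
    then have "?T = {}" by blast
    then show ?thesis using True by (simp only: sum.empty if_True)
  next
    case False
    have "?T = add_mset x ` ?S (m - d x)"
    proof (intro equalityI subsetI)
      fix M assume M: "M \<in> ?T"
      then have e: "M = add_mset x (M - {#x#})" by simp
      then have "(\<Sum>y\<in>#M. d y) = d x + (\<Sum>y\<in>#M - {#x#}. d y)"
        by (metis image_mset_add_mset sum_mset.add_mset)
      then have "M - {#x#} \<in> ?S (m - d x)" using M by (auto simp: wmon_def dest: in_diffD)
      then show "M \<in> add_mset x ` ?S (m - d x)" using e by blast
    next
      fix M assume "M \<in> add_mset x ` ?S (m - d x)"
      then show "M \<in> ?T" using False by (auto simp: wmon_def)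
    qed
    then have "(\<Sum>M\<in>?T. c ^ size M) = (\<Sum>M\<in>add_mset x ` ?S (m - d x). c ^ size M)" by simp
    also have "\<dots> = (\<Sum>M\<in>?S (m - d x). c * c ^ size M)"
      by (subst sum.reindex) (auto simp: inj_on_def)
    finally show ?thesis using False by (simp add: sum_distrib_left)
  qed
  ultimately show ?thesis by simp
qed

text \<open>Adding a variable \<open>x\<close> divides the generating function by \<open>1 - c t\<^sup>d\<close>, where \<open>d\<close> is the degree of \<open>x\<close>;
  this is the recursion of the preceding lemma.\<close>

lemma prod_inverse_eq_wmon:
  fixes c :: "'k::field"
  assumes "finite X" "\<And>x. x \<in> X \<Longrightarrow> d x > 0"
  shows "(\<Prod>x\<in>X. inverse (1 - fps_const c * fps_X ^ d x)) = Abs_fps (\<lambda>m. \<Sum>M\<in>wmon d X m. c ^ size M)"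
  using assms
proof (induction X rule: finite_induct)
  case empty
  have "wmon d {} m = (if m = 0 then {{#}} else {})" for m by (auto simp: wmon_def)
  then show ?case by (intro fps_ext) auto
next
  case (insert x X)
  let ?f = "1 - fps_const c * fps_X ^ d x"
  let ?g = "\<lambda>X. Abs_fps (\<lambda>m. \<Sum>M\<in>wmon d X m. c ^ size M)"
  have d0: "d x > 0" using insert.prems by blast
  then have f0: "fps_nth ?f 0 \<noteq> 0" by simp
  have e: "?g (insert x X) * ?f = ?g X"
  proof (rule fps_ext)
    fix m
    have "?g (insert x X) * ?f = ?g (insert x X) - fps_const c * (?g (insert x X) * fps_X ^ d x)"
      by (simp add: algebra_simps)
    then have "fps_nth (?g (insert x X) * ?f) m = fps_nth (?g (insert x X)) m
        - c * (if m < d x then 0 else fps_nth (?g (insert x X)) (m - d x))"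
      by (simp add: fps_X_power_mult_right_nth)
    then show "fps_nth (?g (insert x X) * ?f) m = fps_nth (?g X) m"
      using sum_wmon_insert[of X x d c m] insert.hyps insert.prems by (simp split: if_splits)
  qed
  have "?g X * inverse ?f = ?g (insert x X) * (?f * inverse ?f)"
    unfolding e[symmetric] by (rule mult.assoc)
  then have "?g (insert x X) = ?g X * inverse ?f" unfolding inverse_mult_eq_1'[OF f0] by simp
  moreover have "(\<Prod>x\<in>X. inverse (1 - fps_const c * fps_X ^ d x)) = ?g X"
    using insert.IH insert.prems by blast
  ultimately show ?case using insert.hyps by (simp add: mult.commute)
qed

section \<open>Sums of tensors as lists of pairs\<close>

text \<open>An element of a tensor product is handled as a list of pairs \<open>(a, b)\<close>, standing for the sum of the
  \<open>a \<otimes> b\<close>; \<open>psum \<beta> ps\<close> is the image of this element under the linear map that \<open>\<beta>\<close> induces.\<close>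

definition psum :: "('a \<Rightarrow> 'b \<Rightarrow> 'c::comm_monoid_add) \<Rightarrow> ('a \<times> 'b) list \<Rightarrow> 'c" where
  "psum \<beta> ps = (\<Sum>(a, b)\<leftarrow>ps. \<beta> a b)"

lemma psum_simps [simp]:
  "psum \<beta> [] = 0"
  "psum \<beta> (p # ps) = \<beta> (fst p) (snd p) + psum \<beta> ps"
  "psum \<beta> (ps @ qs) = psum \<beta> ps + psum \<beta> qs"
  by (simp_all add: psum_def split_beta)

lemma psum_cong:
  "(\<And>a b. (a, b) \<in> set ps \<Longrightarrow> \<beta> a b = \<gamma> a b) \<Longrightarrow> psum \<beta> ps = psum \<gamma> ps"
  by (induction ps) auto

lemma psum_0: "(\<And>a b. (a, b) \<in> set ps \<Longrightarrow> \<beta> a b = 0) \<Longrightarrow> psum \<beta> ps = 0"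
  by (induction ps) auto

lemma psum_add: "psum (\<lambda>a b. \<beta> a b + \<gamma> a b) ps = psum \<beta> ps + psum \<gamma> ps"
  by (induction ps) (auto simp: algebra_simps)

lemma psum_diff:
  fixes \<beta> :: "'a \<Rightarrow> 'b \<Rightarrow> 'c::ab_group_add"
  shows "psum (\<lambda>a b. \<beta> a b - \<gamma> a b) ps = psum \<beta> ps - psum \<gamma> ps"
  by (induction ps) (auto simp: algebra_simps)

lemma psum_swap:
  "psum (\<lambda>a b. psum (\<lambda>c d. g a b c d) qs) ps = psum (\<lambda>c d. psum (\<lambda>a b. g a b c d) ps) qs"
  by (induction ps) (simp_all add: psum_add psum_0)

lemma psum_sum: "psum (\<lambda>a b. \<Sum>i\<in>I. g i a b) ps = (\<Sum>i\<in>I. psum (g i) ps)"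
  by (induction ps) (auto simp: sum.distrib)

lemma psum_map: "psum \<beta> (map (\<lambda>(a, b). (f a b, g a b)) ps) = psum (\<lambda>a b. \<beta> (f a b) (g a b)) ps"
  by (induction ps) auto

lemma psum_concat:
  "psum \<beta> (concat (map (\<lambda>(a, b). f a b) ps)) = psum (\<lambda>a b. psum \<beta> (f a b)) ps"
  by (induction ps) auto

lemma psum_mult_left: "psum (\<lambda>a b. (c::'c::semiring_0) * g a b) ps = c * psum g ps"
  by (induction ps) (auto simp: algebra_simps)

lemma psum_mult_right: "psum (\<lambda>a b. g a b * (c::'c::semiring_0)) ps = psum g ps * c"
  by (induction ps) (auto simp: algebra_simps)

lemma vspace_subspace: "is_vspace V \<Longrightarrow> module.subspace (scl V) (car V)"
  by (simp add: is_vspace_def)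

lemma is_vspace_ground: "is_vspace (ground :: ('k::field, 'k) vspace)"
proof -
  have v: "vector_space ((*) :: 'k \<Rightarrow> 'k \<Rightarrow> 'k)"
    by unfold_locales (auto simp: algebra_simps)
  then interpret g: vector_space "(*) :: 'k \<Rightarrow> 'k \<Rightarrow> 'k" .
  show ?thesis using v by (simp add: is_vspace_def ground_def)
qed

context
  fixes V :: "('k::field, 'a::ab_group_add, 'z) vspace_scheme"
  assumes V: "is_vspace V"
begin

interpretation vector_space "scl V" using V by (simp add: is_vspace_def)

lemma car_0: "0 \<in> car V"
  and car_add: "x \<in> car V \<Longrightarrow> y \<in> car V \<Longrightarrow> x + y \<in> car V"
  and car_diff: "x \<in> car V \<Longrightarrow> y \<in> car V \<Longrightarrow> x - y \<in> car V"
  and car_scl: "x \<in> car V \<Longrightarrow> scl V c x \<in> car V"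
  and car_sum: "(\<And>i. i \<in> I \<Longrightarrow> h i \<in> car V) \<Longrightarrow> sum h I \<in> car V"
  using vspace_subspace[OF V] subspace_0 subspace_add subspace_scale subspace_diff subspace_sum
  by blast+

lemma car_psum: "(\<And>a b. (a, b) \<in> set ps \<Longrightarrow> \<beta> a b \<in> car V) \<Longrightarrow> psum \<beta> ps \<in> car V"
  by (induction ps) (auto simp: car_0 car_add)

lemma lin_map_0:
  assumes "lin_map V U f" shows "f 0 = 0"
proof -
  have "f (0 + 0) = f 0 + f 0" using assms car_0 unfolding lin_map_def by blast
  then show ?thesis by simp
qed

lemma lin_map_psum:
  assumes f: "lin_map V U f" and "\<And>a b. (a, b) \<in> set ps \<Longrightarrow> \<beta> a b \<in> car V"
  shows "f (psum \<beta> ps) = psum (\<lambda>a b. f (\<beta> a b)) ps"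
  using assms(2)
proof (induction ps)
  case (Cons p ps)
  have "f (\<beta> (fst p) (snd p) + psum \<beta> ps) = f (\<beta> (fst p) (snd p)) + f (psum \<beta> ps)"
    using Cons.prems f car_psum[of ps] unfolding lin_map_def by (metis list.set_intros prod.collapse)
  then show ?case using Cons by simp
qed (use lin_map_0[OF f] in simp)

lemma lin_map_sum:
  assumes f: "lin_map V U f" and "\<And>i. i \<in> I \<Longrightarrow> h i \<in> car V"
  shows "f (sum h I) = (\<Sum>i\<in>I. f (h i))"
  using assms(2)
proof (induction I rule: infinite_finite_induct)
  case (insert i I)
  then have "f (h i + sum h I) = f (h i) + f (sum h I)"
    using f car_sum[of I h] unfolding lin_map_def by blast
  then show ?case using insert by simp
qed (use lin_map_0[OF f] in simp_all)

lemma lin_map_diff: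
  assumes f: "lin_map V U f" and "x \<in> car V" "y \<in> car V"
  shows "f (x - y) = f x - f y"
proof -
  have "f ((x - y) + y) = f (x - y) + f y" using f assms car_diff unfolding lin_map_def by blast
  then show ?thesis by simp
qed

end

lemma lin_map_add: "lin_map V U f \<Longrightarrow> x \<in> car V \<Longrightarrow> y \<in> car V \<Longrightarrow> f (x + y) = f x + f y"
  and lin_map_scl: "lin_map V U f \<Longrightarrow> x \<in> car V \<Longrightarrow> f (scl V c x) = scl U c (f x)"
  and lin_map_car: "lin_map V U f \<Longrightarrow> x \<in> car V \<Longrightarrow> f x \<in> car U"
  by (auto simp: lin_map_def)

lemma scl_ground [simp]: "scl ground = (*)" and car_ground [simp]: "car ground = UNIV"
  by (simp_all add: ground_def)

lemma pure_tensor_scl: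
  "fun_scale c (pure_tensor V W a b) = pure_tensor V W (scl V c a) b"
  by (auto simp: pure_tensor_def fun_scale_def fun_eq_iff bilin_map_def lin_map_def subsp_def)

lemma tensor_space_list:
  assumes V: "is_vspace V" and t: "t \<in> car (tensor_space V W)"
  shows "\<exists>ps. set ps \<subseteq> car V \<times> car W \<and> t = psum (pure_tensor V W) ps"
proof -
  interpret vector_space fun_scale by (rule vector_space_fun_scale)
  have "t \<in> span {pure_tensor V W a b | a b. a \<in> car V \<and> b \<in> car W}"
    using t by (simp add: tensor_space_def)
  then show ?thesis
  proof (induction rule: span_induct_alt)
    case base
    show ?case by (intro exI[of _ "[]"]) simp
  next
    case (step c x y)
    then obtain a b ps where *: "a \<in> car V" "b \<in> car W" "x = pure_tensor V W a b"
      "set ps \<subseteq> car V \<times> car W" "y = psum (pure_tensor V W) ps" by blast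
    then show ?case using car_scl[OF V]
      by (intro exI[of _ "(scl V c a, b) # ps"]) (auto simp: pure_tensor_scl)
  qed
qed

lemma tensor_space_psum:
  assumes "set ps \<subseteq> car V \<times> car W"
  shows "psum (pure_tensor V W) ps \<in> car (tensor_space V W)"
proof -
  interpret vector_space fun_scale by (rule vector_space_fun_scale)
  have "pure_tensor V W a b \<in> span {pure_tensor V W a b | a b. a \<in> car V \<and> b \<in> car W}"
    if "(a, b) \<in> set ps" for a b
    using assms that by (intro span_base) blast
  then have "psum (pure_tensor V W) ps
      \<in> span {pure_tensor V W a b | a b. a \<in> car V \<and> b \<in> car W}"
    by (induction ps) (auto intro: span_zero span_add)
  then show ?thesis by (simp add: tensor_space_def)
qed

lemma is_vspace_tensor: "is_vspace (tensor_space V W)"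
proof -
  interpret vector_space fun_scale by (rule vector_space_fun_scale)
  show ?thesis by (simp add: is_vspace_def tensor_space_def vector_space_axioms)
qed

lemma tensor_lift_psum:
  assumes "is_vspace V" "is_vspace W" "is_vspace U" "bilin_map V W U \<beta>" "set ps \<subseteq> car V \<times> car W"
  shows "tensor_lift V W \<beta> (psum (pure_tensor V W) ps) = psum \<beta> ps"
  using tensor_lift_sum[OF assms] by (simp add: psum_def)

lemma pure_tensor_subsp [simp]: "pure_tensor (subsp V A) W = pure_tensor V W"
    "pure_tensor V (subsp W B) = pure_tensor V W"
  by (simp_all add: pure_tensor_def subsp_def fun_eq_iff)

lemma subsp_sel [simp]: "scl (subsp V A) = scl V" "car (subsp V A) = A"
  by (simp_all add: subsp_def)

lemma is_vspace_subsp: "is_vspace V \<Longrightarrow> module.subspace (scl V) A \<Longrightarrow> is_vspace (subsp V A)"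
  by (simp add: is_vspace_def)

lemma psum_pure_eq_0_if_forms:
  assumes "\<And>\<beta>. bilin_map (subsp V UNIV) (subsp W UNIV) ground \<beta> \<Longrightarrow> psum \<beta> ps = 0"
  shows "psum (pure_tensor V W) ps = 0"
  using assms by (intro ext) (auto simp: psum_def sum_pure_tensor_apply)

text \<open>Products of linear forms from separating families separate tensors.  Bilinear forms need not be
  sums of such products, but the second components span a finite-dimensional space: in a basis \<open>E\<close>
  of it the tensor reads \<open>\<Sum>e\<in>E. w e \<otimes> e\<close>, and the hypothesis forces every \<open>w e\<close> to vanish.\<close>

lemma psum_pure_eq_0:
  assumes V: "is_vspace V" and W: "is_vspace W" and ps: "set ps \<subseteq> car V \<times> car W"
    and \<Phi>: "\<And>\<phi>. \<phi> \<in> \<Phi> \<Longrightarrow> lin_map V ground \<phi>"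
    and sepV: "\<And>a. a \<in> car V \<Longrightarrow> (\<And>\<phi>. \<phi> \<in> \<Phi> \<Longrightarrow> \<phi> a = 0) \<Longrightarrow> a = 0"
    and \<Psi>: "\<And>\<psi>. \<psi> \<in> \<Psi> \<Longrightarrow> lin_map W ground \<psi>"
    and sepW: "\<And>b. b \<in> car W \<Longrightarrow> (\<And>\<psi>. \<psi> \<in> \<Psi> \<Longrightarrow> \<psi> b = 0) \<Longrightarrow> b = 0"
    and 0: "\<And>\<phi> \<psi>. \<phi> \<in> \<Phi> \<Longrightarrow> \<psi> \<in> \<Psi> \<Longrightarrow> psum (\<lambda>a b. \<phi> a * \<psi> b) ps = 0"
  shows "psum (pure_tensor V W) ps = 0"
proof (rule psum_pure_eq_0_if_forms)
  fix \<beta> assume \<beta>: "bilin_map (subsp V UNIV) (subsp W UNIV) ground \<beta>"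
  interpret W: vector_space "scl W" using W by (simp add: is_vspace_def)
  obtain E where E: "E \<subseteq> snd ` set ps" "W.independent E" "snd ` set ps \<subseteq> W.span E"
    using W.maximal_independent_subset by blast
  have finE: "finite E" using E(1) finite_subset by blast
  let ?r = "W.representation E"
  have spanE: "b \<in> W.span E" if "(a, b) \<in> set ps" for a b using E(3) that by force
  have \<beta>sum: "\<beta> a (sum h I) = (\<Sum>i\<in>I. \<beta> a (h i))" for a h and I :: "'d set"
    using lin_map_sum[of "subsp W UNIV" ground "\<beta> a" I h] \<beta> W
    by (auto simp: bilin_map_def is_vspace_def W.subspace_UNIV)
  have \<beta>l: "lin_map (subsp V UNIV) ground (\<lambda>a. \<beta> a b)" for b
    using \<beta> by (auto simp: bilin_map_def)
  have VU: "is_vspace (subsp V UNIV)"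
    using V by (auto simp: is_vspace_def module.subspace_def vector_space_def module_def)
  define w where "w e = psum (\<lambda>a b. scl V (?r b e) a) ps" for e
  have wV: "w e \<in> car V" for e
    unfolding w_def using ps by (intro car_psum[OF V]) (auto intro: car_scl[OF V])
  have w0: "w e = 0" for e
  proof (rule sepV[OF wV])
    fix \<phi> assume \<phi>: "\<phi> \<in> \<Phi>"
    have s: "psum (\<lambda>a b. scl W (\<phi> a) b) ps = 0"
    proof (rule sepW)
      show "psum (\<lambda>a b. scl W (\<phi> a) b) ps \<in> car W"
        using ps by (intro car_psum[OF W]) (auto intro: car_scl[OF W])
      fix \<psi> assume \<psi>: "\<psi> \<in> \<Psi>"
      have "\<psi> (psum (\<lambda>a b. scl W (\<phi> a) b) ps) = psum (\<lambda>a b. \<psi> (scl W (\<phi> a) b)) ps"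
        using ps by (intro lin_map_psum[OF W \<Psi>[OF \<psi>]]) (auto intro: car_scl[OF W])
      also have "\<dots> = psum (\<lambda>a b. \<phi> a * \<psi> b) ps"
        using ps by (intro psum_cong) (auto simp: lin_map_scl[OF \<Psi>[OF \<psi>]])
      finally show "\<psi> (psum (\<lambda>a b. scl W (\<phi> a) b) ps) = 0" using 0 \<phi> \<psi> by simp
    qed
    have repsum: "?r (psum (\<lambda>a b. scl W (\<phi> a) b) qs) e = psum (\<lambda>a b. \<phi> a * ?r b e) qs
        \<and> psum (\<lambda>a b. scl W (\<phi> a) b) qs \<in> W.span E"
      if "set qs \<subseteq> set ps" for qs
      using that
    proof (induction qs)
      case (Cons q qs)
      obtain a b where q: "q = (a, b)" by force
      then have b: "b \<in> W.span E" using spanE Cons.prems by auto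
      have "?r (scl W (\<phi> a) b + psum (\<lambda>a b. scl W (\<phi> a) b) qs) e =
          ?r (scl W (\<phi> a) b) e + ?r (psum (\<lambda>a b. scl W (\<phi> a) b) qs) e"
        using Cons b by (subst W.representation_add[OF E(2)]) (auto intro: W.span_scale)
      then show ?case using Cons q b
        by (auto simp: W.representation_scale[OF E(2)] intro: W.span_scale W.span_add)
    qed (simp add: W.representation_zero W.span_zero)
    have "\<phi> (w e) = psum (\<lambda>a b. \<phi> (scl V (?r b e) a)) ps"
      unfolding w_def using ps by (intro lin_map_psum[OF V \<Phi>[OF \<phi>]]) (auto intro: car_scl[OF V])
    also have "\<dots> = psum (\<lambda>a b. \<phi> a * ?r b e) ps"
      using ps by (intro psum_cong) (auto simp: lin_map_scl[OF \<Phi>[OF \<phi>]] mult.commute)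
    also have "\<dots> = 0" using repsum[of ps] s by (simp add: W.representation_zero)
    finally show "\<phi> (w e) = 0" .
  qed
  have "psum \<beta> ps = psum (\<lambda>a b. \<Sum>e\<in>E. \<beta> (scl V (?r b e) a) e) ps"
  proof (rule psum_cong)
    fix a b assume ab: "(a, b) \<in> set ps"
    have "\<beta> a b = \<beta> a (\<Sum>e\<in>E. scl W (?r b e) e)"
      using W.sum_representation_eq[OF E(2) spanE[OF ab] finE] by simp
    also have "\<dots> = (\<Sum>e\<in>E. \<beta> (scl V (?r b e) a) e)"
      using \<beta> by (simp add: \<beta>sum bilin_map_def lin_map_def)
    finally show "\<beta> a b = (\<Sum>e\<in>E. \<beta> (scl V (?r b e) a) e)" .
  qed
  also have "\<dots> = (\<Sum>e\<in>E. \<beta> (w e) e)"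
    unfolding psum_sum w_def using lin_map_psum[OF VU \<beta>l, of ps] by simp
  also have "\<dots> = 0" using w0 lin_map_0[OF VU \<beta>l] by simp
  finally show "psum \<beta> ps = 0" .
qed

section \<open>Coproducts in sumless notation\<close>

lemma tensor_space_scl [simp]: "scl (tensor_space V W) = fun_scale"
  by (simp add: tensor_space_def)

lemma pure_tensor_add_left: "pure_tensor V W (a + a') b = pure_tensor V W a b + pure_tensor V W a' b"
  and pure_tensor_add_right: "pure_tensor V W a (b + b') = pure_tensor V W a b + pure_tensor V W a b'"
  and pure_tensor_scl_right: "pure_tensor V W a (scl W c b) = fun_scale c (pure_tensor V W a b)"
  by (auto simp: pure_tensor_def fun_scale_def fun_eq_iff bilin_map_def lin_map_def subsp_def)

lemma pure_tensor_in: "a \<in> car V \<Longrightarrow> b \<in> car W \<Longrightarrow> pure_tensor V W a b \<in> car (tensor_space V W)"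
  using tensor_space_psum[of "[(a, b)]" V W] by simp

lemma pure_tensor_bilin: "bilin_map V W (tensor_space V W) (pure_tensor V W)"
  by (auto simp: bilin_map_def lin_map_def pure_tensor_add_left pure_tensor_add_right
      pure_tensor_scl pure_tensor_scl_right intro: pure_tensor_in)

lemma bilin_map_comp:
  assumes "lin_map V V' f" "lin_map W W' g" "bilin_map V' W' U \<beta>"
  shows "bilin_map V W U (\<lambda>a b. \<beta> (f a) (g b))"
  using assms unfolding bilin_map_def lin_map_def by (intro conjI ballI allI; metis)

lemma lin_map_comp: "lin_map V W f \<Longrightarrow> lin_map W U g \<Longrightarrow> lin_map V U (\<lambda>x. g (f x))"
  by (auto simp: lin_map_def)

lemma lin_map_id: "lin_map V V (\<lambda>x. x)" "lin_map V V id"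
  by (auto simp: lin_map_def)

lemma tensor_lift_lin:
  assumes V: "is_vspace V" and W: "is_vspace W" and U: "is_vspace U" and \<beta>: "bilin_map V W U \<beta>"
  shows "lin_map (tensor_space V W) U (tensor_lift V W \<beta>)"
  unfolding lin_map_def
proof (intro conjI ballI allI)
  note L = tensor_lift_psum[OF V W U \<beta>]
  fix s assume "s \<in> car (tensor_space V W)"
  then obtain ps where ps: "set ps \<subseteq> car V \<times> car W" "s = psum (pure_tensor V W) ps"
    using tensor_space_list[OF V] by blast
  show "tensor_lift V W \<beta> s \<in> car U"
    unfolding ps(2) L[OF ps(1)] using ps(1) \<beta>
    by (intro car_psum[OF U]) (auto simp: bilin_map_def lin_map_def)
  fix t assume "t \<in> car (tensor_space V W)"
  then obtain qs where qs: "set qs \<subseteq> car V \<times> car W" "t = psum (pure_tensor V W) qs"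
    using tensor_space_list[OF V] by blast
  show "tensor_lift V W \<beta> (s + t) = tensor_lift V W \<beta> s + tensor_lift V W \<beta> t"
    using L[OF ps(1)] L[OF qs(1)] L[of "ps @ qs"] ps qs by simp
next
  note L = tensor_lift_psum[OF V W U \<beta>]
  fix c s assume "s \<in> car (tensor_space V W)"
  then obtain ps where ps: "set ps \<subseteq> car V \<times> car W" "s = psum (pure_tensor V W) ps"
    using tensor_space_list[OF V] by blast
  let ?qs = "map (\<lambda>(a, b). (scl V c a, b)) ps"
  have "set ?qs \<subseteq> car V \<times> car W" using ps(1) car_scl[OF V] by auto
  moreover have "fun_scale c s = psum (pure_tensor V W) ?qs"
  proof -
    have "fun_scale c (psum (pure_tensor V W) ps) = psum (\<lambda>a b. pure_tensor V W (scl V c a) b) ps"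
      by (induction ps) (auto simp: fun_scale_def fun_eq_iff algebra_simps pure_tensor_scl[symmetric])
    then show ?thesis using ps(2) psum_map[of "pure_tensor V W" "\<lambda>a b. scl V c a" "\<lambda>a b. b" ps] by simp
  qed
  moreover have "psum \<beta> ?qs = scl U c (psum \<beta> ps)"
  proof -
    interpret vector_space "scl U" using U by (simp add: is_vspace_def)
    have "\<beta> (scl V c a) b = scl U c (\<beta> a b)" if "(a, b) \<in> set ps" for a b
      using \<beta> ps(1) that by (auto simp: bilin_map_def lin_map_def)
    then show ?thesis
      unfolding psum_map by (induction ps) (auto simp: scale_right_distrib)
  qed
  ultimately show "tensor_lift V W \<beta> (scl (tensor_space V W) c s) = scl U c (tensor_lift V W \<beta> s)"
    using L[OF ps(1)] L[of ?qs] ps by simp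
qed

text \<open>The standing assumptions.  Characteristic zero enters through the gradients of monomials (the
  multiplicities of their factors are invertible) and through the binomial coefficients.\<close>

locale locally_finite_hopf_algebra = graded_connected_hopf_algebra H
  for H :: "('k::field_char_0, 'a::ab_group_add) hopf" +
  assumes fin: "finite_dim (subsp H (hdeg H m))"
begin

lemmas vsp = unital_algebra_axioms[THEN unital_algebra.vspace]

sublocale vs: vector_space "scl H"
  using vsp by (simp add: is_vspace_def)

abbreviation V where "V \<equiv> car H"
abbreviation mul (infixl "\<cdot>" 70) where "mul \<equiv> prd H"
abbreviation sm (infixr "\<odot>" 75) where "sm \<equiv> scl H"
abbreviation one ("\<one>") where "one \<equiv> hunit H"
abbreviation cu ("\<epsilon>") where "cu \<equiv> counit H"
abbreviation pt where "pt \<equiv> pure_tensor H H"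
abbreviation lin where "lin \<equiv> lin_map H H"
abbreviation lform where "lform \<equiv> lin_map H ground"

lemmas V_0 [simp, intro] = car_0[OF vsp]
lemmas V_add [simp, intro] = car_add[OF vsp]
lemmas V_diff [simp, intro] = car_diff[OF vsp]
lemmas V_scl [simp, intro] = car_scl[OF vsp]
lemmas V_sum [intro] = car_sum[OF vsp]
lemmas V_psum [intro] = car_psum[OF vsp]

lemma one_V [simp, intro]: "\<one> \<in> V" by (rule unit_closed)

lemma mul_V [simp, intro]: "a \<in> V \<Longrightarrow> b \<in> V \<Longrightarrow> a \<cdot> b \<in> V"
  and mul_lin1: "b \<in> V \<Longrightarrow> lin (\<lambda>a. a \<cdot> b)"
  and mul_lin2: "a \<in> V \<Longrightarrow> lin (mul a)"
  using prd_bilin by (auto simp: bilin_map_def lin_map_def)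

lemma mul_add: "a \<in> V \<Longrightarrow> a' \<in> V \<Longrightarrow> b \<in> V \<Longrightarrow> (a + a') \<cdot> b = a \<cdot> b + a' \<cdot> b"
    "a \<in> V \<Longrightarrow> b \<in> V \<Longrightarrow> b' \<in> V \<Longrightarrow> a \<cdot> (b + b') = a \<cdot> b + a \<cdot> b'"
  and mul_scl: "a \<in> V \<Longrightarrow> b \<in> V \<Longrightarrow> (c \<odot> a) \<cdot> b = c \<odot> (a \<cdot> b)"
    "a \<in> V \<Longrightarrow> b \<in> V \<Longrightarrow> a \<cdot> (c \<odot> b) = c \<odot> (a \<cdot> b)"
  using prd_bilin by (auto simp: bilin_map_def lin_map_def)

lemma mul_diff: "a \<in> V \<Longrightarrow> a' \<in> V \<Longrightarrow> b \<in> V \<Longrightarrow> (a - a') \<cdot> b = a \<cdot> b - a' \<cdot> b"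
    "a \<in> V \<Longrightarrow> b \<in> V \<Longrightarrow> b' \<in> V \<Longrightarrow> a \<cdot> (b - b') = a \<cdot> b - a \<cdot> b'"
  using lin_map_diff[OF vsp mul_lin1] lin_map_diff[OF vsp mul_lin2] by blast+

lemma mul_0 [simp]: "b \<in> V \<Longrightarrow> 0 \<cdot> b = 0" "a \<in> V \<Longrightarrow> a \<cdot> 0 = 0"
  using lin_map_0[OF vsp mul_lin1] lin_map_0[OF vsp mul_lin2] by blast+

lemma mul_psum:
  assumes "\<And>a b. (a, b) \<in> set ps \<Longrightarrow> g a b \<in> V" "y \<in> V"
  shows "psum g ps \<cdot> y = psum (\<lambda>a b. g a b \<cdot> y) ps" "y \<cdot> psum g ps = psum (\<lambda>a b. y \<cdot> g a b) ps"
  using lin_map_psum[OF vsp mul_lin1[OF assms(2)], of ps g]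
    lin_map_psum[OF vsp mul_lin2[OF assms(2)], of ps g] assms(1) by auto

lemma scl_psum: "c \<odot> psum g ps = psum (\<lambda>a b. c \<odot> g a b) ps"
  by (induction ps) (auto simp: vs.scale_right_distrib)

lemma lform_prod_bilin: "lform f \<Longrightarrow> lform g \<Longrightarrow> bilin_map H H ground (\<lambda>a b. f a * g b)"
  by (auto simp: bilin_map_def lin_map_def algebra_simps)

lemma lin_prod_bilin: "lin P \<Longrightarrow> lin Q \<Longrightarrow> bilin_map H H H (\<lambda>a b. P a \<cdot> Q b)"
  by (rule bilin_map_comp[OF _ _ prd_bilin])

lemma lform_scl_bilin: "lform f \<Longrightarrow> lin Q \<Longrightarrow> bilin_map H H H (\<lambda>a b. f a \<odot> Q b)"
    "lform f \<Longrightarrow> lin Q \<Longrightarrow> bilin_map H H H (\<lambda>a b. f b \<odot> Q a)"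
  by (auto simp: bilin_map_def lin_map_def vs.scale_right_distrib vs.scale_left_distrib mult.commute)

lemma cu_lform: "lform \<epsilon>" by (rule counit_lin)

lemma sep_lform:
  assumes "vs.subspace S" "v \<notin> S"
  obtains f where "lform f" "\<And>w. w \<in> S \<Longrightarrow> f w = 0" "f v = 1"
proof -
  obtain f where f: "Vector_Spaces.linear (scl H) (*) f" "\<And>w. w \<in> S \<Longrightarrow> f w = 0" "f v = 1"
    using separating_form[OF vs.vector_space_axioms assms] by blast
  then have "lform f" by (auto simp: lin_map_def Vector_Spaces.linear_iff)
  with that f show ?thesis by blast
qed

lemma ambient_lform:
  assumes "lform f"
  obtains f' where "lin_map (subsp H UNIV) ground f'" "\<And>x. x \<in> V \<Longrightarrow> f' x = f x"
proof -
  obtain p where p: "Vector_Spaces.linear (scl H) (scl H) p" "\<And>x. p x \<in> V" "\<And>x. x \<in> V \<Longrightarrow> p x = x"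
    using projection_onto_carrier[OF vsp] by blast
  interpret p: Vector_Spaces.linear "scl H" "scl H" p by fact
  have "lin_map (subsp H UNIV) ground (\<lambda>x. f (p x))"
    using assms p(2) by (auto simp: lin_map_def p.add p.scale)
  with that[of "\<lambda>x. f (p x)"] p(3) show ?thesis by simp
qed

text \<open>\<open>cop x ps\<close> is Sweedler notation: the coproduct of \<open>x\<close> is the sum of the \<open>a \<otimes> b\<close> for \<open>(a, b)\<close> in \<open>ps\<close>.\<close>

definition cop :: "'a \<Rightarrow> ('a \<times> 'a) list \<Rightarrow> bool" where
  "cop x ps \<longleftrightarrow> x \<in> V \<and> set ps \<subseteq> V \<times> V \<and> coprd H x = psum pt ps"

lemma copD: "cop x ps \<Longrightarrow> x \<in> V" "cop x ps \<Longrightarrow> (a, b) \<in> set ps \<Longrightarrow> a \<in> V"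
    "cop x ps \<Longrightarrow> (a, b) \<in> set ps \<Longrightarrow> b \<in> V"
  by (auto simp: cop_def)

lemma cop_ex: "x \<in> V \<Longrightarrow> \<exists>ps. cop x ps"
  using tensor_space_list[OF vsp, of "coprd H x" H] lin_map_car[OF coprd_lin] by (auto simp: cop_def)

lemma lift_cop:
  "cop x ps \<Longrightarrow> is_vspace U \<Longrightarrow> bilin_map H H U \<beta> \<Longrightarrow> tensor_lift H H \<beta> (coprd H x) = psum \<beta> ps"
  using tensor_lift_psum[OF vsp vsp] by (auto simp: cop_def)

lemma cop_cu: assumes "cop x ps"
  shows "psum (\<lambda>a b. \<epsilon> a \<odot> b) ps = x" "psum (\<lambda>a b. \<epsilon> b \<odot> a) ps = x"
  using counit_left counit_right copD(1)[OF assms]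
    lift_cop[OF assms vsp lform_scl_bilin(1)[OF cu_lform lin_map_id(1)]]
    lift_cop[OF assms vsp lform_scl_bilin(2)[OF cu_lform lin_map_id(1)]] by auto

lemma cop_one: "cop \<one> [(\<one>, \<one>)]"
  by (simp add: cop_def coprd_unit)

lemma conv_cop:
  assumes x: "cop x ps" and P: "lin P" and Q: "lin Q"
  shows "conv H P Q x = psum (\<lambda>a b. P a \<cdot> Q b) ps"
proof -
  have b: "bilin_map H H (tensor_space H H) (\<lambda>a b. pt (P a) (Q b))"
    by (rule bilin_map_comp[OF P Q pure_tensor_bilin])
  let ?qs = "map (\<lambda>(a, b). (P a, Q b)) ps"
  have qs: "set ?qs \<subseteq> V \<times> V" using P Q copD(2,3)[OF x] by (auto simp: lin_map_def)
  have "tensor_map H H H H P Q (coprd H x) = psum pt ?qs"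
    unfolding tensor_map_def using lift_cop[OF x is_vspace_tensor b]
    by (simp add: psum_map)
  then show ?thesis
    using tensor_lift_psum[OF vsp vsp vsp prd_bilin qs] by (simp add: conv_def psum_map)
qed

lemma cop_mult:
  assumes x: "cop x ps" and y: "cop y qs"
  shows "cop (x \<cdot> y) (concat (map (\<lambda>(a, b). map (\<lambda>(c, d). (a \<cdot> c, b \<cdot> d)) qs) ps))"
proof -
  note xD = copD[OF x] and yD = copD[OF y]
  have b1: "bilin_map H H (tensor_space H H) (\<lambda>c d. pt (a \<cdot> c) (b \<cdot> d))" if "a \<in> V" "b \<in> V" for a b
    by (rule bilin_map_comp[OF mul_lin2 mul_lin2 pure_tensor_bilin]) fact+
  have l1: "tensor_lift H H (\<lambda>c d. pt (a \<cdot> c) (b \<cdot> d)) (coprd H y)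
      = psum (\<lambda>c d. pt (a \<cdot> c) (b \<cdot> d)) qs" if "a \<in> V" "b \<in> V" for a b
    by (rule lift_cop[OF y is_vspace_tensor b1[OF that]])
  have b2: "bilin_map H H (tensor_space H H)
     (\<lambda>a b. tensor_lift H H (\<lambda>c d. pt (a \<cdot> c) (b \<cdot> d)) (coprd H y))"
  proof -
    have sc: "fun_scale c (psum g qs) = psum (\<lambda>a b. fun_scale c (g a b)) qs" for c g and qs :: "('a \<times> 'a) list"
      by (induction qs) (auto simp: fun_scale_def fun_eq_iff algebra_simps)
    show ?thesis
      unfolding bilin_map_def lin_map_def
      using yD(2,3)
      by (auto simp: l1 psum_add[symmetric] mul_add mul_scl pure_tensor_add_left pure_tensor_add_right
          pure_tensor_scl[symmetric] pure_tensor_scl_right sc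
          intro!: psum_cong car_psum[OF is_vspace_tensor] pure_tensor_in)
  qed
  have "coprd H (x \<cdot> y) = psum (\<lambda>a b. psum (\<lambda>c d. pt (a \<cdot> c) (b \<cdot> d)) qs) ps"
    using lift_cop[OF x is_vspace_tensor b2] coprd_prd[OF xD(1) yD(1)] xD(2,3)
    by (auto simp: tensor_prd_def l1 intro!: psum_cong)
  then show ?thesis using xD yD
    by (auto simp: cop_def psum_concat psum_map intro!: psum_cong)
qed

text \<open>The product of the dual algebra, on all linear forms.\<close>

definition cf :: "('a \<Rightarrow> 'k) \<Rightarrow> ('a \<Rightarrow> 'k) \<Rightarrow> 'a \<Rightarrow> 'k" where
  "cf f g x = tensor_lift H H (\<lambda>a b. f a * g b) (coprd H x)"

lemma cf_cop: "cop x ps \<Longrightarrow> lform f \<Longrightarrow> lform g \<Longrightarrow> cf f g x = psum (\<lambda>a b. f a * g b) ps"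
  unfolding cf_def by (rule lift_cop[OF _ is_vspace_ground lform_prod_bilin])

lemma cf_lform: "lform f \<Longrightarrow> lform g \<Longrightarrow> lform (cf f g)"
  unfolding cf_def
  by (rule lin_map_comp[OF coprd_lin tensor_lift_lin[OF vsp vsp is_vspace_ground lform_prod_bilin]])

text \<open>Evaluate both sides of the coassociativity axiom, which live in \<open>H \<otimes> (H \<otimes> H)\<close>,
  at the bilinear form built from \<open>f\<close>, \<open>g\<close> and \<open>h\<close>; the forms are first extended
  from the carrier to the whole type.\<close>

lemma cf_assoc:
  assumes f: "lform f" and g: "lform g" and h: "lform h" and x: "x \<in> V"
  shows "cf (cf f g) h x = cf f (cf g h) x"
proof -
  let ?T = "tensor_space H H"
  have vT: "is_vspace ?T" by (rule is_vspace_tensor)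
  obtain ps where ps: "cop x ps" using cop_ex[OF x] by blast
  obtain R where R: "\<And>a. a \<in> V \<Longrightarrow> cop a (R a)" using cop_ex by metis
  have bT: "bilin_map H H (tensor_space H ?T) (\<lambda>a b. pure_tensor H ?T a (pt b c))" if "c \<in> V" for c
  proof (rule bilin_map_comp[OF lin_map_id(1) _ pure_tensor_bilin])
    show "lin_map H ?T (\<lambda>b. pt b c)" using pure_tensor_bilin[of H H] that by (auto simp: bilin_map_def)
  qed
  define \<gamma> where "\<gamma> = (\<lambda>u c. tensor_lift H H (\<lambda>a b. pure_tensor H ?T a (pt b c)) u)"
  have \<gamma>b: "bilin_map ?T H (tensor_space H ?T) \<gamma>"
    unfolding bilin_map_def
  proof (intro conjI ballI)
    fix c assume "c \<in> V"
    then show "lin_map ?T (tensor_space H ?T) (\<lambda>u. \<gamma> u c)"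
      unfolding \<gamma>_def by (intro tensor_lift_lin vsp is_vspace_tensor bT)
  next
    fix u assume "u \<in> car ?T"
    then obtain us where us: "set us \<subseteq> V \<times> V" "u = psum pt us" using tensor_space_list[OF vsp] by blast
    have *: "\<gamma> u c = psum (\<lambda>a b. pure_tensor H ?T a (pt b c)) us" if "c \<in> V" for c
      unfolding \<gamma>_def us(2) by (rule tensor_lift_psum[OF vsp vsp is_vspace_tensor bT[OF that] us(1)])
    have sc: "fun_scale c (psum g qs) = psum (\<lambda>a b. fun_scale c (g a b)) qs"
      for c qs and g :: "'a \<Rightarrow> 'a \<Rightarrow> ('a, ('a,'a,'k) tensor, 'k) tensor"
      by (induction qs) (auto simp: fun_scale_def fun_eq_iff algebra_simps)
    have sc': "pure_tensor H ?T a (fun_scale c t) = fun_scale c (pure_tensor H ?T a t)" for a c t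
      using pure_tensor_scl_right[of H ?T a c t] by simp
    show "lin_map H (tensor_space H ?T) (\<gamma> u)"
      unfolding lin_map_def using us(1)
      by (auto simp: * psum_add[symmetric] pure_tensor_add_right pure_tensor_scl_right sc sc'
          intro!: psum_cong car_psum[OF is_vspace_tensor] pure_tensor_in)
  qed
  have \<Delta>T: "coprd H a \<in> car ?T" if "a \<in> V" for a using lin_map_car[OF coprd_lin that] .
  have L1: "tensor_map H H ?T H (coprd H) id (coprd H x)
      = psum (pure_tensor ?T H) (map (\<lambda>(a, b). (coprd H a, b)) ps)"
    unfolding tensor_map_def
    using lift_cop[OF ps is_vspace_tensor bilin_map_comp[OF coprd_lin lin_map_id(2) pure_tensor_bilin]]
    by (simp add: psum_map)
  have L: "tensor_assoc H (tensor_map H H ?T H (coprd H) id (coprd H x)) =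
      psum (\<lambda>a b. \<gamma> (coprd H a) b) ps"
    unfolding tensor_assoc_def \<gamma>_def[symmetric] L1
    using copD[OF ps] \<Delta>T by (subst tensor_lift_psum[OF vT vsp is_vspace_tensor \<gamma>b]) (auto simp: psum_map)
  have M: "tensor_map H H H ?T id (coprd H) (coprd H x) = psum (\<lambda>a b. pure_tensor H ?T a (coprd H b)) ps"
    unfolding tensor_map_def
    using lift_cop[OF ps is_vspace_tensor bilin_map_comp[OF lin_map_id(2) coprd_lin pure_tensor_bilin]]
    by simp
  have E: "psum (\<lambda>a b. \<gamma> (coprd H a) b) ps = psum (\<lambda>a b. pure_tensor H ?T a (coprd H b)) ps"
    using coassoc[OF x] L M by simp
  obtain f' where f': "lin_map (subsp H UNIV) ground f'" "\<And>x. x \<in> V \<Longrightarrow> f' x = f x" using ambient_lform[OF f] by blast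
  obtain g' where g': "lin_map (subsp H UNIV) ground g'" "\<And>x. x \<in> V \<Longrightarrow> g' x = g x" using ambient_lform[OF g] by blast
  obtain h' where h': "lin_map (subsp H UNIV) ground h'" "\<And>x. x \<in> V \<Longrightarrow> h' x = h x" using ambient_lform[OF h] by blast
  define \<beta> where "\<beta> = (\<lambda>b c. g' b * h' c)"
  define \<Theta> where "\<Theta> = (\<lambda>a (t :: ('a,'a,'k) tensor). f' a * t \<beta>)"
  have \<beta>: "bilin_map (subsp H UNIV) (subsp H UNIV) ground \<beta>"
    using g' h' by (auto simp: \<beta>_def bilin_map_def lin_map_def algebra_simps)
  have \<Theta>: "bilin_map (subsp H UNIV) (subsp ?T UNIV) ground \<Theta>"
    using f' by (auto simp: \<Theta>_def bilin_map_def lin_map_def fun_scale_def algebra_simps)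
  have pe: "pure_tensor H ?T a t \<Theta> = \<Theta> a t" for a t using \<Theta> by (simp add: pure_tensor_def)
  have pe2: "pt b c \<beta> = g' b * h' c" for b c using \<beta> by (simp add: pure_tensor_def \<beta>_def)
  have psum_app: "psum G qs z = psum (\<lambda>a b. G a b z) qs" for qs :: "('a \<times> 'a) list"
    and z :: "'w" and G :: "'a \<Rightarrow> 'a \<Rightarrow> 'w \<Rightarrow> 'k" by (induction qs) auto
  have "psum (\<lambda>a b. \<gamma> (coprd H a) b) ps \<Theta> = psum (\<lambda>a b. psum (\<lambda>a1 a2. f a1 * g a2) (R a) * h b) ps"
    unfolding psum_app
  proof (rule psum_cong)
    fix a b assume ab: "(a, b) \<in> set ps"
    then have abV: "a \<in> V" "b \<in> V" using copD[OF ps] by auto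
    have "\<gamma> (coprd H a) b = psum (\<lambda>a1 a2. pure_tensor H ?T a1 (pt a2 b)) (R a)"
      unfolding \<gamma>_def by (rule lift_cop[OF R[OF abV(1)] is_vspace_tensor bT[OF abV(2)]])
    then have "\<gamma> (coprd H a) b \<Theta> = psum (\<lambda>a1 a2. f' a1 * (g' a2 * h' b)) (R a)"
      by (simp add: psum_app pe) (simp add: \<Theta>_def pe2)
    also have "\<dots> = psum (\<lambda>a1 a2. (f a1 * g a2) * h b) (R a)"
      using copD[OF R[OF abV(1)]] abV by (intro psum_cong) (auto simp: f' g' h')
    finally show "\<gamma> (coprd H a) b \<Theta> = psum (\<lambda>a1 a2. f a1 * g a2) (R a) * h b"
      by (simp add: psum_mult_right)
  qed
  also have "\<dots> = psum (\<lambda>a b. cf f g a * h b) ps"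
    using copD[OF ps] by (intro psum_cong) (auto simp: cf_cop[OF R f g])
  also have "\<dots> = cf (cf f g) h x" by (rule cf_cop[OF ps cf_lform[OF f g] h, symmetric])
  finally have A: "psum (\<lambda>a b. \<gamma> (coprd H a) b) ps \<Theta> = cf (cf f g) h x" .
  have "psum (\<lambda>a b. pure_tensor H ?T a (coprd H b)) ps \<Theta> = psum (\<lambda>a b. f a * cf g h b) ps"
    unfolding psum_app
  proof (rule psum_cong)
    fix a b assume ab: "(a, b) \<in> set ps"
    then have abV: "a \<in> V" "b \<in> V" using copD[OF ps] by auto
    have "coprd H b \<beta> = psum (\<lambda>a1 a2. g' a1 * h' a2) (R b)"
      using R[OF abV(2)] by (simp add: cop_def psum_app pe2)
    also have "\<dots> = psum (\<lambda>a1 a2. g a1 * h a2) (R b)"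
      using copD[OF R[OF abV(2)]] by (intro psum_cong) (auto simp: g' h')
    also have "\<dots> = cf g h b" by (rule cf_cop[OF R[OF abV(2)] g h, symmetric])
    finally show "pure_tensor H ?T a (coprd H b) \<Theta> = f a * cf g h b"
      using abV unfolding pe by (simp add: \<Theta>_def f')
  qed
  also have "\<dots> = cf f (cf g h) x" by (rule cf_cop[OF ps f cf_lform[OF g h], symmetric])
  finally show ?thesis using A E by simp
qed

section \<open>Homogeneous components\<close>

abbreviation D where "D \<equiv> hdeg H"

lemma D_subspace: "vs.subspace (D m)" and D_V: "D m \<subseteq> V"
  using grading by (auto simp: direct_sum_def)

lemma D_in_V [simp, intro]: "x \<in> D m \<Longrightarrow> x \<in> V" using D_V by blast

lemmas D_0 [simp, intro] = vs.subspace_0[OF D_subspace]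
  and D_add [intro] = vs.subspace_add[OF D_subspace]
  and D_diff [intro] = vs.subspace_diff[OF D_subspace]
  and D_scl [intro] = vs.subspace_scale[OF D_subspace]
  and D_sum [intro] = vs.subspace_sum[OF D_subspace]

definition comp :: "'a \<Rightarrow> nat \<Rightarrow> 'a" where
  "comp x = (THE f. (\<forall>m. f m \<in> D m) \<and> finite {m. f m \<noteq> 0} \<and> x = (\<Sum>m | f m \<noteq> 0. f m))"

lemma comp_props:
  assumes "x \<in> V"
  shows comp_D: "comp x m \<in> D m" and comp_finite: "finite {m. comp x m \<noteq> 0}"
    and comp_sum: "(\<Sum>m | comp x m \<noteq> 0. comp x m) = x"
proof -
  let ?P = "\<lambda>f. (\<forall>m. f m \<in> D m) \<and> finite {m. f m \<noteq> 0} \<and> x = (\<Sum>m | f m \<noteq> 0. f m)"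
  have "\<exists>!f. ?P f" using grading assms by (auto simp: direct_sum_def)
  then have "?P (comp x)" unfolding comp_def by (rule theI')
  then show "comp x m \<in> D m" "finite {m. comp x m \<noteq> 0}" "(\<Sum>m | comp x m \<noteq> 0. comp x m) = x"
    by (blast, blast, metis)
qed

lemma comp_V [simp, intro]: "x \<in> V \<Longrightarrow> comp x m \<in> V"
  using comp_D D_V by blast

lemma comp_eqI:
  assumes "\<And>m. f m \<in> D m" "finite S" "\<And>m. m \<notin> S \<Longrightarrow> f m = 0" "x = sum f S"
  shows "comp x = f"
proof -
  let ?P = "\<lambda>f. (\<forall>m. f m \<in> D m) \<and> finite {m. f m \<noteq> 0} \<and> x = (\<Sum>m | f m \<noteq> 0. f m)"
  have sub: "{m. f m \<noteq> 0} \<subseteq> S" using assms by blast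
  have xV: "x \<in> V" using assms by auto
  have "?P f" using assms sub finite_subset[OF sub]
    by (auto intro!: sum.mono_neutral_right)
  moreover have "\<exists>!f. ?P f" using grading xV by (auto simp: direct_sum_def)
  ultimately show ?thesis unfolding comp_def by (intro the1_equality) auto
qed

lemma comp_sum_superset:
  assumes "x \<in> V" "finite S" "{m. comp x m \<noteq> 0} \<subseteq> S"
  shows "(\<Sum>m\<in>S. comp x m) = x"
proof -
  have "(\<Sum>m\<in>S. comp x m) = (\<Sum>m | comp x m \<noteq> 0. comp x m)"
    using assms by (intro sum.mono_neutral_right) auto
  then show ?thesis using comp_sum[OF assms(1)] by simp
qed

lemma comp_lin: "lin (\<lambda>x. comp x m)"
proof -
  have "comp (x + y) = (\<lambda>m. comp x m + comp y m)" if "x \<in> V" "y \<in> V" for x y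
  proof (rule comp_eqI)
    let ?S = "{m. comp x m \<noteq> 0} \<union> {m. comp y m \<noteq> 0}"
    show "comp x m + comp y m \<in> D m" for m using that comp_D by blast
    show f: "finite ?S" using that comp_finite by blast
    show "comp x m + comp y m = 0" if "m \<notin> ?S" for m using that by auto
    show "x + y = (\<Sum>m\<in>?S. comp x m + comp y m)"
      using comp_sum_superset[OF that(1) f] comp_sum_superset[OF that(2) f]
      by (simp add: sum.distrib)
  qed
  moreover have "comp (c \<odot> x) = (\<lambda>m. c \<odot> comp x m)" if "x \<in> V" for c x
  proof (rule comp_eqI)
    show "c \<odot> comp x m \<in> D m" for m using that comp_D by blast
    show "finite {m. comp x m \<noteq> 0}" using that comp_finite by blast
    show "c \<odot> comp x m = 0" if "m \<notin> {m. comp x m \<noteq> 0}" for m using that by auto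
    show "c \<odot> x = (\<Sum>m | comp x m \<noteq> 0. c \<odot> comp x m)"
      using comp_sum[OF that] by (simp add: vs.scale_sum_right[symmetric])
  qed
  ultimately show ?thesis by (simp add: lin_map_def)
qed

lemma comp_hom: "x \<in> D m \<Longrightarrow> comp x l = (if l = m then x else 0)"
  using comp_eqI[of "\<lambda>l. if l = m then x else 0" "{m}" x] by (auto simp: fun_eq_iff)

lemma D_disjoint: "x \<in> D p \<Longrightarrow> x \<in> D q \<Longrightarrow> p \<noteq> q \<Longrightarrow> x = 0"
  using comp_hom[of x p p] comp_hom[of x q p] by simp

lemma one_D [simp, intro]: "\<one> \<in> D 0" by (rule unit_deg)

lemma cu_one [simp]: "\<epsilon> \<one> = 1" by (rule counit_unit)

lemma one_nz: "\<one> \<noteq> 0" using cu_one lin_map_0[OF vsp cu_lform] by (metis zero_neq_one)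

lemma cu_0 [simp]: "\<epsilon> 0 = 0" by (rule lin_map_0[OF vsp cu_lform])

lemma cu_D: "x \<in> D m \<Longrightarrow> m > 0 \<Longrightarrow> \<epsilon> x = 0" by (rule counit_deg)

lemma D0_eq: "x \<in> D 0 \<Longrightarrow> x = \<epsilon> x \<odot> \<one>"
proof -
  assume x: "x \<in> D 0"
  have d: "vs.dim (D 0) = 1" using connected by (simp add: vdim_def)
  obtain B where B: "B \<subseteq> D 0" "vs.independent B" "D 0 \<subseteq> vs.span B" "card B = vs.dim (D 0)"
    using vs.basis_exists by blast
  have "card B = 1" using B(4) d by simp
  then obtain b where b: "B = {b}" by (rule card_1_singletonE)
  have "D 0 \<subseteq> range (\<lambda>k. k \<odot> b)" using B(3) b vs.span_singleton by simp
  then obtain c d where c: "\<one> = c \<odot> b" and d: "x = d \<odot> b" using one_D x by blast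
  have c0: "c \<noteq> 0" using c one_nz by auto
  have xd: "x = (d / c) \<odot> \<one>" using c c0 d by simp
  then have "\<epsilon> x = d / c" using lin_map_scl[OF cu_lform one_V] by simp
  then show ?thesis using xd by simp
qed

lemma D0_span: "D 0 = vs.span {\<one>}"
  using D0_eq D_scl[OF one_D] unfolding vs.span_singleton by blast

lemma mul_D: "a \<in> D p \<Longrightarrow> b \<in> D q \<Longrightarrow> a \<cdot> b \<in> D (p + q)" by (rule prd_deg)

lemma one_mul [simp]: "a \<in> V \<Longrightarrow> \<one> \<cdot> a = a" "a \<in> V \<Longrightarrow> a \<cdot> \<one> = a"
  using unit_left unit_right by auto

lemma cop_D:
  assumes x: "x \<in> D m"
  obtains ps where "cop x ps" "\<And>a b. (a, b) \<in> set ps \<Longrightarrow> \<exists>p\<le>m. a \<in> D p \<and> b \<in> D (m - p)"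
proof -
  interpret T: vector_space "fun_scale :: 'k \<Rightarrow> ('a, 'a, 'k) tensor \<Rightarrow> _" by (rule vector_space_fun_scale)
  let ?Q = "\<lambda>ps. \<forall>(a, b)\<in>set ps. \<exists>p\<le>m. a \<in> D p \<and> b \<in> D (m - p)"
  have "coprd H x \<in> T.span (\<Union>p\<in>{..m}. car (tensor_space (subsp H (D p)) (subsp H (D (m - p)))))"
    using coprd_deg[OF x] by (simp add: vspan_def)
  then have "\<exists>ps. ?Q ps \<and> coprd H x = psum pt ps"
  proof (induction rule: T.span_induct_alt)
    case base
    then show ?case by (intro exI[of _ "[]"]) simp
  next
    case (step c s t)
    then obtain p where p: "p \<le> m" "s \<in> car (tensor_space (subsp H (D p)) (subsp H (D (m - p))))" by auto
    have "fun_scale c s \<in> car (tensor_space (subsp H (D p)) (subsp H (D (m - p))))"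
      using car_scl[OF is_vspace_tensor p(2), of c] by simp
    then obtain qs where qs: "set qs \<subseteq> D p \<times> D (m - p)" "fun_scale c s = psum pt qs"
      using tensor_space_list[OF is_vspace_subsp[OF vsp D_subspace]] by fastforce
    from step obtain ps where ps: "?Q ps" "t = psum pt ps" by blast
    show ?case using qs ps p(1) by (intro exI[of _ "qs @ ps"]) auto
  qed
  then obtain ps where ps: "?Q ps" "coprd H x = psum pt ps" by blast
  moreover have "set ps \<subseteq> V \<times> V" using ps(1) D_V by fast
  ultimately have "cop x ps" using x by (auto simp: cop_def)
  with ps(1) show ?thesis by (intro that[of ps]) auto
qed

lemma psum_filter: "psum g ps = psum g (filter P ps) + psum g (filter (\<lambda>p. \<not> P p) ps)"
  by (induction ps) (auto simp: algebra_simps)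

lemma lform_one: "lform f \<Longrightarrow> x \<in> D 0 \<Longrightarrow> f x = \<epsilon> x * f \<one>"
  using D0_eq[of x] lin_map_scl[of H ground f \<one> "\<epsilon> x"] by simp

lemma lform_D0: "lform f \<Longrightarrow> f \<one> = 0 \<Longrightarrow> x \<in> D 0 \<Longrightarrow> f x = 0"
  using lform_one[of f x] by simp

section \<open>The coradical\<close>

primrec cfp :: "('a \<Rightarrow> 'k) \<Rightarrow> nat \<Rightarrow> 'a \<Rightarrow> 'k" where
  "cfp h 0 = \<epsilon>" | "cfp h (Suc N) = cf h (cfp h N)"

lemma cfp_lform: "lform h \<Longrightarrow> lform (cfp h N)"
  by (induction N) (auto intro: cu_lform cf_lform)

text \<open>Each factor \<open>h\<close> in the convolution power has to take a component of positive degree.\<close>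

lemma cfp_nilpotent: "lform h \<Longrightarrow> h \<one> = 0 \<Longrightarrow> x \<in> D m \<Longrightarrow> m < N \<Longrightarrow> cfp h N x = 0"
proof (induction N arbitrary: x m)
  case (Suc N)
  obtain ps where ps: "cop x ps" "\<And>a b. (a, b) \<in> set ps \<Longrightarrow> \<exists>p\<le>m. a \<in> D p \<and> b \<in> D (m - p)"
    using cop_D[OF Suc.prems(3)] by blast
  have "h a * cfp h N b = 0" if "(a, b) \<in> set ps" for a b
  proof -
    obtain p where p: "p \<le> m" "a \<in> D p" "b \<in> D (m - p)" using ps(2)[OF \<open>(a, b) \<in> set ps\<close>] by blast
    show ?thesis
    proof (cases "p = 0")
      case True
      then show ?thesis using lform_D0[OF Suc.prems(1,2)] p by simp
    next
      case False
      then show ?thesis using Suc.IH[OF Suc.prems(1,2) p(3)] Suc.prems p by simp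
    qed
  qed
  then show ?case using cf_cop[OF ps(1) Suc.prems(1) cfp_lform[OF Suc.prems(1)]] by (simp add: psum_0)
qed simp

lemma subcoalgebra_cop:
  assumes "subcoalgebra H E" "x \<in> E"
  obtains ps where "cop x ps" "set ps \<subseteq> E \<times> E"
proof -
  have "coprd H x \<in> car (tensor_space (subsp H E) (subsp H E))" "vs.subspace E" "E \<subseteq> V"
    using assms by (auto simp: subcoalgebra_def)
  then show ?thesis
    using tensor_space_list[OF is_vspace_subsp[OF vsp], of E "coprd H x" "subsp H E"] that assms(2)
    unfolding cop_def by fastforce
qed

text \<open>Otherwise some form \<open>f\<close> vanishes on the subcoalgebra \<open>E\<close> and takes the value \<open>1\<close> at \<open>1\<close>.  Then \<open>h = f - \<epsilon>\<close>
  kills \<open>1\<close>, hence has locally nilpotent convolution powers.  On \<open>E\<close> these powers are \<open>\<plusminus>\<epsilon>\<close>, so \<open>\<epsilon>\<close> vanishes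
  on \<open>E\<close>, and \<open>E = 0\<close> by the counit axiom.\<close>

lemma one_in_subcoalgebra:
  assumes E: "subcoalgebra H E" "E \<noteq> {0}"
  shows "\<one> \<in> E"
proof (rule ccontr)
  assume 1: "\<one> \<notin> E"
  have sE: "vs.subspace E" "E \<subseteq> V" using E by (auto simp: subcoalgebra_def)
  obtain f where f: "lform f" "\<And>w. w \<in> E \<Longrightarrow> f w = 0" "f \<one> = 1" using sep_lform[OF sE(1) 1] by blast
  define h where "h = (\<lambda>x. f x - \<epsilon> x)"
  have h: "lform h" "h \<one> = 0"
    using f cu_lform by (auto simp: h_def lin_map_def algebra_simps)
  have hE: "h x = - \<epsilon> x" if "x \<in> E" for x using f that by (simp add: h_def)
  have pow: "cfp h N x = (-1) ^ N * \<epsilon> x" if "x \<in> E" for N x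
    using that
  proof (induction N arbitrary: x)
    case (Suc N)
    obtain ps where ps: "cop x ps" "set ps \<subseteq> E \<times> E" using subcoalgebra_cop[OF E(1) Suc.prems] by blast
    have "cfp h (Suc N) x = psum (\<lambda>a b. (-1) ^ Suc N * \<epsilon> (\<epsilon> a \<odot> b)) ps"
      unfolding cfp.simps cf_cop[OF ps(1) h(1) cfp_lform[OF h(1)]]
      using ps(2) sE(2) by (intro psum_cong) (auto simp: hE Suc.IH lin_map_scl[OF cu_lform] subset_iff)
    also have "\<dots> = (-1) ^ Suc N * \<epsilon> (psum (\<lambda>a b. \<epsilon> a \<odot> b) ps)"
      unfolding psum_mult_left using copD[OF ps(1)] by (subst lin_map_psum[OF vsp cu_lform]) auto
    finally show ?case using cop_cu[OF ps(1)] by simp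
  qed simp
  have e0: "\<epsilon> x = 0" if "x \<in> E" for x
  proof -
    have xV: "x \<in> V" using that sE by blast
    define N where "N = Suc (Max (insert 0 {m. comp x m \<noteq> 0}))"
    have N: "m < N" if "comp x m \<noteq> 0" for m
      using that comp_finite[OF xV] by (auto simp: N_def less_Suc_eq_le)
    have "cfp h N x = cfp h N (\<Sum>m | comp x m \<noteq> 0. comp x m)" using comp_sum[OF xV] by simp
    also have "\<dots> = (\<Sum>m | comp x m \<noteq> 0. cfp h N (comp x m))"
      using comp_D[OF xV] by (intro lin_map_sum[OF vsp cfp_lform[OF h(1)]]) auto
    also have "\<dots> = 0" using cfp_nilpotent[OF h comp_D[OF xV] N] by simp
    finally show ?thesis using pow[OF that, of N] by simp
  qed
  have "x = 0" if xE: "x \<in> E" for x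
  proof -
    obtain ps where ps: "cop x ps" "set ps \<subseteq> E \<times> E" using subcoalgebra_cop[OF E(1) xE] by blast
    have "psum (\<lambda>a b. \<epsilon> a \<odot> b) ps = 0" using ps(2) e0 by (intro psum_0) auto
    then show ?thesis using cop_cu[OF ps(1)] by simp
  qed
  then show False using E(2) vs.subspace_0[OF sE(1)] by blast
qed

lemma D0_subcoalgebra: "subcoalgebra H (D 0)"
proof -
  have "coprd H x \<in> car (tensor_space (subsp H (D 0)) (subsp H (D 0)))" if "x \<in> D 0" for x
  proof -
    have "coprd H x = fun_scale (\<epsilon> x) (pt \<one> \<one>)"
      using D0_eq[OF that] lin_map_scl[OF coprd_lin one_V, of "\<epsilon> x"] coprd_unit by simp
    also have "\<dots> = pt (\<epsilon> x \<odot> \<one>) \<one>" by (rule pure_tensor_scl)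
    finally show ?thesis
      using pure_tensor_in[of "\<epsilon> x \<odot> \<one>" "subsp H (D 0)" \<one> "subsp H (D 0)"] D_scl[OF one_D] by simp
  qed
  then show ?thesis using D_subspace D_V by (auto simp: subcoalgebra_def)
qed

text \<open>Every nonzero subcoalgebra contains the line spanned by \<open>1\<close>, which is \<open>H\<^sub>0\<close>; so this line is the only
  simple subcoalgebra.\<close>

lemma coradical_eq: "coradical H = D 0"
proof -
  have D0: "D 0 \<noteq> {0}" using one_D one_nz by blast
  have le: "D 0 \<subseteq> E" if "subcoalgebra H E" "E \<noteq> {0}" for E
    using one_in_subcoalgebra[OF that] that(1) unfolding D0_span
    by (intro vs.span_minimal) (auto simp: subcoalgebra_def)
  have "simple_subcoalgebra H E \<longleftrightarrow> E = D 0" for E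
  proof
    assume "simple_subcoalgebra H E"
    then show "E = D 0" using le[of E] D0_subcoalgebra D0 unfolding simple_subcoalgebra_def by blast
  next
    assume "E = D 0"
    then show "simple_subcoalgebra H E" using D0_subcoalgebra D0 le
      unfolding simple_subcoalgebra_def by blast
  qed
  then have "{E. simple_subcoalgebra H E} = {D 0}" by blast
  then show ?thesis using D_subspace by (simp add: coradical_def vspan_def)
qed

section \<open>The coradical filtration in terms of linear forms\<close>

abbreviation C where "C \<equiv> corad_filt H"

lemma lin_map_subsp: "lin_map W U f \<Longrightarrow> A \<subseteq> car W \<Longrightarrow> lin_map (subsp W A) U f"
  by (simp add: lin_map_def subset_iff)

text \<open>The space \<open>H \<otimes> F\<^sub>j + F\<^sub>0 \<otimes> H\<close> is the kernel of \<open>H \<otimes> H \<rightarrow> H / F\<^sub>0 \<otimes> H / F\<^sub>j\<close>, and products of linear forms separate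
  the points of the target.  For the harder direction the quotients are represented by the
  complements \<open>A = ker \<epsilon>\<close> of \<open>F\<^sub>0\<close> and \<open>B\<close> of \<open>F\<^sub>j\<close>.\<close>

lemma corad_Suc_iff:
  assumes sC: "vs.subspace (C j)" and CV: "C j \<subseteq> V"
  shows "x \<in> C (Suc j) \<longleftrightarrow> x \<in> V \<and>
    (\<forall>f g. lform f \<longrightarrow> lform g \<longrightarrow> f \<one> = 0 \<longrightarrow> (\<forall>y\<in>C j. g y = 0) \<longrightarrow> cf f g x = 0)"
    (is "_ \<longleftrightarrow> _ \<and> ?R")
proof (intro iffI conjI)
  assume x: "x \<in> C (Suc j)"
  then show "x \<in> V" by simp
  from x obtain u v where uv: "u \<in> car (tensor_space H (subsp H (C j)))"
    "v \<in> car (tensor_space (subsp H (D 0)) H)" "coprd H x = u + v"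
    by (auto simp: coradical_eq)
  obtain us where us: "set us \<subseteq> V \<times> C j" "u = psum pt us"
    using tensor_space_list[OF vsp uv(1)] by auto
  obtain ws where ws: "set ws \<subseteq> D 0 \<times> V" "v = psum pt ws"
    using tensor_space_list[OF is_vspace_subsp[OF vsp D_subspace] uv(2)] by auto
  have c: "cop x (us @ ws)" using us ws uv \<open>x \<in> V\<close> D_V CV by (auto simp: cop_def)
  show ?R
  proof (intro allI impI)
    fix f g assume fg: "lform f" "lform g" "f \<one> = 0" "\<forall>y\<in>C j. g y = 0"
    have "psum (\<lambda>a b. f a * g b) us = 0" using us fg by (intro psum_0) auto
    moreover have "psum (\<lambda>a b. f a * g b) ws = 0"
      using ws lform_D0[OF fg(1,3)] by (intro psum_0) auto
    ultimately show "cf f g x = 0" using cf_cop[OF c fg(1,2)] by simp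
  qed
next
  assume "x \<in> V \<and> ?R"
  then have x: "x \<in> V" and R: ?R by auto
  obtain ps where ps: "cop x ps" using cop_ex[OF x] by blast
  obtain q where q: "Vector_Spaces.linear (scl H) (scl H) q" "\<And>x. q x \<in> C j" "\<And>x. x \<in> C j \<Longrightarrow> q x = x"
    using projection_onto_carrier[OF is_vspace_subsp[OF vsp sC]] by auto
  interpret q: Vector_Spaces.linear "scl H" "scl H" q by fact
  define A where "A = {a \<in> V. \<epsilon> a = 0}"
  define B where "B = {b \<in> V. q b = 0}"
  have sA: "vs.subspace A"
    by (auto simp: A_def vs.subspace_def lin_map_add[OF cu_lform] lin_map_scl[OF cu_lform])
  have sB: "vs.subspace B" by (auto simp: B_def vs.subspace_def q.add q.scale q.zero)
  define ps3 where "ps3 = map (\<lambda>(a, b). (a - \<epsilon> a \<odot> \<one>, b - q b)) ps"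
  have qV: "q b \<in> V" for b using q(2) CV by blast
  have "psum (pure_tensor (subsp H A) (subsp H B)) ps3 = 0"
  proof (rule psum_pure_eq_0[where \<Phi> = "{f. lform f \<and> f \<one> = 0}"
        and \<Psi> = "{g. lform g \<and> (\<forall>y\<in>C j. g y = 0)}"])
    show "is_vspace (subsp H A)" "is_vspace (subsp H B)" using is_vspace_subsp[OF vsp] sA sB by auto
    show "set ps3 \<subseteq> car (subsp H A) \<times> car (subsp H B)"
      using copD[OF ps] qV by (auto simp: ps3_def A_def B_def lin_map_diff[OF vsp cu_lform]
          lin_map_scl[OF cu_lform] q.diff q(2,3))
    show "lin_map (subsp H A) ground f" if "f \<in> {f. lform f \<and> f \<one> = 0}" for f
      using that by (auto intro: lin_map_subsp simp: A_def)
    show "lin_map (subsp H B) ground f" if "f \<in> {g. lform g \<and> (\<forall>y\<in>C j. g y = 0)}" for f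
      using that by (auto intro: lin_map_subsp simp: B_def)
    show "a = 0" if a: "a \<in> car (subsp H A)" "\<And>f. f \<in> {f. lform f \<and> f \<one> = 0} \<Longrightarrow> f a = 0" for a
    proof (rule ccontr)
      assume "a \<noteq> 0"
      then have "a \<notin> D 0" using a(1) D0_eq[of a] by (auto simp: A_def)
      then obtain f where "lform f" "\<And>w. w \<in> D 0 \<Longrightarrow> f w = 0" "f a = 1"
        using sep_lform[OF D_subspace] by blast
      then show False using a(2)[of f] by simp
    qed
    show "b = 0" if b: "b \<in> car (subsp H B)"
      "\<And>g. g \<in> {g. lform g \<and> (\<forall>y\<in>C j. g y = 0)} \<Longrightarrow> g b = 0" for b
    proof (rule ccontr)
      assume "b \<noteq> 0"
      then have "b \<notin> C j" using b(1) q(3)[of b] by (auto simp: B_def)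
      then obtain f where "lform f" "\<And>w. w \<in> C j \<Longrightarrow> f w = 0" "f b = 1"
        using sep_lform[OF sC] by blast
      then show False using b(2)[of f] by simp
    qed
    fix f g assume f: "f \<in> {f. lform f \<and> f \<one> = 0}" and g: "g \<in> {g. lform g \<and> (\<forall>y\<in>C j. g y = 0)}"
    from f g have fg: "lform f" "f \<one> = 0" "lform g" "\<And>y. y \<in> C j \<Longrightarrow> g y = 0" by auto
    have 1: "f (a - \<epsilon> a \<odot> \<one>) = f a" if "a \<in> V" for a
      using lin_map_diff[OF vsp fg(1) that V_scl[OF one_V]] lin_map_scl[OF fg(1) one_V] fg(2) by simp
    have 2: "g (b - q b) = g b" if "b \<in> V" for b
      using lin_map_diff[OF vsp fg(3) that qV] fg(4)[OF q(2)] by simp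
    have "psum (\<lambda>a b. f a * g b) ps3 = psum (\<lambda>a b. f a * g b) ps"
      unfolding ps3_def psum_map
      using copD[OF ps] by (intro psum_cong) (simp add: 1 2)
    then show "psum (\<lambda>a b. f a * g b) ps3 = 0" using R f g cf_cop[OF ps] by auto
  qed
  then have 3: "psum (\<lambda>a b. pt (a - \<epsilon> a \<odot> \<one>) (b - q b)) ps = 0" by (simp add: ps3_def psum_map)
  let ?u = "psum pt (map (\<lambda>(a, b). (a, q b)) ps)"
  let ?v = "psum pt (map (\<lambda>(a, b). (\<epsilon> a \<odot> \<one>, b - q b)) ps)"
  have "pt a b = pt a (q b) + pt (\<epsilon> a \<odot> \<one>) (b - q b) + pt (a - \<epsilon> a \<odot> \<one>) (b - q b)" for a b
    using pure_tensor_add_right[of H H a "q b" "b - q b"]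
      pure_tensor_add_left[of H H "\<epsilon> a \<odot> \<one>" "a - \<epsilon> a \<odot> \<one>" "b - q b"] by (simp add: add.assoc)
  then have "psum pt ps = psum (\<lambda>a b. pt a (q b) + pt (\<epsilon> a \<odot> \<one>) (b - q b)
      + pt (a - \<epsilon> a \<odot> \<one>) (b - q b)) ps"
    by (intro psum_cong) blast
  also have "\<dots> = ?u + ?v" unfolding psum_map using 3 by (simp add: psum_add)
  finally have "coprd H x = ?u + ?v" using ps by (simp add: cop_def)
  moreover have s: "set (map (\<lambda>(a, b). (a, q b)) ps) \<subseteq> V \<times> C j"
    "set (map (\<lambda>(a, b). (\<epsilon> a \<odot> \<one>, b - q b)) ps) \<subseteq> D 0 \<times> V"
    using copD[OF ps] q(2) qV D_scl[OF one_D] by auto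
  moreover have "?u \<in> car (tensor_space H (subsp H (C j)))"
    using tensor_space_psum[of "map (\<lambda>(a, b). (a, q b)) ps" H "subsp H (C j)"] s(1)
    by (simp only: subsp_sel pure_tensor_subsp)
  moreover have "?v \<in> car (tensor_space (subsp H (D 0)) H)"
    using tensor_space_psum[of "map (\<lambda>(a, b). (\<epsilon> a \<odot> \<one>, b - q b)) ps" "subsp H (D 0)" H] s(2)
    by (simp only: subsp_sel pure_tensor_subsp)
  ultimately show "x \<in> C (Suc j)" using x by (auto simp: coradical_eq)
qed

lemma corad_subspace: "vs.subspace (C j) \<and> C j \<subseteq> V"
proof (induction j)
  case 0
  show ?case using D_subspace D_V by (simp add: coradical_eq)
next
  case (Suc j)
  note iff = corad_Suc_iff[OF conjunct1[OF Suc] conjunct2[OF Suc]]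
  have "vs.subspace (C (Suc j))"
    unfolding vs.subspace_def
    by (auto simp: iff lin_map_0[OF vsp cf_lform] lin_map_add[OF cf_lform] lin_map_scl[OF cf_lform]
        simp del: corad_filt.simps)
  then show ?case using iff by blast
qed

text \<open>The filtration with integer indices, so that \<open>fil (i + j - 1)\<close> makes sense without truncation.\<close>

definition fil :: "int \<Rightarrow> 'a set" where
  "fil k = (if k < 0 then {0} else C (nat k))"

lemma fil_neg: "k < 0 \<Longrightarrow> fil k = {0}" by (simp add: fil_def)

lemma fil_0: "fil 0 = D 0" by (simp add: fil_def coradical_eq)

lemma fil_subspace: "vs.subspace (fil k)"
  using corad_subspace by (simp add: fil_def)

lemma fil_V: "fil k \<subseteq> V"
  using corad_subspace by (simp add: fil_def)

lemma fil_in_V [simp, intro]: "x \<in> fil k \<Longrightarrow> x \<in> V" using fil_V by blast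

lemmas fil_zero [simp, intro] = vs.subspace_0[OF fil_subspace]
  and fil_add [intro] = vs.subspace_add[OF fil_subspace]
  and fil_diff [intro] = vs.subspace_diff[OF fil_subspace]
  and fil_scl [intro] = vs.subspace_scale[OF fil_subspace]
  and fil_sum [intro] = vs.subspace_sum[OF fil_subspace]

definition kills :: "('a \<Rightarrow> 'k) \<Rightarrow> int \<Rightarrow> bool" where
  "kills f k \<longleftrightarrow> lform f \<and> (\<forall>x\<in>fil k. f x = 0)"

lemma kills_lform: "kills f k \<Longrightarrow> lform f" and killsD: "kills f k \<Longrightarrow> x \<in> fil k \<Longrightarrow> f x = 0"
  by (auto simp: kills_def)

lemma fil_step:
  assumes "i \<ge> 1"
  shows "x \<in> fil i \<longleftrightarrow> x \<in> V \<and>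
    (\<forall>f g. lform f \<longrightarrow> f \<one> = 0 \<longrightarrow> kills g (i - 1) \<longrightarrow> cf f g x = 0)"
proof -
  obtain j where j: "i = int (Suc j)" using assms by (metis not0_implies_Suc of_nat_0 zero_less_imp_eq_int
      int_one_le_iff_zero_less not_less_zero)
  have "fil i = C (Suc j)" "fil (i - 1) = C j" using j by (simp_all add: fil_def nat_add_distrib)
  then show ?thesis
    using corad_Suc_iff[OF conjunct1[OF corad_subspace] conjunct2[OF corad_subspace], of x j]
    unfolding kills_def by metis
qed

lemma fil_sep:
  assumes "x \<in> V" "\<And>f. kills f k \<Longrightarrow> f x = 0" shows "x \<in> fil k"
proof (rule ccontr)
  assume "x \<notin> fil k"
  then obtain f where "lform f" "\<And>w. w \<in> fil k \<Longrightarrow> f w = 0" "f x = 1"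
    using sep_lform[OF fil_subspace] by blast
  then show False using assms(2)[of f] by (auto simp: kills_def)
qed

lemma fil_Suc: "fil i \<subseteq> fil (i + 1)"
proof (cases "i < 0")
  case False
  have "fil (int j) \<subseteq> fil (int j + 1)" for j
  proof (induction j)
    case 0
    have "x \<in> fil 1" if x: "x \<in> D 0" for x
    proof -
      have "cf f g x = 0" if fg: "lform f" "f \<one> = 0" "kills g 0" for f g
      proof -
        have "cf f g \<one> = 0" using cf_cop[OF cop_one fg(1) kills_lform[OF fg(3)]] fg(2) by simp
        then show ?thesis using lform_D0[OF cf_lform[OF fg(1) kills_lform[OF fg(3)]] _ x] by simp
      qed
      then show ?thesis using fil_step[of 1 x] x by auto
    qed
    then show ?case by (auto simp: fil_0)
  next
    case (Suc j)
    have "kills g (int j)" if "kills g (int j + 1)" for g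
      using that Suc by (auto simp: kills_def)
    then show ?case using fil_step[of "int (Suc j)"] fil_step[of "int (Suc j) + 1"]
      by (auto simp: algebra_simps)
  qed
  from this[of "nat i"] show ?thesis using False by simp
qed (auto simp: fil_neg)

lemma fil_mono: assumes "i \<le> j" shows "fil i \<subseteq> fil j"
proof -
  have "fil i \<subseteq> fil (i + int n)" for n
  proof (induction n)
    case (Suc n)
    then show ?case using fil_Suc[of "i + int n"] by (auto simp: algebra_simps)
  qed simp
  from this[of "nat (j - i)"] show ?thesis using assms by simp
qed

lemma kills_mono: "kills f k \<Longrightarrow> j \<le> k \<Longrightarrow> kills f j"
  using fil_mono[of j k] by (auto simp: kills_def)

lemma one_fil: "k \<ge> 0 \<Longrightarrow> \<one> \<in> fil k"
  using fil_mono[of 0 k] one_D fil_0 by blast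

lemma kills_one: "kills f k \<Longrightarrow> k \<ge> 0 \<Longrightarrow> f \<one> = 0"
  using one_fil killsD by blast

lemma cf_comp:
  assumes f: "lform f" and g: "lform g" and x: "x \<in> V"
  shows "cf (\<lambda>y. f (comp y p)) (\<lambda>y. g (comp y q)) x
    = cf (\<lambda>y. f (comp y p)) (\<lambda>y. g (comp y q)) (comp x (p + q))"
proof -
  let ?f = "\<lambda>y. f (comp y p)" and ?g = "\<lambda>y. g (comp y q)"
  have l: "lform ?f" "lform ?g" using lin_map_comp[OF comp_lin] f g by auto
  have z: "cf ?f ?g y = 0" if y: "y \<in> D l" "l \<noteq> p + q" for y l
  proof -
    obtain ps where ps: "cop y ps" "\<And>a b. (a, b) \<in> set ps \<Longrightarrow> \<exists>p\<le>l. a \<in> D p \<and> b \<in> D (l - p)"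
      using cop_D[OF y(1)] by blast
    have "?f a * ?g b = 0" if ab: "(a, b) \<in> set ps" for a b
    proof -
      obtain r where r: "r \<le> l" "a \<in> D r" "b \<in> D (l - r)" using ps(2)[OF ab] by blast
      then show ?thesis using y(2) lin_map_0[OF vsp f] lin_map_0[OF vsp g]
        by (auto simp: comp_hom)
    qed
    then show ?thesis unfolding cf_cop[OF ps(1) l] by (rule psum_0)
  qed
  let ?S = "insert (p + q) {m. comp x m \<noteq> 0}"
  have s: "(\<Sum>m\<in>?S. comp x m) = x"
    by (rule comp_sum_superset[OF x]) (use comp_finite[OF x] in auto)
  have "cf ?f ?g x = cf ?f ?g (\<Sum>m\<in>?S. comp x m)" unfolding s ..
  also have "\<dots> = (\<Sum>m\<in>?S. cf ?f ?g (comp x m))"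
    by (rule lin_map_sum[OF vsp cf_lform[OF l]]) (use x in auto)
  also have "\<dots> = (\<Sum>m\<in>{p + q}. cf ?f ?g (comp x m))"
    using comp_finite[OF x] z comp_D[OF x] by (intro sum.mono_neutral_right) auto
  finally show ?thesis by simp
qed

text \<open>On \<open>H\<^sub>m\<close> a convolution product is the sum of the products of homogeneous parts of complementary
  degrees.  With \<open>cf_comp\<close> this shows that the filtration is homogeneous.\<close>

lemma cf_comp_sum:
  assumes f: "lform f" and g: "lform g" and x: "x \<in> D m"
  shows "cf f g x = (\<Sum>p\<le>m. cf (\<lambda>y. f (comp y p)) (\<lambda>y. g (comp y (m - p))) x)"
proof -
  obtain ps where ps: "cop x ps" "\<And>a b. (a, b) \<in> set ps \<Longrightarrow> \<exists>p\<le>m. a \<in> D p \<and> b \<in> D (m - p)"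
    using cop_D[OF x] by blast
  have l: "lform (\<lambda>y. f (comp y p))" "lform (\<lambda>y. g (comp y p))" for p
    using lin_map_comp[OF comp_lin] f g by auto
  have "psum (\<lambda>a b. f a * g b) ps = psum (\<lambda>a b. \<Sum>p\<le>m. f (comp a p) * g (comp b (m - p))) ps"
  proof (rule psum_cong)
    fix a b assume "(a, b) \<in> set ps"
    then obtain r where r: "r \<le> m" "a \<in> D r" "b \<in> D (m - r)" using ps(2) by blast
    have "(\<Sum>p\<le>m. f (comp a p) * g (comp b (m - p))) = (\<Sum>p\<in>{r}. f (comp a p) * g (comp b (m - p)))"
      using r lin_map_0[OF vsp f] by (intro sum.mono_neutral_right) (auto simp: comp_hom)
    then show "f a * g b = (\<Sum>p\<le>m. f (comp a p) * g (comp b (m - p)))"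
      using r by (simp add: comp_hom)
  qed
  then show ?thesis unfolding cf_cop[OF ps(1) f g] cf_cop[OF ps(1) l] psum_sum .
qed

text \<open>The filtration is compatible with the grading: homogeneous parts of a form that kills \<open>1\<close> or \<open>F\<^sub>j\<close>
  kill it again, by induction on \<open>j\<close>.\<close>

lemma comp_fil: "x \<in> fil k \<Longrightarrow> comp x m \<in> fil k"
proof -
  have "comp x m \<in> fil (int j)" if "x \<in> fil (int j)" for j x m
    using that
  proof (induction j arbitrary: x m)
    case 0
    then show ?case by (auto simp: fil_0 comp_hom)
  next
    case (Suc j)
    have x: "x \<in> V" using Suc.prems by auto
    have "cf f g (comp x m) = 0" if fg: "lform f" "f \<one> = 0" "kills g (int j)" for f g
    proof -
      note g = kills_lform[OF fg(3)]
      have l: "lform (\<lambda>y. f (comp y p))" "lform (\<lambda>y. g (comp y p))" for p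
        using lin_map_comp[OF comp_lin] fg(1) g by auto
      have "cf (\<lambda>y. f (comp y p)) (\<lambda>y. g (comp y (m - p))) (comp x m) = 0" if p: "p \<le> m" for p
      proof -
        have "f (comp \<one> p) = 0" using fg(2) lin_map_0[OF vsp fg(1)] by (simp add: comp_hom[OF one_D])
        moreover have "kills (\<lambda>y. g (comp y (m - p))) (int (Suc j) - 1)"
          using l Suc.IH killsD[OF fg(3)] by (auto simp: kills_def)
        ultimately have "cf (\<lambda>y. f (comp y p)) (\<lambda>y. g (comp y (m - p))) x = 0"
          using Suc.prems l(1)[of p] fil_step[of "int (Suc j)" x] by auto
        then show ?thesis using cf_comp[OF fg(1) g x, of p "m - p"] p by simp
      qed
      then show ?thesis using cf_comp_sum[OF fg(1) g comp_D[OF x]] by simp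
    qed
    then show ?case using fil_step[of "int (Suc j)" "comp x m"] x by auto
  qed
  from this[of x "nat k"] show "x \<in> fil k \<Longrightarrow> comp x m \<in> fil k"
    by (cases "k < 0") (auto simp: fil_neg lin_map_0[OF vsp comp_lin])
qed

text \<open>The filtration exhausts \<open>H\<close>; in \<open>H\<^sub>m\<close> it has length at most \<open>m\<close>.\<close>

lemma D_fil: "x \<in> D m \<Longrightarrow> x \<in> fil (int m)"
proof (induction m arbitrary: x rule: less_induct)
  case (less m)
  show ?case
  proof (cases "m = 0")
    case False
    obtain ps where ps: "cop x ps" "\<And>a b. (a, b) \<in> set ps \<Longrightarrow> \<exists>p\<le>m. a \<in> D p \<and> b \<in> D (m - p)"
      using cop_D[OF less.prems] by blast
    have "cf f g x = 0" if fg: "lform f" "f \<one> = 0" "kills g (int m - 1)" for f g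
      unfolding cf_cop[OF ps(1) fg(1) kills_lform[OF fg(3)]]
    proof (rule psum_0)
      fix a b assume "(a, b) \<in> set ps"
      then obtain p where p: "p \<le> m" "a \<in> D p" "b \<in> D (m - p)" using ps(2) by blast
      show "f a * g b = 0"
      proof (cases "p = 0")
        case True
        then show ?thesis using lform_D0[OF fg(1,2)] p by simp
      next
        case p0: False
        then have "b \<in> fil (int (m - p))" using less.IH[of "m - p" b] p False by simp
        moreover have "int (m - p) \<le> int m - 1" using p0 p by simp
        ultimately have "b \<in> fil (int m - 1)" using fil_mono by blast
        then show ?thesis using killsD[OF fg(3)] by simp
      qed
    qed
    then show ?thesis using fil_step[of "int m" x] False less.prems by auto
  qed (use less.prems fil_0 in simp)
qed

lemma D_fil_ge: "x \<in> D m \<Longrightarrow> int m \<le> k \<Longrightarrow> x \<in> fil k"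
  using D_fil fil_mono by blast

section \<open>The coproduct respects the coradical filtration\<close>

text \<open>\<open>contr g\<close> is the map \<open>(id \<otimes> g) \<circ> \<Delta>\<close>, the action of the form \<open>g\<close> on \<open>H\<close>.\<close>

definition contr :: "('a \<Rightarrow> 'k) \<Rightarrow> 'a \<Rightarrow> 'a" where
  "contr g x = tensor_lift H H (\<lambda>a b. g b \<odot> a) (coprd H x)"

lemma contr_cop: "cop x ps \<Longrightarrow> lform g \<Longrightarrow> contr g x = psum (\<lambda>a b. g b \<odot> a) ps"
  unfolding contr_def by (rule lift_cop[OF _ vsp lform_scl_bilin(2)[OF _ lin_map_id(1)]])

lemma contr_lin: "lform g \<Longrightarrow> lin (contr g)"
  unfolding contr_def
  by (rule lin_map_comp[OF coprd_lin tensor_lift_lin[OF vsp vsp vsp lform_scl_bilin(2)[OF _ lin_map_id(1)]]])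

lemma contr_V [simp, intro]: "lform g \<Longrightarrow> x \<in> V \<Longrightarrow> contr g x \<in> V"
  using lin_map_car[OF contr_lin] by blast

lemma lform_contr:
  assumes "lform f" "lform g" "x \<in> V" shows "f (contr g x) = cf f g x"
proof -
  obtain ps where ps: "cop x ps" using cop_ex[OF assms(3)] by blast
  have "f (psum (\<lambda>a b. g b \<odot> a) ps) = psum (\<lambda>a b. f (g b \<odot> a)) ps"
    using copD[OF ps] by (intro lin_map_psum[OF vsp assms(1)]) auto
  also have "\<dots> = psum (\<lambda>a b. f a * g b) ps"
    using copD[OF ps] by (intro psum_cong) (auto simp: lin_map_scl[OF assms(1)])
  finally show ?thesis by (simp add: contr_cop[OF ps assms(2)] cf_cop[OF ps assms(1,2)])
qed

lemma cf_cu_left: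
  assumes "lform g" "x \<in> V" shows "cf \<epsilon> g x = g x"
proof -
  obtain ps where ps: "cop x ps" using cop_ex[OF assms(2)] by blast
  have "g x = g (psum (\<lambda>a b. \<epsilon> a \<odot> b) ps)" using cop_cu[OF ps] by simp
  also have "\<dots> = psum (\<lambda>a b. g (\<epsilon> a \<odot> b)) ps"
    using copD[OF ps] by (intro lin_map_psum[OF vsp assms(1)]) auto
  also have "\<dots> = psum (\<lambda>a b. \<epsilon> a * g b) ps"
    using copD[OF ps] by (intro psum_cong) (auto simp: lin_map_scl[OF assms(1)])
  finally show ?thesis by (simp add: cf_cop[OF ps cu_lform assms(1)])
qed

lemma kills_cf_aug:
  assumes "lform f" "f \<one> = 0" "kills g (k - 1)" "x \<in> fil k" "k \<ge> 0"
  shows "cf f g x = 0"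
proof (cases "k = 0")
  case True
  note g = kills_lform[OF assms(3)]
  have "cf f g \<one> = 0" using cf_cop[OF cop_one assms(1) g] assms(2) by simp
  then show ?thesis using lform_D0[OF cf_lform[OF assms(1) g]] assms(4) True fil_0 by simp
qed (use assms fil_step[of k x] in auto)

text \<open>Every form is a multiple of \<open>\<epsilon>\<close> plus a form vanishing at \<open>1\<close>; the first part contributes a multiple of
  \<open>g x = 0\<close>.\<close>

lemma cf_kills_0:
  assumes f: "lform f" and g: "kills g k" and x: "x \<in> fil k" and k: "k \<ge> 0"
  shows "cf f g x = 0"
proof -
  note gl = kills_lform[OF g]
  define f' where "f' = (\<lambda>y. f y - f \<one> * \<epsilon> y)"
  have f': "lform f'" "f' \<one> = 0"
    using f cu_lform by (auto simp: f'_def lin_map_def algebra_simps)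
  obtain ps where ps: "cop x ps" using cop_ex x by blast
  have "cf f g x = psum (\<lambda>a b. f' a * g b + f \<one> * (\<epsilon> a * g b)) ps"
    unfolding cf_cop[OF ps f gl] by (intro psum_cong) (simp add: f'_def algebra_simps)
  also have "\<dots> = cf f' g x + f \<one> * cf \<epsilon> g x"
    by (simp add: psum_add psum_mult_left cf_cop[OF ps f'(1) gl] cf_cop[OF ps cu_lform gl])
  also have "\<dots> = 0"
    using kills_cf_aug[OF f' kills_mono[OF g] x k] cf_cu_left[OF gl] x killsD[OF g x] by auto
  finally show ?thesis .
qed

text \<open>Membership of \<open>contr g x\<close> in \<open>F\<^sub>c\<^sub>+\<^sub>1\<close> is tested by convolution products \<open>f * h\<close> with \<open>h\<close> vanishing on \<open>F\<^sub>c\<close>.  By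
  coassociativity the value is that of \<open>f * (h * g)\<close> at \<open>x\<close>, and \<open>h * g\<close> vanishes on \<open>F\<^sub>c\<^sub>+\<^sub>b\<close> by the induction
  hypothesis.\<close>

lemma contr_fil:
  assumes "kills g (b - 1)" "b \<ge> 0" "x \<in> fil (int c + b)"
  shows "contr g x \<in> fil (int c)"
  using assms
proof (induction c arbitrary: x)
  case 0
  note g = kills_lform[OF 0(1)]
  show ?case
  proof (rule fil_sep)
    show "contr g x \<in> V" using 0 g by auto
    fix f assume f: "kills f (int 0)"
    have "cf f g x = 0" using kills_cf_aug[of f g b x] kills_lform[OF f] kills_one[OF f] 0 by auto
    then show "f (contr g x) = 0" using lform_contr[OF kills_lform[OF f] g] 0 by auto
  qed
next
  case (Suc c)
  note g = kills_lform[OF Suc.prems(1)]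
  have x: "x \<in> V" using Suc.prems by auto
  have "cf f h (contr g x) = 0" if fh: "lform f" "f \<one> = 0" "kills h (int c)" for f h
  proof -
    note h = kills_lform[OF fh(3)]
    have "cf h g z = 0" if "z \<in> fil (int c + b)" for z
      using Suc.IH[OF Suc.prems(1,2) that] killsD[OF fh(3)] lform_contr[OF h g fil_in_V[OF that]]
      by simp
    then have "kills (cf h g) (int (Suc c) + b - 1)"
      using cf_lform[OF h g] by (auto simp: kills_def)
    then have "cf f (cf h g) x = 0"
      by (rule kills_cf_aug[OF fh(1,2)]) (use Suc.prems in auto)
    then show ?thesis using lform_contr[OF cf_lform[OF fh(1) h] g x] cf_assoc[OF fh(1) h g x] by simp
  qed
  then show ?case using fil_step[of "int (Suc c)"] contr_V[OF g x] by auto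
qed

text \<open>Dually: the coproduct maps \<open>F\<^sub>i\<close> into the sum of the \<open>F\<^sub>a \<otimes> F\<^sub>i\<^sub>-\<^sub>a\<close>.\<close>

lemma cf_kills:
  assumes f: "kills f (a - 1)" and g: "kills g (b - 1)" and x: "x \<in> fil i"
    and "a \<ge> 0" "b \<ge> 0" "i < a + b"
  shows "cf f g x = 0"
proof -
  have x': "x \<in> fil (a - 1 + b)" using x fil_mono[of i "a - 1 + b"] assms by auto
  show ?thesis
  proof (cases "a = 0")
    case True
    then show ?thesis
      using cf_kills_0[OF kills_lform[OF f] g, of x] x' assms(5) fil_neg[of "-1"] lin_map_0[OF vsp cf_lform[OF kills_lform[OF f] kills_lform[OF g]]]
      by (cases "b = 0") auto
  next
    case False
    then have "contr g x \<in> fil (a - 1)" using contr_fil[OF g, of x "nat (a - 1)"] x' assms by simp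
    then show ?thesis
      using lform_contr[OF kills_lform[OF f] kills_lform[OF g] fil_in_V[OF x]] killsD[OF f] by simp
  qed
qed

section \<open>Bases adapted to the filtration\<close>

lemma D_fin_dim: obtains B where "finite B" "vs.independent B" "B \<subseteq> D m" "vs.span B = D m"
proof -
  obtain S where S: "finite S" "vs.span S = D m" using fin[of m] by (auto simp: finite_dim_def vspan_def)
  obtain B where B: "B \<subseteq> D m" "vs.independent B" "D m \<subseteq> vs.span B" using vs.maximal_independent_subset by blast
  have "finite B" using vs.independent_span_bound[OF S(1) B(2)] B(1) S(2) by auto
  moreover have "vs.span B = D m" using vs.span_subspace[OF B(1,3) D_subspace] .
  ultimately show ?thesis using that B by blast
qed

lemma D_independent_finite: "vs.independent B \<Longrightarrow> B \<subseteq> D m \<Longrightarrow> finite B"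
  using D_fin_dim[of m] vs.independent_span_bound by metis

definition adapted :: "nat \<Rightarrow> 'a set \<Rightarrow> bool" where
  "adapted p B \<longleftrightarrow> finite B \<and> vs.independent B \<and> B \<subseteq> D p \<and> vs.span B = D p \<and>
     (\<forall>k. vs.span (B \<inter> fil k) = fil k \<inter> D p)"

lemma adapted_ex: "\<exists>B. adapted p B"
proof -
  define U where "U n = fil (int n) \<inter> D p" for n
  have sU: "vs.subspace (U n)" for n unfolding U_def using fil_subspace D_subspace by (intro vs.subspace_inter)
  have Um: "U n \<subseteq> U (Suc n)" for n unfolding U_def using fil_mono[of "int n" "int (Suc n)"] by auto
  let ?P = "\<lambda>n B. B \<subseteq> U n \<and> vs.independent B \<and> U n \<subseteq> vs.span B"
  have "\<exists>B. \<forall>n. ?P n (B n) \<and> B n \<subseteq> B (Suc n)"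
  proof (rule dependent_nat_choice)
    show "\<exists>B. ?P 0 B" by (rule vs.maximal_independent_subset[of "U 0"]) (intro exI conjI)
    fix B n assume "?P n B"
    then have "B \<subseteq> U (Suc n)" "vs.independent B" using Um by auto
    then show "\<exists>B'. ?P (Suc n) B' \<and> B \<subseteq> B'"
      by (rule vs.maximal_independent_subset_extend) (intro exI conjI)
  qed
  then obtain B where B: "\<And>n. ?P n (B n)" "\<And>n. B n \<subseteq> B (Suc n)" by blast
  have Bm: "B i \<subseteq> B j" if "i \<le> j" for i j using lift_Suc_mono_le[of B i j] B(2) that by blast
  have sB: "vs.span (B n) = U n" for n using B(1)[of n] sU vs.span_subspace by blast
  have Up: "U n = D p" if "n \<ge> p" for n using D_fil_ge that by (auto simp: U_def)
  have "vs.span (B p \<inter> fil k) = fil k \<inter> D p" for k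
  proof (rule vs.span_subspace)
    show "B p \<inter> fil k \<subseteq> fil k \<inter> D p" using B(1)[of p] by (auto simp: U_def)
    show "vs.subspace (fil k \<inter> D p)" using fil_subspace D_subspace by (intro vs.subspace_inter)
    show "fil k \<inter> D p \<subseteq> vs.span (B p \<inter> fil k)"
    proof (cases "k < 0")
      case True
      then show ?thesis by (auto simp: fil_neg vs.span_zero)
    next
      case False
      then obtain n where n: "k = int n" by (metis zero_le_imp_eq_int linorder_not_le)
      show ?thesis
      proof (cases "n \<le> p")
        case True
        have "B n \<subseteq> B p \<inter> fil k" using Bm[OF True] B(1)[of n] n by (auto simp: U_def)
        from vs.span_mono[OF this] show ?thesis using sB[of n] n by (simp add: U_def)
      next
        case False
        then have "B p \<inter> fil k = B p" using B(1)[of p] D_fil_ge[of _ p k] n by (auto simp: U_def)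
        then show ?thesis using sB[of p] Up[of p] by auto
      qed
    qed
  qed
  moreover have "B p \<subseteq> D p" using B(1)[of p] by (auto simp: U_def)
  ultimately have "adapted p (B p)"
    using B(1)[of p] sB[of p] Up[of p] D_independent_finite unfolding adapted_def by auto
  then show ?thesis by blast
qed

definition Bas :: "nat \<Rightarrow> 'a set" where "Bas p = (SOME B. adapted p B)"

lemma Bas_adapted: "adapted p (Bas p)"
  unfolding Bas_def by (rule someI_ex[OF adapted_ex])

lemma Bas_finite [simp, intro]: "finite (Bas p)" and Bas_indep: "vs.independent (Bas p)"
  and Bas_D: "b \<in> Bas p \<Longrightarrow> b \<in> D p" and Bas_span: "vs.span (Bas p) = D p"
  and Bas_fil: "vs.span (Bas p \<inter> fil k) = fil k \<inter> D p"
  using Bas_adapted[of p] unfolding adapted_def by blast+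

definition ht :: "'a \<Rightarrow> nat" where "ht b = (LEAST k. b \<in> C k)"

lemma ht_fil: "b \<in> D p \<Longrightarrow> b \<in> fil (int k) \<longleftrightarrow> ht b \<le> k"
proof -
  assume b: "b \<in> D p"
  have "b \<in> C p" using D_fil[OF b] by (simp add: fil_def)
  then have "b \<in> C (ht b)" unfolding ht_def by (rule LeastI)
  then have "b \<in> fil (int (ht b))" by (simp add: fil_def)
  moreover have "ht b \<le> k" if "b \<in> fil (int k)"
    unfolding ht_def using that by (intro Least_le) (simp add: fil_def)
  ultimately show ?thesis using fil_mono[of "int (ht b)" "int k"] by (meson of_nat_mono subsetD)
qed

text \<open>The coordinate of \<open>x\<close> at the element \<open>b\<close> of the adapted basis of \<open>H\<^sub>p\<close>, as a form on all of \<open>H\<close>.\<close>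

definition coord :: "nat \<Rightarrow> 'a \<Rightarrow> 'a \<Rightarrow> 'k" where
  "coord p b x = vs.representation (Bas p) (comp x p) b"

lemma coord_lform: "lform (coord p b)"
proof -
  have c: "comp x p \<in> vs.span (Bas p)" if "x \<in> V" for x using comp_D[OF that] Bas_span by simp
  show ?thesis
    using lin_map_add[OF comp_lin] lin_map_scl[OF comp_lin]
    by (auto simp: lin_map_def coord_def vs.representation_add[OF Bas_indep c c]
        vs.representation_scale[OF Bas_indep c])
qed

lemma coord_sum: "x \<in> D p \<Longrightarrow> (\<Sum>b\<in>Bas p. coord p b x \<odot> b) = x"
  unfolding coord_def using vs.sum_representation_eq[OF Bas_indep _ Bas_finite subset_refl] Bas_span
  by (simp add: comp_hom)

lemma coord_D: "x \<in> D l \<Longrightarrow> l \<noteq> p \<Longrightarrow> coord p b x = 0"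
  by (simp add: coord_def comp_hom vs.representation_zero)

text \<open>This is where the basis has to be adapted.\<close>

lemma coord_kills: assumes "b \<in> Bas p" shows "kills (coord p b) (int (ht b) - 1)"
  unfolding kills_def
proof (intro conjI coord_lform ballI)
  fix x assume x: "x \<in> fil (int (ht b) - 1)"
  let ?k = "int (ht b) - 1"
  have "comp x p \<in> vs.span (Bas p \<inter> fil ?k)" using comp_fil[OF x] comp_D x Bas_fil by auto
  moreover have "b \<notin> fil ?k"
  proof (cases "ht b = 0")
    case True
    then show ?thesis using vs.dependent_zero[of "Bas p"] Bas_indep assms by (auto simp: fil_neg)
  next
    case False
    then show ?thesis using ht_fil[OF Bas_D[OF assms], of "ht b - 1"] by (simp add: of_nat_diff)
  qed
  moreover have "vs.representation (Bas p \<inter> fil ?k) (comp x p) b = 0 \<or> b \<in> Bas p \<inter> fil ?k"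
    using vs.representation_ne_zero by blast
  ultimately show "coord p b x = 0"
    using vs.representation_extend[OF Bas_indep, of "comp x p" "Bas p \<inter> fil ?k"]
    by (auto simp: coord_def)
qed

definition pieces :: "int \<Rightarrow> nat \<Rightarrow> ('a \<times> 'a) set" where
  "pieces i m = {(u, v). \<exists>a p. a \<ge> 0 \<and> a \<le> i \<and> p \<le> m \<and> u \<in> fil a \<and> u \<in> D p
     \<and> v \<in> fil (i - a) \<and> v \<in> D (m - p)}"

lemma piecesD: "set ps \<subseteq> pieces i m \<Longrightarrow> (u, v) \<in> set ps \<Longrightarrow> \<exists>a p. a \<ge> 0 \<and> a \<le> i \<and> p \<le> m
    \<and> u \<in> fil a \<and> u \<in> D p \<and> v \<in> fil (i - a) \<and> v \<in> D (m - p)"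
  by (auto simp: pieces_def)

text \<open>In an adapted basis the coefficient of \<open>b \<otimes> b'\<close> in the coproduct is the value of a convolution
  product of coordinate forms, which vanishes when the heights of \<open>b\<close> and \<open>b'\<close> add up to more than \<open>i\<close>.\<close>

lemma cop_fil:
  assumes xk: "x \<in> fil i" and xm: "x \<in> D m"
  obtains ps where "cop x ps"
    "set ps \<subseteq> pieces i m"
proof -
  obtain qs where qs: "cop x qs" "\<And>a b. (a, b) \<in> set qs \<Longrightarrow> \<exists>p\<le>m. a \<in> D p \<and> b \<in> D (m - p)"
    using cop_D[OF xm] by blast
  define c where "c p b b' = cf (coord p b) (coord (m - p) b') x" for p b b'
  define S where "S = (SIGMA p:{..m}. Bas p \<times> Bas (m - p))"
  have finS: "finite S" by (simp add: S_def)
  have pt0: "pt (0 :: 'a) v = 0" "pt v 0 = 0" for v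
    using lin_map_0[of "subsp H UNIV" _ "\<lambda>a. _"] pure_tensor_scl[of 0 H H v v]
      pure_tensor_add_left[of H H 0 0 v] pure_tensor_add_right[of H H v 0 0] by auto
  have pts1: "pt (sum h I) v = (\<Sum>i\<in>I. pt (h i) v)" for h v and I :: "'a set"
    by (induction I rule: infinite_finite_induct) (simp_all add: pt0 pure_tensor_add_left)
  have pts2: "pt v (sum h I) = (\<Sum>i\<in>I. pt v (h i))" for h v and I :: "'a set"
    by (induction I rule: infinite_finite_induct) (simp_all add: pt0 pure_tensor_add_right)
  have fsum: "fun_scale (psum g qs) t = psum (\<lambda>a b. fun_scale (g a b) t) qs"
    for g and t :: "('a, 'a, 'k) tensor" and qs :: "('a \<times> 'a) list"
    by (induction qs) (auto simp: fun_scale_def fun_eq_iff algebra_simps)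
  have "psum pt qs = psum (\<lambda>u v. \<Sum>(p, b, b')\<in>S. fun_scale (coord p b u * coord (m - p) b' v) (pt b b')) qs"
  proof (rule psum_cong)
    fix u v assume "(u, v) \<in> set qs"
    then obtain r where r: "r \<le> m" "u \<in> D r" "v \<in> D (m - r)" using qs(2) by blast
    have "pt u v = pt (\<Sum>b\<in>Bas r. coord r b u \<odot> b) (\<Sum>b'\<in>Bas (m - r). coord (m - r) b' v \<odot> b')"
      using coord_sum r by simp
    also have "\<dots> = (\<Sum>b\<in>Bas r. \<Sum>b'\<in>Bas (m - r). fun_scale (coord r b u * coord (m - r) b' v) (pt b b'))"
      unfolding pts1 unfolding pts2
      by (intro sum.cong refl) (auto simp: pure_tensor_scl[symmetric] pure_tensor_scl_right fun_scale_def fun_eq_iff algebra_simps)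
    also have "\<dots> = (\<Sum>p\<le>m. \<Sum>b\<in>Bas p. \<Sum>b'\<in>Bas (m - p). fun_scale (coord p b u * coord (m - p) b' v) (pt b b'))"
      using r by (subst sum.mono_neutral_right[of "{..m}" "{r}"]) (auto simp: coord_D fun_scale_def zero_fun_def intro!: sum.neutral)
    also have "\<dots> = (\<Sum>(p, b, b')\<in>S. fun_scale (coord p b u * coord (m - p) b' v) (pt b b'))"
      unfolding S_def by (simp add: sum.Sigma sum.cartesian_product)
    finally show "pt u v = (\<Sum>(p, b, b')\<in>S. fun_scale (coord p b u * coord (m - p) b' v) (pt b b'))" .
  qed
  also have "\<dots> = (\<Sum>(p, b, b')\<in>S. fun_scale (c p b b') (pt b b'))"
    unfolding case_prod_unfold psum_sum
    by (intro sum.cong refl) (simp add: c_def cf_cop[OF qs(1) coord_lform coord_lform] fsum)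
  also have "\<dots> = (\<Sum>(p, b, b')\<in>{(p, b, b')\<in>S. c p b b' \<noteq> 0}. pt (c p b b' \<odot> b) b')"
    using finS by (intro sum.mono_neutral_cong_right) (auto simp: pure_tensor_scl[symmetric] fun_scale_def fun_eq_iff)
  finally have 1: "psum pt qs = (\<Sum>(p, b, b')\<in>{(p, b, b')\<in>S. c p b b' \<noteq> 0}. pt (c p b b' \<odot> b) b')" .
  have "finite {(p, b, b')\<in>S. c p b b' \<noteq> 0}" by (rule finite_subset[OF _ finS]) auto
  from finite_distinct_list[OF this] obtain ts
    where ts: "set ts = {(p, b, b')\<in>S. c p b b' \<noteq> 0}" "distinct ts" by blast
  define ps where "ps = map (\<lambda>(p, b, b'). (c p b b' \<odot> b, b')) ts"
  have "psum pt ps = (\<Sum>(p, b, b')\<leftarrow>ts. pt (c p b b' \<odot> b) b')"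
    unfolding ps_def by (induction ts) auto
  also have "\<dots> = psum pt qs" unfolding 1 ts(1)[symmetric] using sum_list_distinct_conv_sum_set[OF ts(2)] by blast
  finally have ps1: "psum pt ps = psum pt qs" .
  have P: "\<exists>a p. a \<ge> 0 \<and> a \<le> i \<and> p \<le> m \<and> u \<in> fil a \<and> u \<in> D p \<and> v \<in> fil (i - a) \<and> v \<in> D (m - p)"
    if uv: "(u, v) \<in> set ps" for u v
  proof -
    from uv obtain p b b' where p: "p \<le> m" "b \<in> Bas p" "b' \<in> Bas (m - p)" "c p b b' \<noteq> 0"
      "u = c p b b' \<odot> b" "v = b'" unfolding ps_def using ts by (auto simp: S_def)
    have "int (ht b) + int (ht b') \<le> i"
      using cf_kills[OF coord_kills[OF p(2)] coord_kills[OF p(3)] xk] p(4) by (force simp: c_def)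
    moreover have "b \<in> fil (int (ht b))" using ht_fil[OF Bas_D[OF p(2)]] by simp
    moreover have "b' \<in> fil (int (ht b'))" using ht_fil[OF Bas_D[OF p(3)]] by simp
    ultimately show ?thesis using p Bas_D fil_mono[of "int (ht b')" "i - int (ht b)"]
      by (intro exI[of _ "int (ht b)"] exI[of _ p]) auto
  qed
  have "u \<in> V \<and> v \<in> V" if "(u, v) \<in> set ps" for u v using P[OF that] by blast
  then have "set ps \<subseteq> V \<times> V" by auto
  then have "cop x ps" using ps1 qs(1) by (auto simp: cop_def)
  moreover have "set ps \<subseteq> pieces i m" using P by (auto simp: pieces_def)
  ultimately show ?thesis by (rule that)
qed

section \<open>Commutativity up to lower filtration\<close>

lemma pt_psum:
  assumes "\<And>a b. (a, b) \<in> set ps \<Longrightarrow> g a b \<in> V" "y \<in> V"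
  shows "pt (psum g ps) y = psum (\<lambda>a b. pt (g a b) y) ps" "pt y (psum g ps) = psum (\<lambda>a b. pt y (g a b)) ps"
proof -
  have "lin_map H (tensor_space H H) (\<lambda>u. pt u y)" "lin_map H (tensor_space H H) (pt y)"
    using pure_tensor_bilin[of H H] assms(2) by (auto simp: bilin_map_def)
  from this[THEN lin_map_psum[OF vsp], of ps g] assms(1)
  show "pt (psum g ps) y = psum (\<lambda>a b. pt (g a b) y) ps" "pt y (psum g ps) = psum (\<lambda>a b. pt y (g a b)) ps"
    by auto
qed

lemma pt_scl: "pt (c \<odot> a) b = pt a (c \<odot> b)"
  by (simp add: pure_tensor_scl[symmetric] pure_tensor_scl_right)

definition inner_pieces :: "int \<Rightarrow> nat \<Rightarrow> ('a \<times> 'a) set" where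
  "inner_pieces i m = {(u, v). \<exists>a p. 0 < a \<and> a < i \<and> 0 < p \<and> p < m \<and> u \<in> fil a \<and> u \<in> D p
     \<and> v \<in> fil (i - a) \<and> v \<in> D (m - p)}"

lemma inner_piecesD: "set ps \<subseteq> inner_pieces i m \<Longrightarrow> (u, v) \<in> set ps \<Longrightarrow>
    \<exists>a p. 0 < a \<and> a < i \<and> 0 < p \<and> p < m \<and> u \<in> fil a \<and> u \<in> D p \<and> v \<in> fil (i - a) \<and> v \<in> D (m - p)"
  by (auto simp: inner_pieces_def)

text \<open>In degree \<open>0\<close> only multiples of \<open>1\<close> are left, so the terms with a factor of degree \<open>0\<close> are determined by
  the counit axioms.  The other terms have positive indices because \<open>F\<^sub>0 = H\<^sub>0\<close>.\<close>

lemma cop_reduced: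
  assumes xi: "x \<in> fil i" and xm: "x \<in> D m" and m: "m > 0"
  obtains ps where "cop x ((x, \<one>) # (\<one>, x) # ps)"
    "set ps \<subseteq> inner_pieces i m"
proof -
  obtain qs where qs: "cop x qs"
    "set qs \<subseteq> pieces i m"
    using cop_fil[OF xi xm] by blast
  note V = copD[OF qs(1)] and qsD = piecesD[OF qs(2)]
  let ?P = "\<lambda>(u, v). u \<in> D 0" and ?Q = "\<lambda>(u, v). v \<in> D 0"
  let ?q1 = "filter (\<lambda>p. \<not> ?P p) qs"
  define ps where "ps = filter (\<lambda>p. \<not> ?Q p) ?q1"
  have "psum (\<lambda>u v. \<epsilon> u \<odot> v) ?q1 = 0"
  proof (rule psum_0)
    fix u v assume "(u, v) \<in> set ?q1"
    then obtain p where "u \<in> D p" "p \<noteq> 0" using qsD by force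
    then show "\<epsilon> u \<odot> v = 0" using cu_D by simp
  qed
  then have e1: "psum (\<lambda>u v. \<epsilon> u \<odot> v) (filter ?P qs) = x"
    using cop_cu(1)[OF qs(1)] psum_filter[of "\<lambda>u v. \<epsilon> u \<odot> v" qs ?P] by simp
  have "psum pt (filter ?P qs) = psum (\<lambda>u v. pt \<one> (\<epsilon> u \<odot> v)) (filter ?P qs)"
    using D0_eq by (intro psum_cong) (auto simp: pt_scl[symmetric])
  also have "\<dots> = pt \<one> (psum (\<lambda>u v. \<epsilon> u \<odot> v) (filter ?P qs))"
    using V by (subst pt_psum(2)) auto
  finally have s1: "psum pt (filter ?P qs) = pt \<one> x" unfolding e1 .
  have "psum (\<lambda>u v. \<epsilon> v \<odot> u) (filter ?P qs) = 0"
  proof (rule psum_0)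
    fix u v assume "(u, v) \<in> set (filter ?P qs)"
    then obtain p where p: "u \<in> D p" "v \<in> D (m - p)" "u \<in> D 0" using qsD by force
    show "\<epsilon> v \<odot> u = 0"
    proof (cases "p = 0")
      case True
      then show ?thesis using p(2) m cu_D[of v m] by simp
    next
      case False
      then show ?thesis using D_disjoint[OF p(1,3)] by simp
    qed
  qed
  moreover have "psum (\<lambda>u v. \<epsilon> v \<odot> u) ps = 0"
  proof (rule psum_0)
    fix u v assume "(u, v) \<in> set ps"
    then obtain p where "v \<in> D p" "p \<noteq> 0" using qsD unfolding ps_def by force
    then show "\<epsilon> v \<odot> u = 0" using cu_D by simp
  qed
  ultimately have e2: "psum (\<lambda>u v. \<epsilon> v \<odot> u) (filter ?Q ?q1) = x"
    using cop_cu(2)[OF qs(1)] psum_filter[of "\<lambda>u v. \<epsilon> v \<odot> u" qs ?P]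
      psum_filter[of "\<lambda>u v. \<epsilon> v \<odot> u" ?q1 ?Q] unfolding ps_def by simp
  have "psum pt (filter ?Q ?q1) = psum (\<lambda>u v. pt (\<epsilon> v \<odot> u) \<one>) (filter ?Q ?q1)"
    using D0_eq by (intro psum_cong) (auto simp: pt_scl)
  also have "\<dots> = pt (psum (\<lambda>u v. \<epsilon> v \<odot> u) (filter ?Q ?q1)) \<one>"
    using V by (subst pt_psum(1)) auto
  finally have s2: "psum pt (filter ?Q ?q1) = pt x \<one>" unfolding e2 .
  have "psum pt qs = psum pt ((x, \<one>) # (\<one>, x) # ps)"
    using s1 s2 psum_filter[of pt qs ?P] psum_filter[of pt ?q1 ?Q] by (simp add: ps_def algebra_simps)
  moreover have "set ps \<subseteq> set qs" by (auto simp: ps_def)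
  ultimately have c: "cop x ((x, \<one>) # (\<one>, x) # ps)" using qs(1) by (auto simp: cop_def)
  have "\<exists>a p. 0 < a \<and> a < i \<and> 0 < p \<and> p < m \<and> u \<in> fil a \<and> u \<in> D p
      \<and> v \<in> fil (i - a) \<and> v \<in> D (m - p)" if uv: "(u, v) \<in> set ps" for u v
  proof -
    obtain a p where ap: "a \<ge> 0" "a \<le> i" "p \<le> m" "u \<in> fil a" "u \<in> D p" "v \<in> fil (i - a)" "v \<in> D (m - p)"
      using qsD[of u v] uv unfolding ps_def by auto
    have "u \<notin> D 0" "v \<notin> D 0" using uv by (auto simp: ps_def)
    then have "a \<noteq> 0" "i - a \<noteq> 0" "p \<noteq> 0" "m - p \<noteq> 0" using ap fil_0 by metis+
    then show ?thesis using ap by (intro exI[of _ a] exI[of _ p]) auto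
  qed
  then have "set ps \<subseteq> inner_pieces i m" by (auto simp: inner_pieces_def)
  with c show ?thesis by (rule that)
qed

lemma cop_reduced_right:
  assumes "x \<in> fil i" "x \<in> D m" "m > 0"
  obtains ps where "cop x ((x, \<one>) # (\<one>, x) # ps)"
    "\<And>u v. (u, v) \<in> set ps \<Longrightarrow> \<exists>q<m. v \<in> fil (i - 1) \<and> v \<in> D q"
proof -
  obtain ps where ps: "cop x ((x, \<one>) # (\<one>, x) # ps)" "set ps \<subseteq> inner_pieces i m"
    using cop_reduced[OF assms] by blast
  have "\<exists>q<m. v \<in> fil (i - 1) \<and> v \<in> D q" if uv: "(u, v) \<in> set ps" for u v
  proof -
    obtain a p where "0 < a" "0 < p" "p < m" "v \<in> fil (i - a)" "v \<in> D (m - p)"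
      using inner_piecesD[OF ps(2) uv] by blast
    then show ?thesis using fil_mono[of "i - a" "i - 1"] by (intro exI[of _ "m - p"]) auto
  qed
  with ps(1) show ?thesis by (rule that)
qed

lemma cf_mul:
  assumes "cop x xs" "cop y ys" "lform f" "lform g"
  shows "cf f g (x \<cdot> y) = psum (\<lambda>a b. psum (\<lambda>c d. f (a \<cdot> c) * g (b \<cdot> d)) ys) xs"
  unfolding cf_cop[OF cop_mult[OF assms(1,2)] assms(3,4)] psum_concat psum_map ..

lemma fil_D_trivial: "x \<in> fil i \<Longrightarrow> x \<in> D m \<Longrightarrow> m > 0 \<Longrightarrow> i \<le> 0 \<Longrightarrow> x = 0"
  using fil_0 fil_neg[of i] D_disjoint[of x 0 m] by (cases "i = 0") auto

text \<open>Membership in the filtration is tested with forms \<open>f\<close> and \<open>g\<close> as in \<open>fil_step\<close>.  Insert the reduced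
  coproducts of \<open>x\<close> and \<open>y\<close>; apart from the terms in which \<open>f\<close> or \<open>g\<close> is applied to \<open>1\<close>, the right factors
  of the product lie low enough for \<open>g\<close> to kill them, by induction on the total degree.\<close>

lemma fil_mul_commutator_hom:
  assumes "x \<in> fil i" "x \<in> D m" "y \<in> fil j" "y \<in> D l"
  shows "x \<cdot> y \<in> fil (i + j) \<and> x \<cdot> y - y \<cdot> x \<in> fil (i + j - 1)"
  using assms
proof (induction "m + l" arbitrary: x y i j m l rule: less_induct)
  case less
  note x = less.prems(1,2) and y = less.prems(3,4)
  have xV: "x \<in> V" "y \<in> V" using x y by auto
  consider "m = 0" | "l = 0" | "m > 0" "l > 0" "i \<le> 0 \<or> j \<le> 0" | "m > 0" "l > 0" "i \<ge> 1" "j \<ge> 1" by linarith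
  then show ?case
  proof cases
    case 1
    then have "x \<cdot> y = \<epsilon> x \<odot> y" "y \<cdot> x = \<epsilon> x \<odot> y"
      using D0_eq[of x] x xV mul_scl(1)[OF one_V xV(2), of "\<epsilon> x"] mul_scl(2)[OF xV(2) one_V, of "\<epsilon> x"]
      by simp_all
    then show ?thesis using fil_mono[of j "i + j"] y fil_neg[of i] x by (cases "i < 0") auto
  next
    case 2
    then have "x \<cdot> y = \<epsilon> y \<odot> x" "y \<cdot> x = \<epsilon> y \<odot> x"
      using D0_eq[of y] y xV mul_scl(2)[OF xV(1) one_V, of "\<epsilon> y"] mul_scl(1)[OF one_V xV(1), of "\<epsilon> y"]
      by simp_all
    then show ?thesis using fil_mono[of i "i + j"] x fil_neg[of j] y by (cases "j < 0") auto
  next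
    case 3
    then have "x = 0 \<or> y = 0" using fil_D_trivial x y by blast
    then show ?thesis using xV by auto
  next
    case 4
    obtain ps where ps: "cop x ((x, \<one>) # (\<one>, x) # ps)"
      "\<And>u v. (u, v) \<in> set ps \<Longrightarrow> \<exists>q<m. v \<in> fil (i - 1) \<and> v \<in> D q" using cop_reduced_right[OF x 4(1)] by blast
    obtain qs where qs: "cop y ((y, \<one>) # (\<one>, y) # qs)"
      "\<And>u v. (u, v) \<in> set qs \<Longrightarrow> \<exists>q<l. v \<in> fil (j - 1) \<and> v \<in> D q" using cop_reduced_right[OF y 4(2)] by blast
    note psV = copD(2,3)[OF ps(1)] and qsV = copD(2,3)[OF qs(1)]
    have pV: "v \<in> V \<and> v \<in> fil (i - 1) \<and> v \<cdot> y \<in> fil (i + j - 1) \<and> v \<cdot> y - y \<cdot> v \<in> fil (i + j - 2)"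
      if uv: "(u, v) \<in> set ps" for u v
    proof -
      obtain q where q: "q < m" "v \<in> fil (i - 1)" "v \<in> D q" using ps(2)[OF uv] by blast
      then show ?thesis using less.hyps[of q l v "i - 1" y j] y by (auto simp: algebra_simps)
    qed
    have qV: "v \<in> V \<and> v \<in> fil (j - 1) \<and> x \<cdot> v \<in> fil (i + j - 1) \<and> x \<cdot> v - v \<cdot> x \<in> fil (i + j - 2)"
      if uv: "(u, v) \<in> set qs" for u v
    proof -
      obtain q where q: "q < l" "v \<in> fil (j - 1)" "v \<in> D q" using qs(2)[OF uv] by blast
      then show ?thesis using less.hyps[of m q x i v "j - 1"] x by (auto simp: algebra_simps)
    qed
    have pqV: "v \<cdot> w \<in> fil (i + j - 2) \<and> w \<cdot> v \<in> fil (i + j - 2)"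
      if uv: "(u, v) \<in> set ps" and uw: "(u', w) \<in> set qs" for u v u' w
    proof -
      obtain q where q: "q < m" "v \<in> fil (i - 1)" "v \<in> D q" using ps(2)[OF uv] by blast
      obtain r where r: "r < l" "w \<in> fil (j - 1)" "w \<in> D r" using qs(2)[OF uw] by blast
      show ?thesis
        using less.hyps[of q r v "i - 1" w "j - 1"] less.hyps[of r q w "j - 1" v "i - 1"] q r
        by (auto simp: algebra_simps)
    qed
    have "cf f g (x \<cdot> y) = 0" if f: "lform f" "f \<one> = 0" and g: "kills g (i + j - 1)" for f g
    proof -
      have g1: "g \<one> = 0" using kills_one[OF g] 4 by simp
      have gk: "g z = 0" if "z \<in> fil k" "k \<le> i + j - 1" for z k
        using killsD[OF g] fil_mono[OF that(2)] that(1) by blast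
      have gx: "g x = 0" "g y = 0" using gk[of _ i] gk[of _ j] x y 4 by auto
      have pz: "v \<in> V \<and> g v = 0 \<and> g (v \<cdot> y) = 0" if uv: "(u, v) \<in> set ps" for u v
        using pV[OF uv] gk[of v "i - 1"] gk[of "v \<cdot> y"] 4 by auto
      have qz: "v \<in> V \<and> g v = 0 \<and> g (x \<cdot> v) = 0" if uv: "(u, v) \<in> set qs" for u v
        using qV[OF uv] gk[of v "j - 1"] gk[of "x \<cdot> v"] 4 by auto
      have pq: "g (v \<cdot> w) = 0" if "(u, v) \<in> set ps" "(u', w) \<in> set qs" for u v u' w
        using pqV[OF that] gk[of "v \<cdot> w" "i + j - 2"] by simp
      show ?thesis
        unfolding cf_mul[OF ps(1) qs(1) f(1) kills_lform[OF g]]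
        using pz qz pq gx g1 f(2) psV qsV xV by (intro psum_0) auto
    qed
    then have prod: "x \<cdot> y \<in> fil (i + j)" using fil_step[of "i + j" "x \<cdot> y"] 4 xV by auto
    have "cf f g (x \<cdot> y - y \<cdot> x) = 0" if f: "lform f" "f \<one> = 0" and g: "kills g (i + j - 2)" for f g
    proof -
      note gl = kills_lform[OF g]
      have g1: "g \<one> = 0" using kills_one[OF g] 4 by simp
      have gk: "g z = 0" if "z \<in> fil k" "k \<le> i + j - 2" for z k
        using killsD[OF g] fil_mono[OF that(2)] that(1) by blast
      have pz: "v \<in> V \<and> g v = 0 \<and> g (v \<cdot> y) = g (y \<cdot> v)" if uv: "(u, v) \<in> set ps" for u v
        using pV[OF uv] gk[of v "i - 1"] gk[of "v \<cdot> y - y \<cdot> v"] 4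
          lin_map_diff[OF vsp gl, of "v \<cdot> y" "y \<cdot> v"] xV by auto
      have qz: "v \<in> V \<and> g v = 0 \<and> g (x \<cdot> v) = g (v \<cdot> x)" if uv: "(u, v) \<in> set qs" for u v
        using qV[OF uv] gk[of v "j - 1"] gk[of "x \<cdot> v - v \<cdot> x"] 4
          lin_map_diff[OF vsp gl, of "x \<cdot> v" "v \<cdot> x"] xV by auto
      have pq: "g (v \<cdot> w) = 0 \<and> g (w \<cdot> v) = 0" if "(u, v) \<in> set ps" "(u', w) \<in> set qs" for u v u' w
        using pqV[OF that] gk by blast
      have "cf f g (x \<cdot> y) - cf f g (y \<cdot> x) =
        psum (\<lambda>a b. psum (\<lambda>c d. f (a \<cdot> c) * g (b \<cdot> d) - f (c \<cdot> a) * g (d \<cdot> b)) ((y, \<one>) # (\<one>, y) # qs))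
          ((x, \<one>) # (\<one>, x) # ps)"
        unfolding cf_mul[OF ps(1) qs(1) f(1) gl] cf_mul[OF qs(1) ps(1) f(1) gl]
        by (subst psum_swap[of "\<lambda>c d a b. f (c \<cdot> a) * g (d \<cdot> b)"]) (simp only: psum_diff)
      also have "\<dots> = 0"
      (* Termwise: x (x) y and y (x) x cancel, being present in both orders; in all other terms g is
         applied to elements, or to commutators, of index at most i + j - 2. *)
      proof (intro psum_0)
        fix a b c d
        assume ab: "(a, b) \<in> set ((x, \<one>) # (\<one>, x) # ps)" and cd: "(c, d) \<in> set ((y, \<one>) # (\<one>, y) # qs)"
        note abV = psV[OF ab] and cdV = qsV[OF cd]
        consider "a = x" "b = \<one>" | "a = \<one>" "b = x" | "(a, b) \<in> set ps" using ab by auto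
        then show "f (a \<cdot> c) * g (b \<cdot> d) - f (c \<cdot> a) * g (d \<cdot> b) = 0"
        proof cases
          case 1
          then show ?thesis using cd g1 qz xV by auto
        next
          case 2
          then show ?thesis using cd g1 qz xV f(2) cdV by auto
        next
          case 3
          then show ?thesis using cd g1 pz[OF 3] pq[OF 3] xV abV by auto
        qed
      qed
      finally show ?thesis using lin_map_diff[OF vsp cf_lform[OF f(1) gl], of "x \<cdot> y" "y \<cdot> x"] xV by simp
    qed
    then have "x \<cdot> y - y \<cdot> x \<in> fil (i + j - 1)"
      using fil_step[of "i + j - 1" "x \<cdot> y - y \<cdot> x"] 4 xV by auto
    with prod show ?thesis ..
  qed
qed

lemma fil_hom_induct:
  assumes "x \<in> fil i" "\<And>m x. x \<in> fil i \<Longrightarrow> x \<in> D m \<Longrightarrow> P x" "P 0"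
    "\<And>x y. x \<in> fil i \<Longrightarrow> y \<in> fil i \<Longrightarrow> P x \<Longrightarrow> P y \<Longrightarrow> P (x + y)"
  shows "P x"
proof -
  have x: "x \<in> V" using assms(1) by auto
  have "finite S \<Longrightarrow> P (\<Sum>m\<in>S. comp x m)" for S
  proof (induction S rule: finite_induct)
    case (insert m S)
    have "P (comp x m)" using assms(2)[OF comp_fil[OF assms(1)] comp_D[OF x]] .
    moreover have "sum (comp x) S \<in> fil i" using comp_fil[OF assms(1)] by auto
    ultimately show ?case using insert comp_fil[OF assms(1)] by (auto intro!: assms(4))
  qed (use assms in auto)
  from this[OF comp_finite[OF x]] show ?thesis unfolding comp_sum[OF x] .
qed

lemma fil_mul: assumes x: "x \<in> fil i" and y: "y \<in> fil j" shows "x \<cdot> y \<in> fil (i + j)"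
proof (rule fil_hom_induct[OF x])
  fix m x assume x: "x \<in> fil i" "x \<in> D m"
  show "x \<cdot> y \<in> fil (i + j)"
  proof (rule fil_hom_induct[OF y])
    fix y z assume "y \<in> fil j" "z \<in> fil j" "x \<cdot> y \<in> fil (i + j)" "x \<cdot> z \<in> fil (i + j)"
    then show "x \<cdot> (y + z) \<in> fil (i + j)" using x mul_add(2)[of x y z] by auto
  qed (use x fil_mul_commutator_hom in auto)
next
  fix u v assume "u \<in> fil i" "v \<in> fil i" "u \<cdot> y \<in> fil (i + j)" "v \<cdot> y \<in> fil (i + j)"
  then show "(u + v) \<cdot> y \<in> fil (i + j)" using y mul_add(1)[of u v y] by auto
qed (use y in auto)

lemma commutator:
  assumes x: "x \<in> fil i" and y: "y \<in> fil j" shows "x \<cdot> y - y \<cdot> x \<in> fil (i + j - 1)"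
proof (rule fil_hom_induct[OF x])
  fix m x assume x: "x \<in> fil i" "x \<in> D m"
  show "x \<cdot> y - y \<cdot> x \<in> fil (i + j - 1)"
  proof (rule fil_hom_induct[OF y])
    fix y z assume *: "y \<in> fil j" "z \<in> fil j"
      "x \<cdot> y - y \<cdot> x \<in> fil (i + j - 1)" "x \<cdot> z - z \<cdot> x \<in> fil (i + j - 1)"
    have "x \<cdot> (y + z) - (y + z) \<cdot> x = (x \<cdot> y - y \<cdot> x) + (x \<cdot> z - z \<cdot> x)"
      using x * mul_add(1)[of y z x] mul_add(2)[of x y z] by (simp add: fil_in_V)
    then show "x \<cdot> (y + z) - (y + z) \<cdot> x \<in> fil (i + j - 1)" using * by auto
  qed (use x fil_mul_commutator_hom in auto)
next
  fix u v assume *: "u \<in> fil i" "v \<in> fil i"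
    "u \<cdot> y - y \<cdot> u \<in> fil (i + j - 1)" "v \<cdot> y - y \<cdot> v \<in> fil (i + j - 1)"
  have "(u + v) \<cdot> y - y \<cdot> (u + v) = (u \<cdot> y - y \<cdot> u) + (v \<cdot> y - y \<cdot> v)"
    using * y mul_add(1)[of u v y] mul_add(2)[of y u v] by (simp add: fil_in_V)
  then show "(u + v) \<cdot> y - y \<cdot> (u + v) \<in> fil (i + j - 1)" using * by auto
qed (use y in auto)

section \<open>Indecomposables and generators\<close>

text \<open>The part of \<open>F\<^sub>i \<inter> H\<^sub>m\<close> that becomes decomposable in \<open>gr H\<close>: lower terms and products of elements of
  positive degree.\<close>

definition Dec :: "int \<Rightarrow> nat \<Rightarrow> 'a set" where
  "Dec i m = vs.span ((fil (i - 1) \<inter> D m) \<union>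
     {u \<cdot> v | u v a b p q. u \<in> fil a \<and> u \<in> D p \<and> v \<in> fil b \<and> v \<in> D q \<and> 0 < p \<and> 0 < q
        \<and> p + q = m \<and> a + b \<le> i})"

lemma Dec_sub: "Dec i m \<subseteq> fil i \<inter> D m"
  unfolding Dec_def
proof (rule vs.span_minimal)
  show "vs.subspace (fil i \<inter> D m)" using fil_subspace D_subspace by (intro vs.subspace_inter)
  have "u \<cdot> v \<in> fil i \<inter> D m" if "u \<in> fil a" "u \<in> D p" "v \<in> fil b" "v \<in> D q" "p + q = m" "a + b \<le> i"
    for u v a b p q
    using fil_mul[OF that(1,3)] mul_D[OF that(2,4)] that fil_mono[OF that(6)] by auto
  then show "(fil (i - 1) \<inter> D m) \<union>
     {u \<cdot> v | u v a b p q. u \<in> fil a \<and> u \<in> D p \<and> v \<in> fil b \<and> v \<in> D q \<and> 0 < p \<and> 0 < q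
        \<and> p + q = m \<and> a + b \<le> i} \<subseteq> fil i \<inter> D m"
    using fil_mono[of "i - 1" i] by (intro Un_least) auto
qed

lemma Dec_lower: "x \<in> fil (i - 1) \<Longrightarrow> x \<in> D m \<Longrightarrow> x \<in> Dec i m"
  unfolding Dec_def by (intro vs.span_base) blast

lemma Dec_prod: "u \<in> fil a \<Longrightarrow> u \<in> D p \<Longrightarrow> v \<in> fil b \<Longrightarrow> v \<in> D q \<Longrightarrow> 0 < p \<Longrightarrow> 0 < q \<Longrightarrow>
    a + b \<le> i \<Longrightarrow> u \<cdot> v \<in> Dec i (p + q)"
  unfolding Dec_def by (intro vs.span_base) blast

text \<open>\<open>X\<close> is a basis of \<open>F\<^sub>i \<inter> H\<^sub>m\<close> modulo \<open>Dec i m\<close>.\<close>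

definition complementary :: "int \<Rightarrow> nat \<Rightarrow> 'a set \<Rightarrow> bool" where
  "complementary i m X \<longleftrightarrow> X \<subseteq> fil i \<inter> D m \<and> fil i \<inter> D m \<subseteq> vs.span (X \<union> Dec i m) \<and>
     (\<forall>x\<in>X. x \<notin> vs.span (Dec i m \<union> (X - {x})))"

lemma complementary_ex: "\<exists>X. complementary i m X"
proof -
  obtain B1 where B1: "B1 \<subseteq> Dec i m" "vs.independent B1" "Dec i m \<subseteq> vs.span B1"
    by (rule vs.maximal_independent_subset)
  have "B1 \<subseteq> fil i \<inter> D m" using B1(1) Dec_sub by blast
  then obtain B2 where B2: "B1 \<subseteq> B2" "B2 \<subseteq> fil i \<inter> D m" "vs.independent B2" "fil i \<inter> D m \<subseteq> vs.span B2"
    using B1(2) by (rule vs.maximal_independent_subset_extend)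
  let ?X = "B2 - B1"
  have "vs.span B2 \<subseteq> vs.span (?X \<union> Dec i m)" using B1(1) by (intro vs.span_mono) blast
  moreover have "x \<notin> vs.span (Dec i m \<union> (?X - {x}))" if x: "x \<in> ?X" for x
  proof -
    have "Dec i m \<subseteq> vs.span (B2 - {x})"
      using B1(3) vs.span_mono[of B1 "B2 - {x}"] B2(1) x by blast
    moreover have "?X - {x} \<subseteq> vs.span (B2 - {x})" by (auto intro: vs.span_base)
    ultimately have "vs.span (Dec i m \<union> (?X - {x})) \<subseteq> vs.span (B2 - {x})"
      by (intro vs.span_minimal) auto
    then show ?thesis using B2(3) x unfolding vs.dependent_def by blast
  qed
  moreover have "?X \<subseteq> fil i \<inter> D m" using B2(2) by blast
  ultimately have "complementary i m ?X"
    using B2(4) unfolding complementary_def by (intro conjI ballI) auto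
  then show ?thesis by blast
qed

definition Xs :: "int \<Rightarrow> nat \<Rightarrow> 'a set" where "Xs i m = (SOME X. complementary i m X)"

lemma Xs_complementary: "complementary i m (Xs i m)"
  unfolding Xs_def by (rule someI_ex[OF complementary_ex])

lemma Xs_fil: "x \<in> Xs i m \<Longrightarrow> x \<in> fil i" and Xs_D: "x \<in> Xs i m \<Longrightarrow> x \<in> D m"
  and Xs_span: "fil i \<inter> D m \<subseteq> vs.span (Xs i m \<union> Dec i m)"
  and Xs_notin: "x \<in> Xs i m \<Longrightarrow> x \<notin> vs.span (Dec i m \<union> (Xs i m - {x}))"
  using Xs_complementary[of i m] unfolding complementary_def by blast+

lemma Xs_not_Dec: "x \<in> Xs i m \<Longrightarrow> x \<notin> Dec i m"
  using Xs_notin vs.span_base by blast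

lemma Xs_not_lower: "x \<in> Xs i m \<Longrightarrow> x \<notin> fil (i - 1)"
  using Xs_not_Dec Dec_lower Xs_D by blast

lemma Xs_nz: "x \<in> Xs i m \<Longrightarrow> x \<noteq> 0"
  using Xs_not_lower by blast

lemma Xs_range: assumes "x \<in> Xs i m" "m > 0" shows "1 \<le> i" "i \<le> int m"
proof -
  show "1 \<le> i"
  proof (rule ccontr)
    assume "\<not> 1 \<le> i"
    then show False using fil_D_trivial[OF Xs_fil[OF assms(1)] Xs_D[OF assms(1)] assms(2)] Xs_nz[OF assms(1)] by simp
  qed
  show "i \<le> int m"
  proof (rule ccontr)
    assume "\<not> i \<le> int m"
    then show False using Xs_not_lower D_fil_ge[OF Xs_D, of x i m "i - 1"] assms by auto
  qed
qed

lemma Xs_ht: assumes "x \<in> Xs i m" "m > 0" shows "int (ht x) = i"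
proof -
  have i: "1 \<le> i" using Xs_range assms by blast
  have "ht x \<le> nat i" using ht_fil[OF Xs_D[OF assms(1)], of "nat i"] Xs_fil[OF assms(1)] i by simp
  moreover have "\<not> ht x \<le> nat (i - 1)"
    using ht_fil[OF Xs_D[OF assms(1)], of "nat (i - 1)"] Xs_not_lower[OF assms(1)] i by simp
  ultimately show ?thesis using i by linarith
qed

definition dg :: "'a \<Rightarrow> nat" where "dg x = (THE m. x \<in> D m)"

lemma dg_eq: "x \<in> D m \<Longrightarrow> x \<noteq> 0 \<Longrightarrow> dg x = m"
  unfolding dg_def using D_disjoint by (intro the_equality) blast+

text \<open>Representatives in \<open>H\<close> of a bihomogeneous basis of \<open>I / I\<^sup>2\<close>.\<close>

definition Gens :: "'a set" where "Gens = {x. \<exists>i m. m > 0 \<and> x \<in> Xs i m}"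

lemma GensI: "x \<in> Xs i m \<Longrightarrow> m > 0 \<Longrightarrow> x \<in> Gens \<and> int (ht x) = i \<and> dg x = m"
  using Xs_ht dg_eq[OF Xs_D Xs_nz] by (auto simp: Gens_def)

lemma Gens_Xs: "x \<in> Gens \<Longrightarrow> x \<in> Xs (int (ht x)) (dg x)" and Gens_dg: "x \<in> Gens \<Longrightarrow> dg x > 0"
  and Gens_ht: "x \<in> Gens \<Longrightarrow> ht x > 0"
proof -
  assume "x \<in> Gens"
  then obtain i m where *: "m > 0" "x \<in> Xs i m" by (auto simp: Gens_def)
  have **: "int (ht x) = i" "dg x = m" using GensI[OF *(2,1)] by auto
  show "x \<in> Xs (int (ht x)) (dg x)" "dg x > 0" using * ** by auto
  show "ht x > 0" using Xs_range(1)[OF *(2,1)] ** by simp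
qed

lemma Gens_fil: "x \<in> Gens \<Longrightarrow> x \<in> fil (int (ht x))" and Gens_D: "x \<in> Gens \<Longrightarrow> x \<in> D (dg x)"
  using Gens_Xs Xs_fil Xs_D by blast+

lemma Gens_V [simp, intro]: "x \<in> Gens \<Longrightarrow> x \<in> V" using Gens_D by blast

lemma Xs_finite: "finite (Xs i m)"
proof -
  have "vs.independent (Xs i m)"
    unfolding vs.dependent_def using Xs_notin[of _ i m] vs.span_mono[OF Un_upper2] by (meson subsetD)
  then show ?thesis using D_independent_finite Xs_D by blast
qed

lemma Gens_deg_finite: "finite {x \<in> Gens. dg x = m}"
proof -
  have "{x \<in> Gens. dg x = m} \<subseteq> (\<Union>i\<in>{1..int m}. Xs i m)"
  proof
    fix x assume "x \<in> {x \<in> Gens. dg x = m}"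
    then have "x \<in> Xs (int (ht x)) m" "m > 0" using Gens_Xs Gens_dg by auto
    then show "x \<in> (\<Union>i\<in>{1..int m}. Xs i m)"
      using Xs_range[of x "int (ht x)" m] by (intro UN_I[of "int (ht x)"]) auto
  qed
  then show ?thesis by (rule finite_subset) (simp add: Xs_finite)
qed

lemma psum_fil: "(\<And>a b. (a, b) \<in> set ps \<Longrightarrow> g a b \<in> fil k) \<Longrightarrow> psum g ps \<in> fil k"
  by (induction ps) auto

text \<open>A form dual to the generator \<open>x\<close>.  Its value at a generator of the same degree and larger height is arbitrary: it
  changes the contraction of that generator by a multiple of \<open>1\<close>, which is of lower filtration there.\<close>

definition dual_form :: "'a \<Rightarrow> ('a \<Rightarrow> 'k) \<Rightarrow> bool" where
  "dual_form x f \<longleftrightarrow> lform f \<and> f x = 1 \<and> (\<forall>w\<in>Dec (int (ht x)) (dg x). f w = 0) \<and>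
     (\<forall>y\<in>Xs (int (ht x)) (dg x) - {x}. f y = 0) \<and> (\<forall>l. l \<noteq> dg x \<longrightarrow> (\<forall>y\<in>D l. f y = 0))"

lemma dual_form_ex: assumes x: "x \<in> Gens" shows "\<exists>f. dual_form x f"
proof -
  let ?i = "int (ht x)" and ?m = "dg x"
  let ?S = "vs.span (Dec ?i ?m \<union> (Xs ?i ?m - {x}))"
  have "x \<notin> ?S" using Xs_notin[OF Gens_Xs[OF x]] .
  then obtain f where f: "lform f" "\<And>w. w \<in> ?S \<Longrightarrow> f w = 0" "f x = 1"
    using sep_lform[OF vs.subspace_span] by blast
  let ?f = "\<lambda>y. f (comp y ?m)"
  have "?f y = f y" if "y \<in> D ?m" for y using comp_hom[OF that, of ?m] by simp
  moreover have "?f y = 0" if "y \<in> D l" "l \<noteq> ?m" for y l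
    using comp_hom[OF that(1), of ?m] that(2) lin_map_0[OF vsp f(1)] by simp
  moreover have "f w = 0" if "w \<in> Dec ?i ?m \<or> w \<in> Xs ?i ?m - {x}" for w
    by (rule f(2), rule vs.span_base) (use that in blast)
  moreover have "w \<in> D ?m" if "w \<in> Dec ?i ?m \<or> w \<in> Xs ?i ?m - {x}" for w
    using that Dec_sub Xs_D by blast
  ultimately have "dual_form x ?f"
    using lin_map_comp[OF comp_lin f(1)] f(3) Gens_D[OF x] unfolding dual_form_def by simp
  then show ?thesis by blast
qed

definition gen_form :: "'a \<Rightarrow> 'a \<Rightarrow> 'k" where "gen_form x = (SOME f. dual_form x f)"

context
  fixes x assumes x: "x \<in> Gens"
begin

lemma gen_form_dual: "dual_form x (gen_form x)"
  unfolding gen_form_def by (rule someI_ex[OF dual_form_ex[OF x]])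

lemma gen_form_lform: "lform (gen_form x)" and gen_form_self: "gen_form x x = 1"
  and gen_form_Dec: "w \<in> Dec (int (ht x)) (dg x) \<Longrightarrow> gen_form x w = 0"
  and gen_form_other: "y \<in> Xs (int (ht x)) (dg x) \<Longrightarrow> y \<noteq> x \<Longrightarrow> gen_form x y = 0"
  and gen_form_D: "y \<in> D l \<Longrightarrow> l \<noteq> dg x \<Longrightarrow> gen_form x y = 0"
  using gen_form_dual unfolding dual_form_def by blast+

lemma gen_form_comp: "y \<in> V \<Longrightarrow> gen_form x y = gen_form x (comp y (dg x))"
proof -
  assume y: "y \<in> V"
  let ?S = "insert (dg x) {m. comp y m \<noteq> 0}"
  have s: "(\<Sum>m\<in>?S. comp y m) = y"
    by (rule comp_sum_superset[OF y]) (use comp_finite[OF y] in auto)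
  have "gen_form x (\<Sum>m\<in>?S. comp y m) = (\<Sum>m\<in>?S. gen_form x (comp y m))"
    by (rule lin_map_sum[OF vsp gen_form_lform]) (use y in auto)
  also have "\<dots> = (\<Sum>m\<in>{dg x}. gen_form x (comp y m))"
    using comp_finite[OF y] gen_form_D comp_D[OF y] by (intro sum.mono_neutral_right) auto
  finally show ?thesis unfolding s by simp
qed

lemma gen_form_kills: "kills (gen_form x) (int (ht x) - 1)"
proof -
  have "gen_form x y = 0" if "y \<in> fil (int (ht x) - 1)" for y
    using gen_form_comp[of y] gen_form_Dec[OF Dec_lower[OF comp_fil[OF that] comp_D]] that by auto
  then show ?thesis using gen_form_lform by (auto simp: kills_def)
qed

lemma gen_form_one: "gen_form x \<one> = 0"
  using gen_form_D[OF one_D] Gens_dg[OF x] by simp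

text \<open>The forms dual to generators are \<open>\<epsilon>\<close>-derivations in the relevant range of indices, because they kill
  \<open>Dec\<close>.\<close>

lemma gen_form_prod:
  assumes y: "y \<in> fil j" "y \<in> D p" and z: "z \<in> fil k" "z \<in> D q" and jk: "j + k \<le> int (ht x)"
  shows "gen_form x (y \<cdot> z) = \<epsilon> y * gen_form x z + gen_form x y * \<epsilon> z"
proof -
  have V: "y \<in> V" "z \<in> V" using y z by auto
  consider "p = 0" | "q = 0" | "p > 0" "q > 0" by linarith
  then show ?thesis
  proof cases
    case 1
    then have "y \<cdot> z = \<epsilon> y \<odot> z" using D0_eq[of y] y mul_scl(1)[OF one_V V(2), of "\<epsilon> y"] V by simp
    moreover have "gen_form x y = 0" using lform_D0[OF gen_form_lform gen_form_one] 1 y by simp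
    ultimately show ?thesis using lin_map_scl[OF gen_form_lform V(2)] by simp
  next
    case 2
    then have "y \<cdot> z = \<epsilon> z \<odot> y" using D0_eq[of z] z mul_scl(2)[OF V(1) one_V, of "\<epsilon> z"] V by simp
    moreover have "gen_form x z = 0" using lform_D0[OF gen_form_lform gen_form_one] 2 z by simp
    ultimately show ?thesis using lin_map_scl[OF gen_form_lform V(1)] by simp
  next
    case 3
    have "gen_form x (y \<cdot> z) = 0"
    proof (cases "p + q = dg x")
      case True
      then show ?thesis using gen_form_Dec Dec_prod[OF y z 3 jk] by simp
    next
      case False
      then show ?thesis using gen_form_D mul_D[OF y(2) z(2)] by blast
    qed
    then show ?thesis using cu_D[OF y(2)] cu_D[OF z(2)] 3 by simp
  qed
qed

section \<open>The derivations dual to the generators\<close>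

text \<open>So the contraction with such a form is a derivation of \<open>gr H\<close>, lowering the index by the height of \<open>x\<close>.
  Where \<open>gen_form_prod\<close> does not apply, the left factors are already of low index.\<close>

lemma contr_gen_form_prod:
  assumes y: "y \<in> fil j" "y \<in> D p" and z: "z \<in> fil k" "z \<in> D q"
  shows "contr (gen_form x) (y \<cdot> z) - (contr (gen_form x) y \<cdot> z + y \<cdot> contr (gen_form x) z)
    \<in> fil (j + k - int (ht x) - 1)"
proof -
  let ?g = "gen_form x"
  obtain ps where ps: "cop y ps" "set ps \<subseteq> pieces j p" using cop_fil[OF y] by blast
  obtain qs where qs: "cop z qs" "set qs \<subseteq> pieces k q" using cop_fil[OF z] by blast
  note pV = copD[OF ps(1)] and qV = copD[OF qs(1)]
  have E1: "contr ?g (y \<cdot> z) = psum (\<lambda>a b. psum (\<lambda>c d. ?g (b \<cdot> d) \<odot> (a \<cdot> c)) qs) ps"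
    unfolding contr_cop[OF cop_mult[OF ps(1) qs(1)] gen_form_lform] psum_concat psum_map ..
  have E2: "contr ?g y \<cdot> z = psum (\<lambda>a b. psum (\<lambda>c d. (?g b * \<epsilon> d) \<odot> (a \<cdot> c)) qs) ps"
  proof -
    have "contr ?g y \<cdot> z = psum (\<lambda>a b. (?g b \<odot> a) \<cdot> z) ps"
      unfolding contr_cop[OF ps(1) gen_form_lform] using pV qV by (intro mul_psum) auto
    also have "\<dots> = psum (\<lambda>a b. psum (\<lambda>c d. (?g b * \<epsilon> d) \<odot> (a \<cdot> c)) qs) ps"
    proof (rule psum_cong)
      fix a b assume ab: "(a, b) \<in> set ps"
      have aV: "a \<in> V" using pV(2)[OF ab] .
      have "(?g b \<odot> a) \<cdot> z = (?g b \<odot> a) \<cdot> psum (\<lambda>c d. \<epsilon> d \<odot> c) qs" using cop_cu(2)[OF qs(1)] by simp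
      also have "\<dots> = psum (\<lambda>c d. (?g b \<odot> a) \<cdot> (\<epsilon> d \<odot> c)) qs"
        using aV qV by (intro mul_psum) auto
      also have "\<dots> = psum (\<lambda>c d. (?g b * \<epsilon> d) \<odot> (a \<cdot> c)) qs"
        using aV qV by (intro psum_cong) (auto simp: mul_scl)
      finally show "(?g b \<odot> a) \<cdot> z = psum (\<lambda>c d. (?g b * \<epsilon> d) \<odot> (a \<cdot> c)) qs" .
    qed
    finally show ?thesis .
  qed
  have E3: "y \<cdot> contr ?g z = psum (\<lambda>a b. psum (\<lambda>c d. (\<epsilon> b * ?g d) \<odot> (a \<cdot> c)) qs) ps"
  proof -
    have cV: "contr ?g z \<in> V" using qV(1) gen_form_lform by auto
    have "y \<cdot> contr ?g z = psum (\<lambda>a b. \<epsilon> b \<odot> a) ps \<cdot> contr ?g z" using cop_cu(2)[OF ps(1)] by simp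
    also have "\<dots> = psum (\<lambda>a b. (\<epsilon> b \<odot> a) \<cdot> contr ?g z) ps"
      using pV cV by (intro mul_psum) auto
    also have "\<dots> = psum (\<lambda>a b. psum (\<lambda>c d. (\<epsilon> b * ?g d) \<odot> (a \<cdot> c)) qs) ps"
    proof (rule psum_cong)
      fix a b assume ab: "(a, b) \<in> set ps"
      have aV: "a \<in> V" using pV(2)[OF ab] .
      have "(\<epsilon> b \<odot> a) \<cdot> contr ?g z = psum (\<lambda>c d. (\<epsilon> b \<odot> a) \<cdot> (?g d \<odot> c)) qs"
        unfolding contr_cop[OF qs(1) gen_form_lform] using aV qV by (intro mul_psum) auto
      also have "\<dots> = psum (\<lambda>c d. (\<epsilon> b * ?g d) \<odot> (a \<cdot> c)) qs"
        using aV qV by (intro psum_cong) (auto simp: mul_scl)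
      finally show "(\<epsilon> b \<odot> a) \<cdot> contr ?g z = psum (\<lambda>c d. (\<epsilon> b * ?g d) \<odot> (a \<cdot> c)) qs" .
    qed
    finally show ?thesis .
  qed
  have "contr ?g (y \<cdot> z) - (contr ?g y \<cdot> z + y \<cdot> contr ?g z) =
    psum (\<lambda>a b. psum (\<lambda>c d. ?g (b \<cdot> d) \<odot> (a \<cdot> c) - ((?g b * \<epsilon> d) \<odot> (a \<cdot> c) + (\<epsilon> b * ?g d) \<odot> (a \<cdot> c))) qs) ps"
    unfolding E1 E2 E3 by (simp only: psum_diff psum_add)
  also have "\<dots> \<in> fil (j + k - int (ht x) - 1)"
  proof (intro psum_fil)
    fix a b c d assume ab: "(a, b) \<in> set ps" and cd: "(c, d) \<in> set qs"
    obtain i1 r1 where 1: "a \<in> fil i1" "a \<in> D r1" "b \<in> fil (j - i1)" "b \<in> D (p - r1)" using piecesD[OF ps(2) ab] by blast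
    obtain i2 r2 where 2: "c \<in> fil i2" "c \<in> D r2" "d \<in> fil (k - i2)" "d \<in> D (q - r2)" using piecesD[OF qs(2) cd] by blast
    show "?g (b \<cdot> d) \<odot> (a \<cdot> c) - ((?g b * \<epsilon> d) \<odot> (a \<cdot> c) + (\<epsilon> b * ?g d) \<odot> (a \<cdot> c))
        \<in> fil (j + k - int (ht x) - 1)"
    proof (cases "(j - i1) + (k - i2) \<le> int (ht x)")
      case True
      show ?thesis using gen_form_prod[OF 1(3,4) 2(3,4) True]
        by (simp add: vs.scale_left_distrib)
    next
      case False
      then have "a \<cdot> c \<in> fil (j + k - int (ht x) - 1)"
        using fil_mul[OF 1(1) 2(1)] fil_mono[of "i1 + i2" "j + k - int (ht x) - 1"] by auto
      then show ?thesis by (intro fil_diff fil_add fil_scl)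
    qed
  qed
  finally show ?thesis .
qed

lemma contr_gen_form_one: "contr (gen_form x) \<one> = 0"
  using contr_cop[OF cop_one gen_form_lform] gen_form_one by simp

lemma contr_gen_form_fil: assumes y: "y \<in> fil j" shows "contr (gen_form x) y \<in> fil (j - int (ht x))"
proof (cases "j < int (ht x)")
  case False
  then show ?thesis using contr_fil[OF gen_form_kills, of y "nat (j - int (ht x))"] y by simp
next
  case True
  have ht: "int (ht x) \<ge> 1" using Gens_ht[OF x] by simp
  have y': "y \<in> fil (int (ht x) - 1)" using y fil_mono[of j "int (ht x) - 1"] True by auto
  have "contr (gen_form x) y \<in> fil (-1)"
  proof (rule fil_sep)
    show "contr (gen_form x) y \<in> V" using y gen_form_lform by auto
    fix f assume f: "kills f (-1)"
    have "cf f (gen_form x) y = 0" by (rule cf_kills_0[OF kills_lform[OF f] gen_form_kills y']) (use ht in simp)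
    then show "f (contr (gen_form x) y) = 0" using lform_contr[OF kills_lform[OF f] gen_form_lform] y by auto
  qed
  then show ?thesis by (simp add: fil_neg)
qed

text \<open>On a generator of degree at most \<open>dg x\<close> the derivation takes the constant value \<open>gen_form x y\<close>: the
  inner terms of the coproduct have right factors of too small a degree.\<close>

lemma contr_gen_form_gen:
  assumes y: "y \<in> Gens" "dg y \<le> dg x"
  shows "contr (gen_form x) y - (if y = x then \<one> else 0) \<in> fil (int (ht y) - int (ht x) - 1)"
proof -
  obtain ps where ps: "cop y ((y, \<one>) # (\<one>, y) # ps)"
      "set ps \<subseteq> inner_pieces (int (ht y)) (dg y)"
    using cop_reduced[OF Gens_fil[OF y(1)] Gens_D[OF y(1)] Gens_dg[OF y(1)]] by blast
  have "psum (\<lambda>a b. gen_form x b \<odot> a) ps = 0"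
  proof (rule psum_0)
    fix u v assume "(u, v) \<in> set ps"
    then obtain p where "0 < p" "p < dg y" "v \<in> D (dg y - p)" using inner_piecesD[OF ps(2)] by blast
    then have "gen_form x v = 0" using gen_form_D[of v "dg y - p"] y(2) by simp
    then show "gen_form x v \<odot> u = 0" by simp
  qed
  then have e: "contr (gen_form x) y = gen_form x y \<odot> \<one>"
    using contr_cop[OF ps(1) gen_form_lform] gen_form_one by simp
  show ?thesis
  proof (cases "ht y > ht x")
    case True
    then have "\<one> \<in> fil (int (ht y) - int (ht x) - 1)" by (intro one_fil) simp
    then show ?thesis unfolding e by (intro fil_diff fil_scl) auto
  next
    case False
    have "gen_form x y = (if y = x then 1 else 0)"
    proof (cases "dg y = dg x \<and> ht y = ht x")
      case True
      then show ?thesis using gen_form_self gen_form_other[of y] Gens_Xs[OF y(1)] by auto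
    next
      case F: False
      show ?thesis
      proof (cases "dg y = dg x")
        case True
        then have "int (ht y) \<le> int (ht x) - 1" using F False by simp
        then have "gen_form x y = 0" using killsD[OF gen_form_kills] fil_mono Gens_fil[OF y(1)] by blast
        then show ?thesis using F by auto
      next
        case False
        then show ?thesis using gen_form_D[OF Gens_D[OF y(1)]] by auto
      qed
    qed
    then show ?thesis unfolding e by simp
  qed
qed

end

section \<open>Monomials in the generators\<close>

primrec prodl :: "'a list \<Rightarrow> 'a" where
  "prodl [] = \<one>" | "prodl (y # ys) = y \<cdot> prodl ys"

definition HT :: "'a multiset \<Rightarrow> int" where "HT M = (\<Sum>y\<in>#M. int (ht y))"
definition DG :: "'a multiset \<Rightarrow> nat" where "DG M = (\<Sum>y\<in>#M. dg y)"

lemma HT_simps [simp]: "HT {#} = 0" "HT (add_mset y M) = int (ht y) + HT M" "HT (M + N) = HT M + HT N"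
  by (simp_all add: HT_def)

lemma DG_simps [simp]: "DG {#} = 0" "DG (add_mset y M) = dg y + DG M" "DG (M + N) = DG M + DG N"
  by (simp_all add: DG_def)

lemma HT_remove: "y \<in># M \<Longrightarrow> HT (M - {#y#}) = HT M - int (ht y)"
  and DG_remove: "y \<in># M \<Longrightarrow> DG (M - {#y#}) = DG M - dg y"
  using HT_simps(2)[of y "M - {#y#}"] DG_simps(2)[of y "M - {#y#}"] by auto

lemma DG_ge: "y \<in># M \<Longrightarrow> dg y \<le> DG M"
  using DG_simps(2)[of y "M - {#y#}"] by simp

lemma prodl_props:
  assumes "set ys \<subseteq> Gens"
  shows prodl_fil: "prodl ys \<in> fil (HT (mset ys))" and prodl_D: "prodl ys \<in> D (DG (mset ys))"
proof -
  show "prodl ys \<in> fil (HT (mset ys))" using assms by (induction ys) (auto simp: one_fil fil_mul Gens_fil)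
  show "prodl ys \<in> D (DG (mset ys))" using assms by (induction ys) (auto simp: mul_D Gens_D)
qed

lemma prodl_V [simp, intro]: "set ys \<subseteq> Gens \<Longrightarrow> prodl ys \<in> V"
  using prodl_fil by blast

lemma mul_assoc: "a \<in> V \<Longrightarrow> b \<in> V \<Longrightarrow> c \<in> V \<Longrightarrow> (a \<cdot> b) \<cdot> c = a \<cdot> (b \<cdot> c)"
  by (rule prd_assoc)

lemma prodl_append: "set ys \<subseteq> Gens \<Longrightarrow> set zs \<subseteq> Gens \<Longrightarrow> prodl (ys @ zs) = prodl ys \<cdot> prodl zs"
  by (induction ys) (auto simp: mul_assoc)

lemma prodl_move_front:
  assumes "set zs \<subseteq> Gens" "y \<in> set zs"
  shows "y \<cdot> prodl (remove1 y zs) - prodl zs \<in> fil (HT (mset zs) - 1)"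
  using assms
proof (induction zs)
  case (Cons z zs)
  show ?case
  proof (cases "y = z")
    case False
    then have y: "y \<in> set zs" and yz: "y \<in> Gens" "z \<in> Gens" "set zs \<subseteq> Gens" using Cons.prems by auto
    let ?R = "prodl (remove1 y zs)"
    have sub: "set (remove1 y zs) \<subseteq> Gens" using yz(3) set_remove1_subset[of y zs] by blast
    have R: "?R \<in> fil (HT (mset zs) - int (ht y))"
      using prodl_fil[OF sub] HT_remove[of y "mset zs"] y by simp
    have V: "?R \<in> V" "y \<in> V" "z \<in> V" "prodl zs \<in> V" using sub yz by auto
    have "y \<cdot> (z \<cdot> ?R) - z \<cdot> prodl zs = (y \<cdot> z - z \<cdot> y) \<cdot> ?R + z \<cdot> (y \<cdot> ?R - prodl zs)"
      using V by (simp add: mul_diff mul_assoc)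
    moreover have "(y \<cdot> z - z \<cdot> y) \<cdot> ?R \<in> fil (int (ht z) + HT (mset zs) - 1)"
      using fil_mul[OF commutator[OF Gens_fil[OF yz(1)] Gens_fil[OF yz(2)]] R] by (simp add: algebra_simps)
    moreover have "z \<cdot> (y \<cdot> ?R - prodl zs) \<in> fil (int (ht z) + HT (mset zs) - 1)"
      using fil_mul[OF Gens_fil[OF yz(2)] Cons.IH[OF yz(3) y]] by (simp add: algebra_simps)
    ultimately show ?thesis using False by auto
  qed simp
qed simp

lemma prodl_perm:
  assumes "set ys \<subseteq> Gens" "mset ys = mset zs"
  shows "prodl ys - prodl zs \<in> fil (HT (mset ys) - 1)"
  using assms
proof (induction ys arbitrary: zs)
  case (Cons y ys)
  have y: "y \<in> set zs" using Cons.prems(2) by (metis list.set_intros(1) set_mset_mset)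
  have zs: "set zs \<subseteq> Gens" using Cons.prems by (metis set_mset_mset)
  have m: "mset ys = mset (remove1 y zs)" using Cons.prems(2) by (metis mset_remove1 remove1.simps(2))
  have s: "set (remove1 y zs) \<subseteq> Gens" using zs set_remove1_subset[of y zs] by blast
  have V: "y \<in> V" "prodl ys \<in> V" "prodl (remove1 y zs) \<in> V" using Cons.prems s by auto
  have "y \<cdot> prodl ys - prodl zs = y \<cdot> (prodl ys - prodl (remove1 y zs)) + (y \<cdot> prodl (remove1 y zs) - prodl zs)"
    using V by (simp add: mul_diff)
  moreover have "y \<cdot> (prodl ys - prodl (remove1 y zs)) \<in> fil (HT (mset (y # ys)) - 1)"
    using fil_mul[OF Gens_fil Cons.IH[OF _ m], of y] Cons.prems(1) by (simp add: algebra_simps)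
  moreover have "y \<cdot> prodl (remove1 y zs) - prodl zs \<in> fil (HT (mset (y # ys)) - 1)"
    using prodl_move_front[OF zs y] Cons.prems(2) by simp
  ultimately show ?case using fil_add by (metis prodl.simps(2))
qed simp

text \<open>The derivation of a monomial is its partial derivative, modulo lower filtration.\<close>

lemma contr_gen_form_prodl:
  assumes x: "x \<in> Gens" and "set ys \<subseteq> Gens" "\<And>y. y \<in> set ys \<Longrightarrow> dg y \<le> dg x"
  shows "contr (gen_form x) (prodl ys) - of_nat (count (mset ys) x) \<odot> prodl (remove1 x ys)
    \<in> fil (HT (mset ys) - int (ht x) - 1)"
  using assms(2,3)
proof (induction ys)
  case Nil
  then show ?case using contr_gen_form_one[OF x] by simp
next
  case (Cons y ys)
  let ?g = "gen_form x" and ?P = "prodl ys" and ?R = "prodl (remove1 x ys)"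
  let ?i = "int (ht x)"
  define c :: 'k where "c = of_nat (count (mset ys) x)"
  define \<delta> where "\<delta> = (if y = x then \<one> else 0)"
  have y: "y \<in> Gens" "dg y \<le> dg x" and ys: "set ys \<subseteq> Gens" using Cons.prems by auto
  have s: "set (remove1 x ys) \<subseteq> Gens" using ys set_remove1_subset[of x ys] by blast
  note gl = gen_form_lform[OF x]
  have V: "y \<in> V" "?P \<in> V" "?R \<in> V" "\<delta> \<in> V" using y ys s by (auto simp: \<delta>_def)
  define e where "e = contr ?g y - \<delta>"
  define e' where "e' = contr ?g ?P - c \<odot> ?R"
  have e: "e \<in> fil (int (ht y) - ?i - 1)" unfolding e_def \<delta>_def by (rule contr_gen_form_gen[OF x y])
  have e': "e' \<in> fil (HT (mset ys) - ?i - 1)" unfolding e'_def c_def using Cons by simp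
  have eV: "e \<in> V" "e' \<in> V" using e e' by auto
  define A where "A = contr ?g (y \<cdot> ?P) - (contr ?g y \<cdot> ?P + y \<cdot> contr ?g ?P)"
  let ?k = "int (ht y) + HT (mset ys) - ?i - 1"
  have A: "A \<in> fil ?k" unfolding A_def
    using contr_gen_form_prod[OF x Gens_fil[OF y(1)] Gens_D[OF y(1)] prodl_fil[OF ys] prodl_D[OF ys]] .
  have eP: "e \<cdot> ?P \<in> fil ?k" using fil_mul[OF e prodl_fil[OF ys]] by (simp add: algebra_simps)
  have ye: "y \<cdot> e' \<in> fil ?k" using fil_mul[OF Gens_fil[OF y(1)] e'] by (simp add: algebra_simps)
  have 1: "contr ?g y \<cdot> ?P = \<delta> \<cdot> ?P + e \<cdot> ?P"
    using mul_add(1)[OF V(4) eV(1) V(2)] by (simp add: e_def)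
  have 2: "y \<cdot> contr ?g ?P = c \<odot> (y \<cdot> ?R) + y \<cdot> e'"
    using mul_add(2)[OF V(1) V_scl[OF V(3), of c] eV(2)] mul_scl(2)[OF V(1,3), of c] by (simp add: e'_def)
  have T: "contr ?g (prodl (y # ys)) = A + e \<cdot> ?P + y \<cdot> e' + \<delta> \<cdot> ?P + c \<odot> (y \<cdot> ?R)"
    using 1 2 unfolding A_def by simp
  have B: "\<delta> \<cdot> ?P + c \<odot> (y \<cdot> ?R) - of_nat (count (mset (y # ys)) x) \<odot> prodl (remove1 x (y # ys)) \<in> fil ?k"
  proof (cases "y = x")
    case False
    then show ?thesis using V by (simp add: \<delta>_def c_def)
  next
    case True
    have "\<delta> \<cdot> ?P + c \<odot> (y \<cdot> ?R) - of_nat (count (mset (y # ys)) x) \<odot> prodl (remove1 x (y # ys))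
      = c \<odot> (x \<cdot> ?R - ?P)"
      using True V by (simp add: \<delta>_def c_def vs.scale_left_distrib vs.scale_right_diff_distrib)
    also have "\<dots> \<in> fil ?k"
    proof (cases "x \<in> set ys")
      case xs: True
      show ?thesis using prodl_move_front[OF ys xs] True by (intro fil_scl) simp
    next
      case False
      then have "c = 0" by (simp add: c_def)
      then show ?thesis by simp
    qed
    finally show ?thesis .
  qed
  have "contr ?g (prodl (y # ys)) - of_nat (count (mset (y # ys)) x) \<odot> prodl (remove1 x (y # ys))
    = (A + e \<cdot> ?P + y \<cdot> e') + (\<delta> \<cdot> ?P + c \<odot> (y \<cdot> ?R)
      - of_nat (count (mset (y # ys)) x) \<odot> prodl (remove1 x (y # ys)))"
    unfolding T by (simp only: add_diff_eq add.assoc)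
  also have "\<dots> \<in> fil ?k" by (intro fil_add A eP ye B)
  finally show ?case by (simp add: algebra_simps)
qed

text \<open>The factors are multiplied in an arbitrary but fixed order.\<close>

definition bm :: "'a multiset \<Rightarrow> 'a" where "bm M = prodl (SOME ys. mset ys = M)"

lemma bm_list: obtains ys where "mset ys = M" "bm M = prodl ys"
  using someI_ex[OF ex_mset[of M]] that unfolding bm_def by blast

lemma bm_perm: "mset ys = M \<Longrightarrow> set_mset M \<subseteq> Gens \<Longrightarrow> prodl ys - bm M \<in> fil (HT M - 1)"
  using prodl_perm[of ys] bm_list[of M] by (metis set_mset_mset)

lemma bm_props: assumes "set_mset M \<subseteq> Gens"
  shows bm_fil: "bm M \<in> fil (HT M)" and bm_D: "bm M \<in> D (DG M)" and bm_V: "bm M \<in> V"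
proof -
  obtain ys where "mset ys = M" "bm M = prodl ys" by (rule bm_list)
  then show "bm M \<in> fil (HT M)" "bm M \<in> D (DG M)" "bm M \<in> V"
    using assms prodl_fil[of ys] prodl_D[of ys] by auto
qed

lemma bm_empty: "bm {#} = \<one>"
  by (rule bm_list[of "{#}"]) auto

lemma contr_gen_form_bm:
  assumes x: "x \<in> Gens" and M: "set_mset M \<subseteq> Gens" "\<And>y. y \<in># M \<Longrightarrow> dg y \<le> dg x"
  shows "contr (gen_form x) (bm M) - of_nat (count M x) \<odot> bm (M - {#x#}) \<in> fil (HT M - int (ht x) - 1)"
proof -
  obtain ys where ys: "mset ys = M" "bm M = prodl ys" by (rule bm_list)
  have sub: "set ys \<subseteq> Gens" using ys(1) M(1) by auto
  have 1: "contr (gen_form x) (prodl ys) - of_nat (count M x) \<odot> prodl (remove1 x ys) \<in> fil (HT M - int (ht x) - 1)"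
    using contr_gen_form_prodl[OF x sub] M(2) ys(1) by auto
  have 2: "of_nat (count M x) \<odot> (prodl (remove1 x ys) - bm (M - {#x#})) \<in> fil (HT M - int (ht x) - 1)"
  proof (cases "x \<in># M")
    case True
    have "set_mset (M - {#x#}) \<subseteq> Gens" using M(1) by (meson in_diffD subset_iff)
    then have "prodl (remove1 x ys) - bm (M - {#x#}) \<in> fil (HT (M - {#x#}) - 1)"
      using bm_perm[of "remove1 x ys" "M - {#x#}"] ys(1) by auto
    then show ?thesis using HT_remove[OF True] by (intro fil_scl) simp
  next
    case False
    then show ?thesis by (simp add: not_in_iff)
  qed
  have "contr (gen_form x) (bm M) - of_nat (count M x) \<odot> bm (M - {#x#}) =
    (contr (gen_form x) (prodl ys) - of_nat (count M x) \<odot> prodl (remove1 x ys))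
     + of_nat (count M x) \<odot> (prodl (remove1 x ys) - bm (M - {#x#}))"
    unfolding ys(2) by (simp add: vs.scale_right_diff_distrib)
  also have "\<dots> \<in> fil (HT M - int (ht x) - 1)" using 1 2 by (rule fil_add)
  finally show ?thesis .
qed

text \<open>Independence of the monomials in \<open>gr H\<close>, by induction on the degree.  Choose a factor \<open>x\<close> of largest
  degree among the monomials that occur in the relation.  Its derivation turns the relation into
  one of smaller degree with coefficients \<open>c M * count M x\<close>, which therefore vanish.\<close>

lemma bm_independent_mod:
  assumes "finite \<M>" "\<And>M. M \<in> \<M> \<Longrightarrow> set_mset M \<subseteq> Gens \<and> DG M = m \<and> HT M = J"
    "(\<Sum>M\<in>\<M>. c M \<odot> bm M) \<in> fil (J - 1)" "M \<in> \<M>"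
  shows "c M = 0"
  using assms
proof (induction m arbitrary: \<M> c J M rule: less_induct)
  case (less m)
  note \<M> = less.prems(2)
  show ?case
  proof (cases "m = 0")
    case True
    have e: "N = {#}" if "N \<in> \<M>" for N
    proof (rule ccontr)
      assume "N \<noteq> {#}"
      then obtain y where "y \<in># N" by blast
      then show False using DG_ge[of y N] \<M>[OF that] True Gens_dg[of y] by auto
    qed
    have M: "M = {#}" "\<M> = {{#}}" using e less.prems(4) by auto
    have "J = 0" using \<M>[OF less.prems(4)] M by simp
    then have "c {#} \<odot> \<one> = 0" using less.prems(3) M by (simp add: bm_empty fil_neg)
    then show ?thesis using one_nz M by simp
  next
    case False
    show ?thesis
    proof (rule ccontr)
      assume cM: "c M \<noteq> 0"
      define \<N> where "\<N> = {N \<in> \<M>. c N \<noteq> 0}"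
      have finN: "finite \<N>" using less.prems(1) by (simp add: \<N>_def)
      let ?U = "\<Union>N\<in>\<N>. set_mset N"
      have finU: "finite ?U" using finN by simp
      have "M \<noteq> {#}" using \<M>[OF less.prems(4)] False by auto
      then have neU: "?U \<noteq> {}" using cM less.prems(4) by (auto simp: \<N>_def)
      (* The degree of x must be maximal, because the derivation is known only on generators of degree
         at most that of x. *)
      obtain x where xU: "x \<in> ?U" and xmax: "\<And>y. y \<in> ?U \<Longrightarrow> dg y \<le> dg x"
      proof -
        have "Max (dg ` ?U) \<in> dg ` ?U" using finU neU by (intro Max_in) auto
        then obtain x where x: "x \<in> ?U" "Max (dg ` ?U) = dg x" by blast
        have "dg y \<le> dg x" if "y \<in> ?U" for y
          unfolding x(2)[symmetric] using finU that by (intro Max_ge) blast+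
        then show ?thesis using that x by blast
      qed
      have x: "x \<in> Gens" using xU \<M> by (auto simp: \<N>_def)
      let ?k = "J - int (ht x) - 1"
      have NV: "bm N \<in> V" "set_mset N \<subseteq> Gens" "DG N = m" "HT N = J" if "N \<in> \<N>" for N
        using \<M>[of N] bm_V[of N] that by (auto simp: \<N>_def)
      have s: "(\<Sum>N\<in>\<M>. c N \<odot> bm N) = (\<Sum>N\<in>\<N>. c N \<odot> bm N)"
        using less.prems(1) by (intro sum.mono_neutral_right) (auto simp: \<N>_def)
      have lin: "lin (contr (gen_form x))" by (rule contr_lin[OF gen_form_lform[OF x]])
      have "contr (gen_form x) (\<Sum>N\<in>\<N>. c N \<odot> bm N) \<in> fil (J - 1 - int (ht x))"
        using contr_gen_form_fil[OF x less.prems(3)] unfolding s .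
      also have "contr (gen_form x) (\<Sum>N\<in>\<N>. c N \<odot> bm N) = (\<Sum>N\<in>\<N>. c N \<odot> contr (gen_form x) (bm N))"
        using NV by (simp add: lin_map_sum[OF vsp lin] lin_map_scl[OF lin])
      finally have 1: "(\<Sum>N\<in>\<N>. c N \<odot> contr (gen_form x) (bm N)) \<in> fil ?k" by (simp add: algebra_simps)
      have "(\<Sum>N\<in>\<N>. c N \<odot> (contr (gen_form x) (bm N) - of_nat (count N x) \<odot> bm (N - {#x#}))) \<in> fil ?k"
      proof (intro fil_sum fil_scl)
        fix N assume N: "N \<in> \<N>"
        have "\<And>y. y \<in># N \<Longrightarrow> dg y \<le> dg x" using xmax N by blast
        from contr_gen_form_bm[OF x NV(2)[OF N] this] NV(4)[OF N]
        show "contr (gen_form x) (bm N) - of_nat (count N x) \<odot> bm (N - {#x#}) \<in> fil ?k" by simp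
      qed
      then have "(\<Sum>N\<in>\<N>. c N \<odot> contr (gen_form x) (bm N))
         - (\<Sum>N\<in>\<N>. (c N * of_nat (count N x)) \<odot> bm (N - {#x#})) \<in> fil ?k"
        by (simp add: vs.scale_right_diff_distrib sum_subtractf)
      from fil_diff[OF 1 this] have 2: "(\<Sum>N\<in>\<N>. (c N * of_nat (count N x)) \<odot> bm (N - {#x#})) \<in> fil ?k"
        by simp
      define \<P> where "\<P> = {N \<in> \<N>. x \<in># N}"
      have finP: "finite \<P>" using finN by (simp add: \<P>_def)
      have "(\<Sum>N\<in>\<N>. (c N * of_nat (count N x)) \<odot> bm (N - {#x#}))
          = (\<Sum>N\<in>\<P>. (c N * of_nat (count N x)) \<odot> bm (N - {#x#}))"
        using finN by (intro sum.mono_neutral_right) (auto simp: \<P>_def not_in_iff)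
      also have "\<dots> = (\<Sum>K\<in>(\<lambda>N. N - {#x#}) ` \<P>. (c (add_mset x K) * of_nat (count (add_mset x K) x)) \<odot> bm K)"
        by (subst sum.reindex) (auto simp: inj_on_def \<P>_def intro!: sum.cong multi_member_split dest: insert_DiffM)
      finally have 3: "(\<Sum>K\<in>(\<lambda>N. N - {#x#}) ` \<P>. (c (add_mset x K) * of_nat (count (add_mset x K) x)) \<odot> bm K)
          \<in> fil (J - int (ht x) - 1)" using 2 by simp
      obtain N where N: "N \<in> \<P>" using xU by (auto simp: \<P>_def)
      have "m - dg x < m" using Gens_dg[OF x] False by simp
      then have "(\<lambda>K. c (add_mset x K) * of_nat (count (add_mset x K) x)) (N - {#x#}) = 0"
      proof (rule less.IH[OF _ _ _ 3])
        show "finite ((\<lambda>N. N - {#x#}) ` \<P>)" using finP by simp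
        show "N - {#x#} \<in> (\<lambda>N. N - {#x#}) ` \<P>" using N by blast
        fix K assume "K \<in> (\<lambda>N. N - {#x#}) ` \<P>"
        then obtain N where N: "N \<in> \<N>" "x \<in># N" "K = N - {#x#}" by (auto simp: \<P>_def)
        then show "set_mset K \<subseteq> Gens \<and> DG K = m - dg x \<and> HT K = J - int (ht x)"
          using NV[OF N(1)] HT_remove[OF N(2)] DG_remove[OF N(2)] by (auto dest: in_diffD)
      qed
      then have "c N * of_nat (count N x) = 0" using N by (simp add: \<P>_def)
      then show False using N by (auto simp: \<P>_def \<N>_def not_in_iff[symmetric])
    qed
  qed
qed

end

text \<open>The trace does not depend on the basis: express the diagonal entries for either basis by the
  entries of the two transition matrices and interchange the summations.\<close>

lemma trace_on_basis:
  fixes V :: "('k::field, 'a::ab_group_add, 'z) vspace_scheme"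
  assumes v: "vector_space (scl V)" and B: "finite B" "\<not> module.dependent (scl V) B"
    "module.span (scl V) B = car V" and f: "lin_map V V f"
  shows "trace_on V f = (\<Sum>b\<in>B. module.representation (scl V) B (f b) b)"
proof -
  interpret vector_space "scl V" by fact
  have isV: "is_vspace V" using v B(3)[symmetric] by (simp add: is_vspace_def)
  let ?A = "SOME B. \<not> dependent B \<and> vspan V B = car V"
  have "\<not> dependent ?A \<and> vspan V ?A = car V"
    by (rule someI[of "\<lambda>B. \<not> dependent B \<and> vspan V B = car V" B]) (use B in \<open>simp add: vspan_def\<close>)
  then have A: "independent ?A" "span ?A = car V" by (auto simp: vspan_def)
  define A where "A = ?A"
  have A: "independent A" "span A = car V" using A by (auto simp: A_def)
  have finA: "finite A" using independent_span_bound[OF B(1) A(1)] A(2) B(3) span_superset[of A] by auto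
  have inA: "a \<in> car V" if "a \<in> A" for a using that A(2) span_base by blast
  have inB: "b \<in> car V" if "b \<in> B" for b using that B(3) span_base by blast
  have fV: "f x \<in> car V" if "x \<in> car V" for x using lin_map_car[OF f that] .
  let ?rA = "representation A" and ?rB = "representation B"
  have rA: "?rA (f a) a = (\<Sum>b\<in>B. ?rB a b * ?rA (f b) a)" if a: "a \<in> A" for a
  proof -
    have "f a = f (\<Sum>b\<in>B. scl V (?rB a b) b)"
      using sum_representation_eq[OF B(2) _ B(1) subset_refl, of a] inA[OF a] B(3) by simp
    also have "\<dots> = (\<Sum>b\<in>B. scl V (?rB a b) (f b))"
      using inB by (subst lin_map_sum[OF isV f]) (auto simp: lin_map_scl[OF f] car_scl[OF isV])
    finally have "?rA (f a) a = ?rA (\<Sum>b\<in>B. scl V (?rB a b) (f b)) a" by simp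
    also have "\<dots> = (\<Sum>b\<in>B. ?rA (scl V (?rB a b) (f b)) a)"
      using A inB fV by (subst representation_sum) (auto intro: car_scl[OF isV])
    finally show ?thesis using A inB fV by (simp add: representation_scale)
  qed
  have rB: "?rB (f b) b = (\<Sum>a\<in>A. ?rA (f b) a * ?rB a b)" if b: "b \<in> B" for b
  proof -
    have "f b = (\<Sum>a\<in>A. scl V (?rA (f b) a) a)"
      using sum_representation_eq[OF A(1) _ finA subset_refl, of "f b"] fV[OF inB[OF b]] A(2) by simp
    then have "?rB (f b) b = ?rB (\<Sum>a\<in>A. scl V (?rA (f b) a) a) b" by simp
    also have "\<dots> = (\<Sum>a\<in>A. ?rB (scl V (?rA (f b) a) a) b)"
      using B inA by (subst representation_sum) (auto intro: car_scl[OF isV])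
    finally show ?thesis using B inA by (simp add: representation_scale)
  qed
  have "trace_on V f = (\<Sum>a\<in>A. ?rA (f a) a)" unfolding trace_on_def A_def Let_def ..
  also have "\<dots> = (\<Sum>a\<in>A. \<Sum>b\<in>B. ?rB a b * ?rA (f b) a)" using rA by simp
  also have "\<dots> = (\<Sum>b\<in>B. \<Sum>a\<in>A. ?rA (f b) a * ?rB a b)"
    by (subst sum.swap) (simp add: mult.commute)
  also have "\<dots> = (\<Sum>b\<in>B. ?rB (f b) b)" using rB by simp
  finally show ?thesis .
qed

context locally_finite_hopf_algebra
begin

section \<open>The monomials span\<close>

text \<open>The span of all products of at least \<open>k\<close> generators of total height \<open>J\<close> and total degree \<open>m\<close>, together
  with lower terms; modulo \<open>F\<^sub>J\<^sub>-\<^sub>1\<close> it corresponds to \<open>I\<^sup>k\<close>.\<close>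

definition Sp :: "nat \<Rightarrow> int \<Rightarrow> nat \<Rightarrow> 'a set" where
  "Sp k J m = vs.span ((fil (J - 1) \<inter> D m) \<union>
     {prodl ys | ys. set ys \<subseteq> Gens \<and> k \<le> length ys \<and> HT (mset ys) = J \<and> DG (mset ys) = m})"

lemma Sp_subspace: "vs.subspace (Sp k J m)"
  unfolding Sp_def by (rule vs.subspace_span)

lemmas Sp_0 [simp, intro] = vs.subspace_0[OF Sp_subspace]
  and Sp_add [intro] = vs.subspace_add[OF Sp_subspace]
  and Sp_scl [intro] = vs.subspace_scale[OF Sp_subspace]

lemma Sp_lower: "x \<in> fil (J - 1) \<Longrightarrow> x \<in> D m \<Longrightarrow> x \<in> Sp k J m"
  unfolding Sp_def by (intro vs.span_base) blast

lemma Sp_prodl: "set ys \<subseteq> Gens \<Longrightarrow> k \<le> length ys \<Longrightarrow> prodl ys \<in> Sp k (HT (mset ys)) (DG (mset ys))"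
  unfolding Sp_def by (intro vs.span_base) blast

lemma Sp_minimal:
  assumes "vs.subspace S" "\<And>x. x \<in> fil (J - 1) \<Longrightarrow> x \<in> D m \<Longrightarrow> x \<in> S"
    "\<And>ys. set ys \<subseteq> Gens \<Longrightarrow> k \<le> length ys \<Longrightarrow> HT (mset ys) = J \<Longrightarrow> DG (mset ys) = m \<Longrightarrow> prodl ys \<in> S"
  shows "Sp k J m \<subseteq> S"
  unfolding Sp_def using assms by (intro vs.span_minimal) auto

lemma Sp_sub: "Sp k J m \<subseteq> fil J \<inter> D m"
proof (rule Sp_minimal)
  show "vs.subspace (fil J \<inter> D m)" using fil_subspace D_subspace by (intro vs.subspace_inter)
  show "x \<in> fil J \<inter> D m" if "x \<in> fil (J - 1)" "x \<in> D m" for x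
    using that fil_mono[of "J - 1" J] by auto
  show "prodl ys \<in> fil J \<inter> D m" if "set ys \<subseteq> Gens" "HT (mset ys) = J" "DG (mset ys) = m" for ys
    using that prodl_fil[of ys] prodl_D[of ys] by auto
qed

lemma Sp_mono: "k \<le> l \<Longrightarrow> Sp l J m \<subseteq> Sp k J m"
  by (rule Sp_minimal[OF Sp_subspace Sp_lower]) (use Sp_prodl in auto)

lemma subspace_mul:
  assumes "vs.subspace S" "t \<in> V"
  shows "vs.subspace {s \<in> V. s \<cdot> t \<in> S}" "vs.subspace {s \<in> V. t \<cdot> s \<in> S}"
  using assms unfolding vs.subspace_def by (auto simp: mul_add mul_scl)

lemma Sp_mul:
  assumes "s \<in> Sp k J m" "t \<in> Sp k' J' m'"
  shows "s \<cdot> t \<in> Sp (k + k') (J + J') (m + m')"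
proof -
  let ?S = "Sp (k + k') (J + J') (m + m')"
  have t: "t \<in> fil J'" "t \<in> D m'" using assms(2) Sp_sub by blast+
  have "Sp k J m \<subseteq> {s \<in> V. s \<cdot> t \<in> ?S}"
  proof (rule Sp_minimal)
    show "vs.subspace {s \<in> V. s \<cdot> t \<in> ?S}" using t Sp_subspace by (intro subspace_mul) auto
    show "x \<in> {s \<in> V. s \<cdot> t \<in> ?S}" if x: "x \<in> fil (J - 1)" "x \<in> D m" for x
    proof -
      have "x \<cdot> t \<in> fil (J + J' - 1)" using fil_mul[OF x(1) t(1)] by (simp add: algebra_simps)
      then show ?thesis using Sp_lower mul_D[OF x(2) t(2)] x by auto
    qed
    fix ys assume ys: "set ys \<subseteq> Gens" "k \<le> length ys" "HT (mset ys) = J" "DG (mset ys) = m"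
    have yV: "prodl ys \<in> V" "prodl ys \<in> fil J" "prodl ys \<in> D m"
      using ys prodl_fil[OF ys(1)] prodl_D[OF ys(1)] by auto
    have "Sp k' J' m' \<subseteq> {t \<in> V. prodl ys \<cdot> t \<in> ?S}"
    proof (rule Sp_minimal)
      show "vs.subspace {t \<in> V. prodl ys \<cdot> t \<in> ?S}" using yV Sp_subspace by (intro subspace_mul) auto
      show "x \<in> {t \<in> V. prodl ys \<cdot> t \<in> ?S}" if x: "x \<in> fil (J' - 1)" "x \<in> D m'" for x
      proof -
        have "prodl ys \<cdot> x \<in> fil (J + J' - 1)" using fil_mul[OF yV(2) x(1)] by (simp add: algebra_simps)
        then show ?thesis using Sp_lower mul_D[OF yV(3) x(2)] x by auto
      qed
      fix zs assume zs: "set zs \<subseteq> Gens" "k' \<le> length zs" "HT (mset zs) = J'" "DG (mset zs) = m'"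
      then show "prodl zs \<in> {t \<in> V. prodl ys \<cdot> t \<in> ?S}"
        using Sp_prodl[of "ys @ zs" "k + k'"] prodl_append[of ys zs] ys by auto
    qed
    then show "prodl ys \<in> {s \<in> V. s \<cdot> t \<in> ?S}" using assms(2) yV by blast
  qed
  then show ?thesis using assms(1) by blast
qed

lemma Gens_Sp: "x \<in> Gens \<Longrightarrow> x \<in> Sp 1 (int (ht x)) (dg x)"
  using Sp_prodl[of "[x]" 1] by auto

text \<open>The generators generate: a complement of the decomposables consists of generators, and the factors
  of decomposables have smaller degree.\<close>

lemma Sp_generate:
  assumes "m > 0"
  shows "Dec J m \<subseteq> Sp 2 J m" "fil J \<inter> D m \<subseteq> Sp 1 J m"
proof -
  have "Dec J m \<subseteq> Sp 2 J m \<and> fil J \<inter> D m \<subseteq> Sp 1 J m" for J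
    using assms
  proof (induction m arbitrary: J rule: less_induct)
    case (less m)
    have Dec: "Dec J m \<subseteq> Sp 2 J m"
      unfolding Dec_def
    proof (rule vs.span_minimal[OF _ Sp_subspace], rule Un_least)
      show "fil (J - 1) \<inter> D m \<subseteq> Sp 2 J m" using Sp_lower by blast
      have "u \<cdot> v \<in> Sp 2 J m" if *: "u \<in> fil a" "u \<in> D p" "v \<in> fil b" "v \<in> D q" "0 < p" "0 < q"
        "p + q = m" "a + b \<le> J" for u v a b p q
      proof (cases "a + b = J")
        case True
        have "u \<in> Sp 1 a p" "v \<in> Sp 1 b q" using less.IH[of p a] less.IH[of q b] * by auto
        from Sp_mul[OF this] show ?thesis using True *(7) by (simp add: numeral_2_eq_2)
      next
        case False
        then have "u \<cdot> v \<in> fil (J - 1)" using fil_mul[OF *(1,3)] fil_mono[of "a + b" "J - 1"] *(8) by auto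
        then show ?thesis using Sp_lower mul_D[OF *(2,4)] *(7) by simp
      qed
      then show "{u \<cdot> v |u v a b p q. u \<in> fil a \<and> u \<in> D p \<and> v \<in> fil b \<and> v \<in> D q \<and> 0 < p \<and> 0 < q
          \<and> p + q = m \<and> a + b \<le> J} \<subseteq> Sp 2 J m" by auto
    qed
    have "Xs J m \<subseteq> Sp 1 J m" using GensI[of _ J m] Gens_Sp less.prems by fastforce
    moreover have "Dec J m \<subseteq> Sp 1 J m" using Dec Sp_mono[of 1 2 J m] by auto
    ultimately have "vs.span (Xs J m \<union> Dec J m) \<subseteq> Sp 1 J m" by (intro vs.span_minimal Sp_subspace) auto
    then show ?case using Dec Xs_span[of J m] by blast
  qed
  then show "Dec J m \<subseteq> Sp 2 J m" "fil J \<inter> D m \<subseteq> Sp 1 J m" by blast+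
qed

definition Mon :: "nat \<Rightarrow> 'a multiset set" where "Mon m = {M. set_mset M \<subseteq> Gens \<and> DG M = m}"

lemma size_le_DG: "set_mset M \<subseteq> Gens \<Longrightarrow> size M \<le> DG M"
proof (induction M)
  case (add x M)
  then show ?case using Gens_dg[of x] by auto
qed simp

lemma Mon_wmon: "m \<le> N \<Longrightarrow> Mon m = wmon dg {x \<in> Gens. dg x \<le> N} m"
  using DG_ge by (fastforce simp: Mon_def wmon_def DG_def)

lemma finite_Mon: "finite (Mon m)"
proof -
  have "{x \<in> Gens. dg x \<le> m} = (\<Union>l\<in>{..m}. {x \<in> Gens. dg x = l})" by auto
  then have "finite {x \<in> Gens. dg x \<le> m}" using Gens_deg_finite by simp
  then show ?thesis unfolding Mon_wmon[OF order_refl] using Gens_dg by (intro finite_wmon) auto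
qed

lemma Sp_bm_step:
  assumes "fil (J - 1) \<inter> D m \<subseteq> vs.span (bm ` {M \<in> Mon m. HT M \<le> J - 1})"
  shows "Sp k J m \<subseteq> vs.span (bm ` {M \<in> Mon m. HT M < J \<or> (HT M = J \<and> k \<le> size M)})"
proof (rule Sp_minimal)
  let ?T = "{M \<in> Mon m. HT M < J \<or> (HT M = J \<and> k \<le> size M)}"
  have "{M \<in> Mon m. HT M \<le> J - 1} \<subseteq> ?T" by auto
  from vs.span_mono[OF image_mono[OF this]] assms
  have low: "x \<in> vs.span (bm ` ?T)" if "x \<in> fil (J - 1)" "x \<in> D m" for x using that by blast
  show "vs.subspace (vs.span (bm ` ?T))" by simp
  show "x \<in> vs.span (bm ` ?T)" if "x \<in> fil (J - 1)" "x \<in> D m" for x using low that .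
  fix ys assume ys: "set ys \<subseteq> Gens" "k \<le> length ys" "HT (mset ys) = J" "DG (mset ys) = m"
  let ?M = "mset ys"
  have "?M \<in> ?T" using ys by (auto simp: Mon_def)
  then have 1: "bm ?M \<in> vs.span (bm ` ?T)" by (intro vs.span_base imageI)
  have "prodl ys - bm ?M \<in> fil (J - 1)" using bm_perm[of ys ?M] ys by auto
  moreover have "prodl ys - bm ?M \<in> D m" using prodl_D[OF ys(1)] bm_D[of ?M] ys by auto
  ultimately have "(prodl ys - bm ?M) + bm ?M \<in> vs.span (bm ` ?T)" using low 1 vs.span_add by blast
  then show "prodl ys \<in> vs.span (bm ` ?T)" by simp
qed

lemma fil_bm_span: "fil J \<inter> D m \<subseteq> vs.span (bm ` {M \<in> Mon m. HT M \<le> J})"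
proof -
  have "fil (int n - 1) \<inter> D m \<subseteq> vs.span (bm ` {M \<in> Mon m. HT M \<le> int n - 1})" for n
  proof (induction n)
    case 0
    then show ?case by (auto simp: fil_neg vs.span_zero)
  next
    case (Suc n)
    show ?case
    proof (cases "m = 0")
      case True
      have "{#} \<in> {M \<in> Mon m. HT M \<le> int (Suc n) - 1}" using True by (auto simp: Mon_def)
      then have "bm {#} \<in> vs.span (bm ` {M \<in> Mon m. HT M \<le> int (Suc n) - 1})"
        by (intro vs.span_base imageI)
      then have "vs.span {\<one>} \<subseteq> vs.span (bm ` {M \<in> Mon m. HT M \<le> int (Suc n) - 1})"
        unfolding bm_empty by (intro vs.span_minimal) auto
      then show ?thesis using D0_span True by auto
    next
      case False
      have "Sp 1 (int n) m \<subseteq> vs.span (bm ` {M \<in> Mon m. HT M < int n \<or> (HT M = int n \<and> 1 \<le> size M)})"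
        by (rule Sp_bm_step[OF Suc])
      also have "\<dots> \<subseteq> vs.span (bm ` {M \<in> Mon m. HT M \<le> int n})"
        by (intro vs.span_mono image_mono) auto
      finally show ?thesis using Sp_generate(2)[of m "int n"] False by auto
    qed
  qed
  from this[of "nat (J + 1)"] show ?thesis
    by (cases "J < 0") (auto simp: fil_neg vs.span_zero)
qed

lemmas Sp_bm_span = Sp_bm_step[OF fil_bm_span]

abbreviation MB where "MB m \<equiv> bm ` Mon m"

lemma MB_span: "vs.span (MB m) = D m"
proof
  show "vs.span (MB m) \<subseteq> D m"
    using bm_D by (intro vs.span_minimal D_subspace) (auto simp: Mon_def)
  have "D m \<subseteq> fil (int m) \<inter> D m" using D_fil by blast
  also have "\<dots> \<subseteq> vs.span (MB m)"
    using fil_bm_span[of "int m" m] vs.span_mono[of "bm ` {M \<in> Mon m. HT M \<le> int m}" "MB m"] by blast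
  finally show "D m \<subseteq> vs.span (MB m)" .
qed

text \<open>Apply \<open>bm_independent_mod\<close> to the part of largest height in a relation.\<close>

lemma bm_lin_indep:
  assumes s: "(\<Sum>M\<in>Mon m. c M \<odot> bm M) = 0" and M: "M \<in> Mon m"
  shows "c M = 0"
proof (rule ccontr)
  assume cM: "c M \<noteq> 0"
  define \<N> where "\<N> = {N \<in> Mon m. c N \<noteq> 0}"
  have fin: "finite \<N>" "\<N> \<noteq> {}" using finite_Mon cM M by (auto simp: \<N>_def)
  define J where "J = Max (HT ` \<N>)"
  have "J \<in> HT ` \<N>" unfolding J_def using fin by (intro Max_in) auto
  then obtain N where N: "N \<in> \<N>" "HT N = J" by auto
  have le: "HT K \<le> J" if "K \<in> \<N>" for K unfolding J_def using fin that by (intro Max_ge) auto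
  let ?T = "{K \<in> \<N>. HT K = J}"
  have "0 = (\<Sum>K\<in>\<N>. c K \<odot> bm K)"
    unfolding s[symmetric] using finite_Mon by (intro sum.mono_neutral_right) (auto simp: \<N>_def)
  also have "\<dots> = (\<Sum>K\<in>?T. c K \<odot> bm K) + (\<Sum>K\<in>\<N> - ?T. c K \<odot> bm K)"
    using fin by (subst sum.union_disjoint[symmetric]) (auto intro!: sum.cong)
  finally have e: "(\<Sum>K\<in>?T. c K \<odot> bm K) = 0 - (\<Sum>K\<in>\<N> - ?T. c K \<odot> bm K)" by (simp add: algebra_simps eq_neg_iff_add_eq_0)
  have "(\<Sum>K\<in>\<N> - ?T. c K \<odot> bm K) \<in> fil (J - 1)"
  proof (intro fil_sum fil_scl)
    fix K assume K: "K \<in> \<N> - ?T"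
    then have "HT K \<le> J - 1" using le[of K] by auto
    moreover have "bm K \<in> fil (HT K)" using K by (intro bm_fil) (auto simp: \<N>_def Mon_def)
    ultimately show "bm K \<in> fil (J - 1)" using fil_mono by blast
  qed
  then have "(\<Sum>K\<in>?T. c K \<odot> bm K) \<in> fil (J - 1)" unfolding e by (intro fil_diff) auto
  moreover have "finite ?T" using fin by simp
  ultimately have "c N = 0"
    using N by (intro bm_independent_mod[where \<M> = ?T and m = m and J = J]) (auto simp: \<N>_def Mon_def)
  then show False using N by (simp add: \<N>_def)
qed

lemma bm_inj: "inj_on bm (Mon m)"
proof (rule inj_onI, rule ccontr)
  fix M N assume MN: "M \<in> Mon m" "N \<in> Mon m" "bm M = bm N" "M \<noteq> N"
  define c :: "'a multiset \<Rightarrow> 'k" where "c = (\<lambda>K. if K = M then 1 else if K = N then -1 else 0)"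
  have "(\<Sum>K\<in>Mon m. c K \<odot> bm K) = (\<Sum>K\<in>{M, N}. c K \<odot> bm K)"
    using MN finite_Mon by (intro sum.mono_neutral_right) (auto simp: c_def)
  also have "\<dots> = 0" using MN by (simp add: c_def)
  finally have "c M = 0" using bm_lin_indep MN(1) by blast
  then show False by (simp add: c_def)
qed

lemma MB_finite: "finite (MB m)" using finite_Mon by blast

lemma MB_indep: "vs.independent (MB m)"
proof
  assume "vs.dependent (MB m)"
  then obtain u v where uv: "v \<in> MB m" "u v \<noteq> 0" "(\<Sum>v\<in>MB m. u v \<odot> v) = 0"
    using vs.dependent_finite[OF MB_finite] by blast
  from uv(3) have "(\<Sum>M\<in>Mon m. u (bm M) \<odot> bm M) = 0" by (simp add: sum.reindex[OF bm_inj])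
  then show False using bm_lin_indep[of "\<lambda>M. u (bm M)" m] uv by auto
qed

section \<open>Convolution powers\<close>

lemma conv_lin: assumes "lin P" "lin Q" shows "lin (conv H P Q)"
proof -
  have "conv H P Q x = tensor_lift H H (\<lambda>a b. P a \<cdot> Q b) (coprd H x)" if x: "x \<in> V" for x
  proof -
    obtain ps where ps: "cop x ps" using cop_ex[OF x] by blast
    show ?thesis
      using conv_cop[OF ps assms] lift_cop[OF ps vsp lin_prod_bilin[OF assms]] by simp
  qed
  moreover have "lin (\<lambda>x. tensor_lift H H (\<lambda>a b. P a \<cdot> Q b) (coprd H x))"
    by (rule lin_map_comp[OF coprd_lin tensor_lift_lin[OF vsp vsp vsp lin_prod_bilin[OF assms]]])
  ultimately show ?thesis by (simp add: lin_map_def)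
qed

lemma unit_counit_lin: "lin (unit_counit H)"
  using cu_lform by (auto simp: unit_counit_def lin_map_def vs.scale_left_distrib)

lemma conv_pow_lin: "lin P \<Longrightarrow> lin (conv_pow H P n)"
  by (induction n) (auto intro: unit_counit_lin conv_lin)

text \<open>The convolution power \<open>id\<^sup>*\<^sup>n\<close>, which is the Adams operator for a natural number \<open>n\<close>.\<close>

definition psi :: "nat \<Rightarrow> 'a \<Rightarrow> 'a" where "psi n = conv_pow H (\<lambda>x. x) n"

lemma psi_lin: "lin (psi n)"
  unfolding psi_def by (rule conv_pow_lin[OF lin_map_id(1)])

lemma psi_V [simp, intro]: "x \<in> V \<Longrightarrow> psi n x \<in> V"
  using lin_map_car[OF psi_lin] .

lemma psi_0: "psi 0 x = \<epsilon> x \<odot> \<one>"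
  by (simp add: psi_def unit_counit_def)

lemma psi_Suc: "cop x ps \<Longrightarrow> psi (Suc n) x = psum (\<lambda>a b. a \<cdot> psi n b) ps"
  using conv_cop[OF _ lin_map_id(1) psi_lin] by (simp add: psi_def)

lemma psi_one: "psi n \<one> = \<one>"
  by (induction n) (simp_all add: psi_0 psi_Suc[OF cop_one])

lemma psum_D: "(\<And>a b. (a, b) \<in> set ps \<Longrightarrow> g a b \<in> D k) \<Longrightarrow> psum g ps \<in> D k"
  by (induction ps) auto

lemma psi_fil_D: "x \<in> fil i \<Longrightarrow> x \<in> D m \<Longrightarrow> psi n x \<in> fil i \<and> psi n x \<in> D m"
proof (induction n arbitrary: x i m)
  case 0
  show ?case
  proof (cases "m = 0")
    case True
    then show ?thesis using D0_eq[of x] 0 by (simp add: psi_0)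
  next
    case False
    then show ?thesis using cu_D[OF 0(2)] by (simp add: psi_0)
  qed
next
  case (Suc n)
  obtain ps where ps: "cop x ps" "set ps \<subseteq> pieces i m" using cop_fil[OF Suc.prems] by blast
  have "u \<cdot> psi n v \<in> fil i \<and> u \<cdot> psi n v \<in> D m" if uv: "(u, v) \<in> set ps" for u v
  proof -
    obtain a p where *: "p \<le> m" "u \<in> fil a" "u \<in> D p" "v \<in> fil (i - a)" "v \<in> D (m - p)"
      using piecesD[OF ps(2) uv] by blast
    from Suc.IH[OF *(4,5)] show ?thesis using fil_mul[OF *(2)] mul_D[OF *(3)] *(1) by fastforce
  qed
  then show ?case unfolding psi_Suc[OF ps(1)] by (intro conjI psum_fil psum_D) auto
qed

text \<open>The coproduct is multiplicative, and modulo lower filtration the factors may be interchanged.\<close>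

lemma psi_mul:
  assumes "x \<in> fil i" "x \<in> D m" "y \<in> fil j" "y \<in> D l"
  shows "psi n (x \<cdot> y) - psi n x \<cdot> psi n y \<in> fil (i + j - 1)"
  using assms
proof (induction n arbitrary: x y i j m l)
  case 0
  then have "x \<in> V" "y \<in> V" by auto
  then show ?case by (simp add: psi_0 mul_scl counit_prd mult.commute)
next
  case (Suc n)
  obtain ps where ps: "cop x ps" "set ps \<subseteq> pieces i m" using cop_fil[OF Suc.prems(1,2)] by blast
  obtain qs where qs: "cop y qs" "set qs \<subseteq> pieces j l" using cop_fil[OF Suc.prems(3,4)] by blast
  note pV = copD[OF ps(1)] and qV = copD[OF qs(1)]
  have E1: "psi (Suc n) (x \<cdot> y) = psum (\<lambda>a b. psum (\<lambda>c d. (a \<cdot> c) \<cdot> psi n (b \<cdot> d)) qs) ps"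
    unfolding psi_Suc[OF cop_mult[OF ps(1) qs(1)]] psum_concat psum_map ..
  have "psi (Suc n) x \<cdot> psi (Suc n) y = psum (\<lambda>a b. (a \<cdot> psi n b) \<cdot> psi (Suc n) y) ps"
    unfolding psi_Suc[OF ps(1)] using pV qV(1) by (intro mul_psum) auto
  also have "\<dots> = psum (\<lambda>a b. psum (\<lambda>c d. (a \<cdot> psi n b) \<cdot> (c \<cdot> psi n d)) qs) ps"
    unfolding psi_Suc[OF qs(1)] using pV qV by (intro psum_cong mul_psum) auto
  finally have E2: "psi (Suc n) x \<cdot> psi (Suc n) y
    = psum (\<lambda>a b. psum (\<lambda>c d. (a \<cdot> psi n b) \<cdot> (c \<cdot> psi n d)) qs) ps" .
  have "psi (Suc n) (x \<cdot> y) - psi (Suc n) x \<cdot> psi (Suc n) y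
    = psum (\<lambda>a b. psum (\<lambda>c d. (a \<cdot> c) \<cdot> psi n (b \<cdot> d) - (a \<cdot> psi n b) \<cdot> (c \<cdot> psi n d)) qs) ps"
    unfolding E1 E2 by (simp only: psum_diff)
  also have "\<dots> \<in> fil (i + j - 1)"
  proof (intro psum_fil)
    fix a b c d assume ab: "(a, b) \<in> set ps" and cd: "(c, d) \<in> set qs"
    obtain i1 r1 where 1: "a \<in> fil i1" "a \<in> D r1" "b \<in> fil (i - i1)" "b \<in> D (m - r1)" using piecesD[OF ps(2) ab] by blast
    obtain i2 r2 where 2: "c \<in> fil i2" "c \<in> D r2" "d \<in> fil (j - i2)" "d \<in> D (l - r2)" using piecesD[OF qs(2) cd] by blast
    have b': "psi n b \<in> fil (i - i1)" and d': "psi n d \<in> fil (j - i2)"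
      using psi_fil_D[OF 1(3,4)] psi_fil_D[OF 2(3,4)] by auto
    have V: "a \<in> V" "b \<in> V" "c \<in> V" "d \<in> V" using 1 2 by auto
    have "(a \<cdot> c) \<cdot> psi n (b \<cdot> d) - (a \<cdot> psi n b) \<cdot> (c \<cdot> psi n d)
      = (a \<cdot> c) \<cdot> (psi n (b \<cdot> d) - psi n b \<cdot> psi n d) + a \<cdot> ((c \<cdot> psi n b - psi n b \<cdot> c) \<cdot> psi n d)"
      using V by (simp add: mul_diff mul_assoc)
    moreover have "(a \<cdot> c) \<cdot> (psi n (b \<cdot> d) - psi n b \<cdot> psi n d) \<in> fil (i + j - 1)"
      using fil_mul[OF fil_mul[OF 1(1) 2(1)] Suc.IH[OF 1(3,4) 2(3,4)]] by (simp add: algebra_simps)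
    moreover have "a \<cdot> ((c \<cdot> psi n b - psi n b \<cdot> c) \<cdot> psi n d) \<in> fil (i + j - 1)"
      using fil_mul[OF 1(1) fil_mul[OF commutator[OF 2(1) b'] d']] by (simp add: algebra_simps)
    ultimately show "(a \<cdot> c) \<cdot> psi n (b \<cdot> d) - (a \<cdot> psi n b) \<cdot> (c \<cdot> psi n d) \<in> fil (i + j - 1)"
      using fil_add by metis
  qed
  finally show ?case .
qed

text \<open>In \<open>id * \<Psi>\<^sub>n\<close> the outer terms of the coproduct contribute \<open>x\<close> and \<open>\<Psi>\<^sub>n x\<close>, the inner ones decomposables.\<close>

lemma psi_mod_Dec:
  assumes x: "x \<in> fil i" "x \<in> D m" and m: "m > 0"
  shows "psi n x - of_nat n \<odot> x \<in> Dec i m"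
proof (induction n)
  case 0
  then show ?case using cu_D[OF x(2) m] by (simp add: psi_0 Dec_def vs.span_zero)
next
  case (Suc n)
  obtain ps where ps: "cop x ((x, \<one>) # (\<one>, x) # ps)"
    "set ps \<subseteq> inner_pieces i m" using cop_reduced[OF x m] by blast
  have Wg: "u \<cdot> psi n v \<in> Dec i m" if uv: "(u, v) \<in> set ps" for u v
  proof -
    obtain a p where *: "0 < p" "p < m" "u \<in> fil a" "u \<in> D p" "v \<in> fil (i - a)" "v \<in> D (m - p)"
      using inner_piecesD[OF ps(2) uv] by blast
    show ?thesis using Dec_prod[OF *(3,4) conjunct1[OF psi_fil_D[OF *(5,6)]] conjunct2[OF psi_fil_D[OF *(5,6)]], of i] *
      by simp
  qed
  then have "psum (\<lambda>a b. a \<cdot> psi n b) ps \<in> Dec i m"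
    unfolding Dec_def by (induction ps) (auto intro: vs.span_zero vs.span_add)
  moreover have "psi (Suc n) x - of_nat (Suc n) \<odot> x = (psi n x - of_nat n \<odot> x) + psum (\<lambda>a b. a \<cdot> psi n b) ps"
    using x psi_Suc[OF ps(1), of n] by (simp add: psi_one vs.scale_left_distrib)
  ultimately show ?case using Suc unfolding Dec_def by (auto intro: vs.span_add)
qed

text \<open>By \<open>psi_mul\<close> the factors may be treated separately, and each contributes a factor \<open>n\<close> up to
  decomposables, which make the product longer.\<close>

lemma psi_prodl:
  assumes "set ys \<subseteq> Gens"
  shows "psi n (prodl ys) - of_nat n ^ length ys \<odot> prodl ys
    \<in> Sp (Suc (length ys)) (HT (mset ys)) (DG (mset ys))"
  using assms
proof (induction ys)
  case Nil
  then show ?case by (simp add: psi_one)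
next
  case (Cons y ys)
  have y: "y \<in> Gens" and ys: "set ys \<subseteq> Gens" using Cons.prems by auto
  let ?P = "prodl ys" and ?k = "length ys" and ?J = "int (ht y) + HT (mset ys)" and ?m = "dg y + DG (mset ys)"
  define c :: 'k where "c = of_nat n"
  define w where "w = psi n y - c \<odot> y"
  define s where "s = psi n ?P - c ^ ?k \<odot> ?P"
  define A where "A = psi n (y \<cdot> ?P) - psi n y \<cdot> psi n ?P"
  note yf = Gens_fil[OF y] and yD = Gens_D[OF y] and Pf = prodl_fil[OF ys] and PD = prodl_D[OF ys]
  have w: "w \<in> Sp 2 (int (ht y)) (dg y)"
    unfolding w_def c_def using psi_mod_Dec[OF yf yD Gens_dg[OF y]] Sp_generate(1)[OF Gens_dg[OF y]] by blast
  have s: "s \<in> Sp (Suc ?k) (HT (mset ys)) (DG (mset ys))" unfolding s_def c_def using Cons.IH[OF ys] .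
  have P: "?P \<in> Sp ?k (HT (mset ys)) (DG (mset ys))" using Sp_prodl[OF ys] by blast
  have Af: "A \<in> fil (?J - 1)" unfolding A_def using psi_mul[OF yf yD Pf PD] .
  have AD: "A \<in> D ?m"
    unfolding A_def using psi_fil_D[OF fil_mul[OF yf Pf] mul_D[OF yD PD]]
      mul_D[OF conjunct2[OF psi_fil_D[OF yf yD]] conjunct2[OF psi_fil_D[OF Pf PD]]] by blast
  have V: "y \<in> V" "?P \<in> V" "w \<in> V" "s \<in> V" using y ys w s Sp_sub by blast+
  have "psi n y \<cdot> psi n ?P = (c \<odot> y + w) \<cdot> (c ^ ?k \<odot> ?P + s)" by (simp add: w_def s_def)
  also have "\<dots> = (c ^ Suc ?k \<odot> (y \<cdot> ?P) + c \<odot> (y \<cdot> s)) + (c ^ ?k \<odot> (w \<cdot> ?P) + w \<cdot> s)"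
    using V by (simp add: mul_add mul_scl vs.scale_right_distrib)
  finally have "psi n (y \<cdot> ?P) - c ^ Suc ?k \<odot> (y \<cdot> ?P) = A + c \<odot> (y \<cdot> s) + c ^ ?k \<odot> (w \<cdot> ?P) + w \<cdot> s"
    unfolding A_def by (simp add: algebra_simps)
  moreover have "A \<in> Sp (Suc (Suc ?k)) ?J ?m" using Af AD by (rule Sp_lower)
  moreover have "y \<cdot> s \<in> Sp (Suc (Suc ?k)) ?J ?m" using Sp_mul[OF Gens_Sp[OF y] s] by simp
  moreover have "w \<cdot> ?P \<in> Sp (Suc (Suc ?k)) ?J ?m" using Sp_mul[OF w P] by simp
  moreover have "w \<cdot> s \<in> Sp (Suc (Suc ?k)) ?J ?m"
    using Sp_mul[OF w s] Sp_mono[of "Suc (Suc ?k)" "2 + Suc ?k"] by auto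
  ultimately show ?case unfolding c_def by (simp add: Sp_add Sp_scl del: power_Suc)
qed

text \<open>Ordered by increasing height and, for equal height, decreasing length, the monomials form a basis in
  which \<open>\<Psi>\<^sub>n\<close> is triangular.\<close>

lemma psi_bm_diag:
  assumes M: "M \<in> Mon m"
  shows "vs.representation (MB m) (psi n (bm M)) (bm M) = of_nat n ^ size M"
proof -
  obtain ys where ys: "mset ys = M" "bm M = prodl ys" by (rule bm_list)
  have G: "set ys \<subseteq> Gens" "DG M = m" using M ys(1) by (auto simp: Mon_def)
  define e where "e = psi n (bm M) - of_nat n ^ size M \<odot> bm M"
  let ?T = "{N \<in> Mon m. HT N < HT M \<or> (HT N = HT M \<and> Suc (size M) \<le> size N)}"
  have "e \<in> Sp (Suc (size M)) (HT M) m"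
    unfolding e_def using psi_prodl[OF G(1), of n] ys G(2) by auto
  then have eT: "e \<in> vs.span (bm ` ?T)" using Sp_bm_span by blast
  have sub: "bm ` ?T \<subseteq> MB m" by auto
  have bM: "bm M \<in> MB m" using M by blast
  have "bm M \<notin> bm ` ?T" using inj_onD[OF bm_inj[of m] _ M] by fastforce
  then have "vs.representation (bm ` ?T) e (bm M) = 0" using vs.representation_ne_zero by blast
  then have 0: "vs.representation (MB m) e (bm M) = 0"
    using vs.representation_extend[OF MB_indep eT sub] by simp
  have es: "e \<in> vs.span (MB m)" using eT vs.span_mono[OF sub] by blast
  have "psi n (bm M) = e + of_nat n ^ size M \<odot> bm M" by (simp add: e_def)
  then show ?thesis
    using 0 by (simp add: vs.representation_add[OF MB_indep vs.span_scale[OF vs.span_base[OF bM]] es]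
        vs.representation_scale[OF MB_indep vs.span_base[OF bM]] vs.representation_basis[OF MB_indep bM])
qed

section \<open>The Adams operators\<close>

definition aug :: "'a \<Rightarrow> 'a" where "aug y = y - unit_counit H y"

lemma aug_lin: "lin aug"
  using unit_counit_lin by (auto simp: aug_def lin_map_def vs.scale_right_diff_distrib)

abbreviation apow where "apow \<equiv> conv_pow H aug"

lemmas apow_lin = conv_pow_lin[OF aug_lin]

lemma apow_V [simp, intro]: "x \<in> V \<Longrightarrow> apow k x \<in> V"
  using lin_map_car[OF apow_lin] .

lemma apow_Suc: "cop x ps \<Longrightarrow> apow (Suc k) x = psum (\<lambda>a b. aug a \<cdot> apow k b) ps"
  using conv_cop[OF _ aug_lin apow_lin] by simp

lemma aug_D0: "x \<in> D 0 \<Longrightarrow> aug x = 0"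
  using D0_eq[of x] by (simp add: aug_def unit_counit_def)

lemma apow_D: "x \<in> D m \<Longrightarrow> apow k x \<in> D m \<and> (m < k \<longrightarrow> apow k x = 0)"
proof (induction k arbitrary: x m)
  case 0
  then show ?case using cu_D[of x m] by (cases "m = 0") (auto simp: unit_counit_def)
next
  case (Suc k)
  obtain ps where ps: "cop x ps" "\<And>a b. (a, b) \<in> set ps \<Longrightarrow> \<exists>p\<le>m. a \<in> D p \<and> b \<in> D (m - p)"
    using cop_D[OF Suc.prems] by blast
  have "aug a \<cdot> apow k b \<in> D m \<and> (m < Suc k \<longrightarrow> aug a \<cdot> apow k b = 0)" if ab: "(a, b) \<in> set ps" for a b
  proof -
    obtain p where p: "p \<le> m" "a \<in> D p" "b \<in> D (m - p)" using ps(2)[OF ab] by blast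
    show ?thesis
    proof (cases "p = 0")
      case True
      then show ?thesis using aug_D0[of a] p by auto
    next
      case False
      then have "aug a = a" using cu_D[OF p(2)] by (simp add: aug_def unit_counit_def)
      then show ?thesis using Suc.IH[OF p(3)] mul_D[OF p(2), of "apow k b" "m - p"] p False by auto
    qed
  qed
  then show ?case unfolding apow_Suc[OF ps(1)] by (auto intro: psum_D psum_0)
qed

lemma mul_sum_right:
  assumes "a \<in> V" "\<And>i. i \<in> I \<Longrightarrow> h i \<in> V" shows "a \<cdot> sum h I = (\<Sum>i\<in>I. a \<cdot> h i)"
  using lin_map_sum[OF vsp mul_lin2[OF assms(1)], of I h] assms(2) by blast

text \<open>The binomial theorem for \<open>id = \<iota>\<epsilon> + (id - \<iota>\<epsilon>)\<close> in the convolution algebra.\<close>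

lemma psi_binomial: "x \<in> V \<Longrightarrow> psi n x = (\<Sum>k\<le>n. of_nat (n choose k) \<odot> apow k x)"
proof (induction n arbitrary: x)
  case 0
  then show ?case by (simp add: psi_0 unit_counit_def)
next
  case (Suc n)
  obtain ps where ps: "cop x ps" using cop_ex[OF Suc.prems] by blast
  note V = copD[OF ps]
  have "psi (Suc n) x = psum (\<lambda>a b. \<epsilon> a \<odot> psi n b + aug a \<cdot> psi n b) ps"
    unfolding psi_Suc[OF ps]
  proof (rule psum_cong)
    fix a b assume ab: "(a, b) \<in> set ps"
    have "a \<cdot> psi n b = (\<epsilon> a \<odot> \<one> + aug a) \<cdot> psi n b" by (simp add: aug_def unit_counit_def)
    also have "\<dots> = \<epsilon> a \<odot> psi n b + aug a \<cdot> psi n b"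
      using V(2,3)[OF ab] lin_map_car[OF aug_lin] by (simp add: mul_add mul_scl)
    finally show "a \<cdot> psi n b = \<epsilon> a \<odot> psi n b + aug a \<cdot> psi n b" .
  qed
  also have "\<dots> = psum (\<lambda>a b. \<epsilon> a \<odot> psi n b) ps + psum (\<lambda>a b. aug a \<cdot> psi n b) ps" by (rule psum_add)
  also have "psum (\<lambda>a b. \<epsilon> a \<odot> psi n b) ps = psi n (psum (\<lambda>a b. \<epsilon> a \<odot> b) ps)"
    using V by (subst lin_map_psum[OF vsp psi_lin]) (auto simp: lin_map_scl[OF psi_lin] intro!: psum_cong)
  also have "\<dots> = psi n x" using cop_cu[OF ps] by simp
  also have "psum (\<lambda>a b. aug a \<cdot> psi n b) ps
      = psum (\<lambda>a b. \<Sum>k\<le>n. of_nat (n choose k) \<odot> (aug a \<cdot> apow k b)) ps"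
    using V lin_map_car[OF aug_lin] by (intro psum_cong) (simp add: Suc.IH mul_sum_right mul_scl)
  also have "\<dots> = (\<Sum>k\<le>n. of_nat (n choose k) \<odot> apow (Suc k) x)"
    unfolding psum_sum apow_Suc[OF ps] scl_psum ..
  also have "psi n x + (\<Sum>k\<le>n. of_nat (n choose k) \<odot> apow (Suc k) x)
      = (\<Sum>k\<le>Suc n. of_nat (Suc n choose k) \<odot> apow k x)"
  proof -
    have "psi n x = (\<Sum>k\<le>Suc n. of_nat (n choose k) \<odot> apow k x)"
      using Suc.IH[OF Suc.prems] by (simp add: binomial_eq_0)
    also have "\<dots> = apow 0 x + (\<Sum>k\<le>n. of_nat (n choose Suc k) \<odot> apow (Suc k) x)"
      by (subst sum.atMost_Suc_shift) simp
    finally have 1: "psi n x = apow 0 x + (\<Sum>k\<le>n. of_nat (n choose Suc k) \<odot> apow (Suc k) x)" .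
    have "(\<Sum>k\<le>Suc n. of_nat (Suc n choose k) \<odot> apow k x) = apow 0 x
        + (\<Sum>k\<le>n. of_nat (Suc n choose Suc k) \<odot> apow (Suc k) x)"
      by (subst sum.atMost_Suc_shift) simp
    then show ?thesis unfolding 1 by (simp add: vs.scale_left_distrib sum.distrib algebra_simps)
  qed
  finally show ?case .
qed

lemma adams_D: "x \<in> D m \<Longrightarrow> adams H c x = (\<Sum>k\<le>m. (c gchoose k) \<odot> apow k x)"
proof -
  assume x: "x \<in> D m"
  have "(\<lambda>y. y - unit_counit H y) = aug" by (simp add: aug_def fun_eq_iff)
  then have "adams H c x = Sum_any (\<lambda>k. (c gchoose k) \<odot> apow k x)" by (simp add: adams_def)
  also have "\<dots> = (\<Sum>k\<le>m. (c gchoose k) \<odot> apow k x)"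
    using apow_D[OF x] by (intro Sum_any.expand_superset) (auto simp: not_le[symmetric])
  finally show ?thesis .
qed

lemma poly_eq_on_nat:
  fixes p q :: "'k poly"
  assumes "\<And>n::nat. poly p (of_nat n) = poly q (of_nat n)" shows "p = q"
proof (rule ccontr)
  assume "p \<noteq> q"
  then have "finite {x. poly (p - q) x = 0}" by (intro poly_roots_finite) simp
  moreover have "range (of_nat :: nat \<Rightarrow> 'k) \<subseteq> {x. poly (p - q) x = 0}" using assms by auto
  moreover have "infinite (range (of_nat :: nat \<Rightarrow> 'k))"
    by (rule range_inj_infinite) (simp add: inj_on_def)
  ultimately show False using finite_subset by blast
qed

text \<open>Both sides are polynomials in \<open>c\<close>, and they agree at all natural numbers by \<open>psi_bm_diag\<close>.\<close>

lemma adams_bm_diag: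
  assumes M: "M \<in> Mon m"
  shows "vs.representation (MB m) (adams H c (bm M)) (bm M) = c ^ size M"
proof -
  have bD: "bm M \<in> D m" using M bm_D by (auto simp: Mon_def)
  define d where "d k = vs.representation (MB m) (apow k (bm M)) (bm M)" for k
  have sp: "apow k (bm M) \<in> vs.span (MB m)" for k using apow_D[OF bD] MB_span by simp
  have rep: "vs.representation (MB m) (\<Sum>k\<in>I. e k \<odot> apow k (bm M)) (bm M) = (\<Sum>k\<in>I. e k * d k)"
    for e and I :: "nat set"
    using sp by (subst vs.representation_sum[OF MB_indep])
      (auto simp: d_def vs.representation_scale[OF MB_indep] intro: vs.span_scale)
  define p :: "'k poly" where
    "p = (\<Sum>k\<le>m. smult (d k / fact k) (\<Prod>i = 0..<k. [:- of_nat i, 1:]))"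
  have p: "poly p e = (\<Sum>k\<le>m. (e gchoose k) * d k)" for e
    unfolding p_def poly_sum by (intro sum.cong refl) (simp add: poly_prod gbinomial_prod_rev)
  have "p = monom 1 (size M)"
  proof (rule poly_eq_on_nat)
    fix n :: nat
    have "of_nat n ^ size M = (\<Sum>k\<le>n. of_nat (n choose k) * d k)"
      using psi_bm_diag[OF M, of n] psi_binomial[of "bm M" n] rep[of _ "{..n}"] bD by auto
    also have "\<dots> = (\<Sum>k\<le>n + m. of_nat (n choose k) * d k)"
      by (intro sum.mono_neutral_left) (auto simp: binomial_eq_0)
    also have "\<dots> = (\<Sum>k\<le>m. of_nat (n choose k) * d k)"
      using apow_D[OF bD] by (intro sum.mono_neutral_right) (auto simp: d_def vs.representation_zero)
    finally show "poly p (of_nat n) = poly (monom 1 (size M)) (of_nat n)"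
      by (simp add: p poly_monom binomial_gbinomial)
  qed
  then have "poly p c = c ^ size M" by (simp add: poly_monom)
  then show ?thesis using p[of c] rep[of "\<lambda>k. c gchoose k" "{..m}"] adams_D[OF bD] by simp
qed

lemma trace_adams: "trace_on (subsp H (D m)) (adams H c) = (\<Sum>M\<in>Mon m. c ^ size M)"
proof -
  have lin: "lin_map (subsp H (D m)) (subsp H (D m)) (adams H c)"
    unfolding lin_map_def
  proof (intro conjI ballI allI)
    fix x y e assume "x \<in> car (subsp H (D m))" and "y \<in> car (subsp H (D m))"
    then have x: "x \<in> D m" "x \<in> V" and y: "y \<in> D m" "y \<in> V" by auto
    show "adams H c x \<in> car (subsp H (D m))" using x apow_D[OF x(1)] by (auto simp: adams_D)
    show "adams H c (x + y) = adams H c x + adams H c y"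
      using x y D_add[OF x(1) y(1)]
      by (simp add: adams_D lin_map_add[OF apow_lin] vs.scale_right_distrib sum.distrib)
  next
    fix x e assume "x \<in> car (subsp H (D m))"
    then have x: "x \<in> D m" "x \<in> V" by auto
    show "adams H c (scl (subsp H (D m)) e x) = scl (subsp H (D m)) e (adams H c x)"
      using x
      by (simp add: adams_D[OF x(1)] adams_D[OF D_scl[OF x(1)]] lin_map_scl[OF apow_lin] vs.scale_sum_right vs.scale_left_commute mult.commute)
  qed
  have "trace_on (subsp H (D m)) (adams H c)
      = (\<Sum>b\<in>MB m. vs.representation (MB m) (adams H c b) b)"
    using trace_on_basis[of "subsp H (D m)" "MB m", OF _ MB_finite _ _ lin] MB_indep MB_span
      vs.vector_space_axioms by simp
  also have "\<dots> = (\<Sum>M\<in>Mon m. vs.representation (MB m) (adams H c (bm M)) (bm M))"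
    by (subst sum.reindex[OF bm_inj]) simp
  also have "\<dots> = (\<Sum>M\<in>Mon m. c ^ size M)" using adams_bm_diag by simp
  finally show ?thesis .
qed

end

section \<open>The associated graded algebra\<close>

lemma lin_map_span_eq:
  assumes v: "vector_space s" and f: "lin_map V U f" and g: "lin_map V U g"
    and V: "scl V = s" "car V = module.span s S" and eq: "\<And>x. x \<in> S \<Longrightarrow> f x = g x"
    and x: "x \<in> car V"
  shows "f x = g x"
proof -
  interpret vector_space s by fact
  have "is_vspace V" using V v by (simp add: is_vspace_def)
  note f0 = lin_map_0[OF this f] and g0 = lin_map_0[OF this g]
  have "x \<in> span S" using x V by simp
  then have "x \<in> span S \<and> f x = g x"
  proof (induction rule: span_induct_alt)
    case base
    show ?case by (simp add: f0 g0 span_zero)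
  next
    case (step c a y)
    then have "a \<in> span S" "y \<in> span S" by (auto intro: span_base)
    then have a: "a \<in> car V" "y \<in> car V" "s c a \<in> car V" and m: "s c a + y \<in> span S"
      unfolding V(2) by (auto intro: span_scale span_add)
    have "f (s c a + y) = scl U c (f a) + f y"
      using lin_map_add[OF f a(3,2)] lin_map_scl[OF f a(1), of c] V(1) by simp
    moreover have "g (s c a + y) = scl U c (g a) + g y"
      using lin_map_add[OF g a(3,2)] lin_map_scl[OF g a(1), of c] V(1) by simp
    ultimately show ?case using step eq m by simp
  qed
  then show ?thesis ..
qed

lemma lin_map_zero: "is_vspace V \<Longrightarrow> is_vspace U \<Longrightarrow> lin_map V U (\<lambda>x. 0)"
  unfolding lin_map_def is_vspace_def
  by (auto simp: module.subspace_def vector_space_def module_def module.scale_zero_right)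

lemma lin_map_plus:
  assumes U: "is_vspace U" and f: "lin_map V U f" and g: "lin_map V U g"
  shows "lin_map V U (\<lambda>x. f x + g x)"
proof -
  interpret vector_space "scl U" using U by (simp add: is_vspace_def)
  show ?thesis using f g car_add[OF U] by (auto simp: lin_map_def scale_right_distrib)
qed

lemma lin_map_ground_sum:
  "(\<And>i. i \<in> I \<Longrightarrow> lin_map V ground (f i)) \<Longrightarrow> lin_map V ground (\<lambda>x. \<Sum>i\<in>I. c i * f i x)"
  by (induction I rule: infinite_finite_induct) (auto simp: lin_map_def algebra_simps)

lemma pure_tensor_scl_eq:
  "scl V = scl V' \<Longrightarrow> scl W = scl W' \<Longrightarrow> pure_tensor V W = pure_tensor V' W'"
  unfolding pure_tensor_def subsp_def by simp

lemma sum_fun_scale_apply: "(\<Sum>i\<in>I. fun_scale (c i) (f i)) z = (\<Sum>i\<in>I. c i * f i z)"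
  by (induction I rule: infinite_finite_induct) (auto simp: fun_scale_def)

context locally_finite_hopf_algebra
begin

declare corad_filt.simps [simp del]

abbreviation gc where "gc \<equiv> gr_class H"
abbreviation G where "G \<equiv> gr_hopf H"

lemma C_fil: "C j = fil (int j)" by (simp add: fil_def)

lemma pred_fil: "corad_filt_pred H j = fil (int j - 1)"
  by (cases j) (simp_all add: corad_filt_pred_def fil_neg C_fil)

lemma gc_add: "gc j (x + y) = gc j x + gc j y"
  and gc_scl: "gc j (c \<odot> x) = fun_scale c (gc j x)"
  by (auto simp: gr_class_def fun_eq_iff lin_map_def fun_scale_def)

lemma gc_zero: "gc j 0 = 0"
  using gc_scl[of j 0 0] by (simp add: fun_scale_def fun_eq_iff)

lemma gc_eq_0: "gc j x = 0 \<longleftrightarrow> x \<in> fil (int j - 1)"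
  using gr_class_eq_iff[of H j x 0] vs.vector_space_axioms fil_subspace by (simp add: pred_fil gc_zero)

lemma gc_diff: "gc j (x - y) = gc j x - gc j y"
  using gc_add[of j "x - y" y] by simp

lemma gc_sum: "gc j (sum h I) = (\<Sum>i\<in>I. gc j (h i))"
  by (induction I rule: infinite_finite_induct) (simp_all add: gc_zero gc_add)

interpretation fs: vector_space "fun_scale :: 'k \<Rightarrow> ('k, 'a) gr \<Rightarrow> ('k, 'a) gr"
  by (rule vector_space_fun_scale)

lemma G_sel: "scl G = fun_scale" "car G = fs.span (\<Union>j. gc j ` C j)" "hunit G = gc 0 \<one>"
    "hdeg G m = fs.span (\<Union>j. gc j ` (C j \<inter> D m))"
    "counit G = gr_lift H (\<lambda>j x. if j = 0 then \<epsilon> x else 0)"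
    "prd G u v = gr_lift H (\<lambda>i x. gr_lift H (\<lambda>j y. gc (i + j) (x \<cdot> y)) v) u"
  by (simp_all add: gr_hopf_def gr_space_def)

lemma G_vspace: "is_vspace G"
  by (simp add: is_vspace_def G_sel fs.vector_space_axioms)

lemma gc_G: "x \<in> C j \<Longrightarrow> gc j x \<in> car G"
  unfolding G_sel by (intro fs.span_base) blast

lemma gc_G_deg: "x \<in> C j \<Longrightarrow> x \<in> D m \<Longrightarrow> gc j x \<in> hdeg G m"
  unfolding G_sel by (intro fs.span_base) blast

definition glist :: "(nat \<times> 'a) list \<Rightarrow> bool" where
  "glist ps \<longleftrightarrow> (\<forall>(j, x)\<in>set ps. x \<in> C j)"

lemma glistD: "glist ps \<Longrightarrow> (j, x) \<in> set ps \<Longrightarrow> x \<in> C j"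
  by (auto simp: glist_def)

lemma glist_append [simp]: "glist (ps @ qs) \<longleftrightarrow> glist ps \<and> glist qs"
  by (auto simp: glist_def)

lemma C_scl: "x \<in> C j \<Longrightarrow> c \<odot> x \<in> C j" and C_add: "x \<in> C j \<Longrightarrow> y \<in> C j \<Longrightarrow> x + y \<in> C j"
  and C_0: "0 \<in> C j" and C_uminus: "x \<in> C j \<Longrightarrow> - x \<in> C j"
  using fil_scl fil_add fil_zero vs.subspace_neg[OF fil_subspace] by (auto simp: C_fil)

lemma fil_C: "x \<in> fil (int j - 1) \<Longrightarrow> x \<in> C j"
  using fil_mono[of "int j - 1" "int j"] by (auto simp: C_fil)

lemma C_V: "x \<in> C j \<Longrightarrow> x \<in> V" by (auto simp: C_fil)

lemma G_list: "u \<in> car G \<Longrightarrow> \<exists>ps. glist ps \<and> u = psum gc ps"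
  unfolding G_sel
proof (induction rule: fs.span_induct_alt)
  case base
  then show ?case by (intro exI[of _ "[]"]) (simp add: glist_def)
next
  case (step c u v)
  then obtain j x ps where *: "x \<in> C j" "u = gc j x" "glist ps" "v = psum gc ps" by blast
  then show ?case
    by (intro exI[of _ "(j, c \<odot> x) # ps"]) (auto simp: glist_def gc_scl C_scl)
qed

text \<open>The total of the entries with index \<open>j\<close>; the class of \<open>\<Sum> gc j x\<close> determines it modulo \<open>F\<^sub>j\<^sub>-\<^sub>1\<close>.\<close>

definition slice :: "nat \<Rightarrow> (nat \<times> 'a) list \<Rightarrow> 'a" where
  "slice j ps = psum (\<lambda>i x. if i = j then x else 0) ps"

lemma slice_C: "glist ps \<Longrightarrow> slice j ps \<in> C j"
  unfolding slice_def by (induction ps) (auto simp: glist_def C_0 C_add)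

lemma slice_zero:
  assumes "psum gc ps = 0" shows "slice j ps \<in> fil (int j - 1)"
proof -
  have app: "psum gc ps z = psum (\<lambda>i x. gc i x z) ps" for z by (induction ps) auto
  have "gc j (slice j ps) = psum (\<lambda>i x. gc j (if i = j then x else 0)) ps"
    unfolding slice_def by (induction ps) (auto simp: gc_add gc_zero)
  moreover have "psum (\<lambda>i x. gc j (if i = j then x else 0)) ps z
      = psum (\<lambda>i x. if fst z = j then gc i x z else 0) ps" for z
  proof -
    have "gc j (if i = j then x else 0) z = (if fst z = j then gc i x z else 0)" for i x
    proof (cases "i = j")
      case False
      then show ?thesis by (cases z) (simp add: gc_zero, simp add: gr_class_def)
    qed (cases z, simp add: gr_class_def)
    then show ?thesis by (induction ps) auto
  qed
  ultimately have "gc j (slice j ps) z = (if fst z = j then psum gc ps z else 0)" for z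
    by (simp add: app psum_0)
  then have "gc j (slice j ps) = 0" using assms by (simp add: fun_eq_iff)
  then show ?thesis by (simp add: gc_eq_0)
qed

text \<open>The families that induce a map on \<open>gr H\<close>; additivity already makes \<open>gr_lift\<close> well defined.\<close>

definition admissible :: "(nat \<Rightarrow> 'a \<Rightarrow> 'c::ab_group_add) \<Rightarrow> bool" where
  "admissible F \<longleftrightarrow> (\<forall>j. \<forall>x\<in>C j. \<forall>y\<in>C j. F j (x + y) = F j x + F j y) \<and>
     (\<forall>j. \<forall>x\<in>fil (int j - 1). F j x = 0)"

lemma admissible_add: "admissible F \<Longrightarrow> x \<in> C j \<Longrightarrow> y \<in> C j \<Longrightarrow> F j (x + y) = F j x + F j y"
  and admissible_low: "admissible F \<Longrightarrow> x \<in> fil (int j - 1) \<Longrightarrow> F j x = 0"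
  by (auto simp: admissible_def)

lemma admissible_psum:
  assumes F: "admissible F" and ps: "glist ps" and J: "finite J" "fst ` set ps \<subseteq> J"
  shows "psum F ps = (\<Sum>j\<in>J. F j (slice j ps))"
  using ps J(2)
proof (induction ps)
  case Nil
  then show ?case using admissible_low[OF F fil_zero] by (simp add: slice_def)
next
  case (Cons p ps)
  obtain i x where p: "p = (i, x)" by force
  have x: "x \<in> C i" and g: "glist ps" using Cons.prems by (auto simp: glist_def p)
  have "F j (slice j (p # ps)) = (if j = i then F i x else 0) + F j (slice j ps)" for j
    using admissible_add[OF F x slice_C[OF g, of i]] by (auto simp: slice_def p)
  then have "(\<Sum>j\<in>J. F j (slice j (p # ps))) = (\<Sum>j\<in>J. if j = i then F i x else 0) + (\<Sum>j\<in>J. F j (slice j ps))"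
    by (simp add: sum.distrib)
  also have "(\<Sum>j\<in>J. if j = i then F i x else 0) = F i x" using Cons.prems J(1) p by simp
  finally show ?case using Cons g p by simp
qed

lemma admissible_psum_zero:
  assumes F: "admissible F" and ps: "glist ps" and 0: "psum gc ps = 0"
  shows "psum F ps = 0"
  using admissible_psum[OF F ps, of "fst ` set ps"] admissible_low[OF F slice_zero[OF 0]] by simp

lemma gr_lift_psum:
  assumes F: "admissible F" and ps: "glist ps"
  shows "gr_lift H F (psum gc ps) = psum F ps"
  unfolding gr_lift_def
proof (rule the_equality)
  show "\<exists>qs. (\<forall>(j, x)\<in>set qs. x \<in> C j) \<and> psum gc ps = (\<Sum>(j, x)\<leftarrow>qs. gc j x) \<and>
      psum F ps = (\<Sum>(j, x)\<leftarrow>qs. F j x)"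
    using ps by (intro exI[of _ ps]) (auto simp: glist_def psum_def)
  fix v assume "\<exists>qs. (\<forall>(j, x)\<in>set qs. x \<in> C j) \<and> psum gc ps = (\<Sum>(j, x)\<leftarrow>qs. gc j x) \<and>
      v = (\<Sum>(j, x)\<leftarrow>qs. F j x)"
  then obtain qs where qs: "glist qs" "psum gc ps = psum gc qs" "v = psum F qs"
    unfolding glist_def psum_def by blast
  let ?r = "ps @ map (\<lambda>(j, x). (j, - x)) qs"
  have gr: "glist ?r" using ps qs(1) C_uminus by (auto simp: glist_def)
  have "gc j (- x) = - gc j x" for j x using gc_diff[of j 0 x] by (simp add: gc_zero)
  then have "psum (\<lambda>j x. gc j (- x)) qs = - psum gc qs" by (induction qs) auto
  then have "psum gc ?r = 0" using qs(2) by (simp add: psum_map)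
  from admissible_psum_zero[OF F gr this] have "psum F ps + psum (\<lambda>j x. F j (- x)) qs = 0"
    by (simp add: psum_map)
  moreover have "psum (\<lambda>j x. F j (- x)) qs = - psum F qs"
  proof -
    have "F j (- x) = - F j x" if "x \<in> C j" for j x
      using admissible_add[OF F that C_uminus[OF that]] admissible_low[OF F fil_zero]
      by (simp add: eq_neg_iff_add_eq_0 add.commute)
    then show ?thesis using qs(1) by (induction qs) (auto simp: glist_def)
  qed
  ultimately show "v = psum F ps" using qs(3) by simp
qed

lemma gr_lift_gc: "admissible F \<Longrightarrow> x \<in> C j \<Longrightarrow> gr_lift H F (gc j x) = F j x"
  using gr_lift_psum[of F "[(j, x)]"] by (simp add: glist_def)

lemma gr_lift_lin:
  assumes F: "admissible F" and U: "is_vspace U"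
    and FU: "\<And>j x. x \<in> C j \<Longrightarrow> F j x \<in> car U" "\<And>j x c. x \<in> C j \<Longrightarrow> F j (c \<odot> x) = scl U c (F j x)"
  shows "lin_map G U (gr_lift H F)"
  unfolding lin_map_def
proof (intro conjI ballI allI)
  fix u assume "u \<in> car G"
  then obtain ps where ps: "glist ps" "u = psum gc ps" using G_list by blast
  show "gr_lift H F u \<in> car U"
    unfolding ps(2) gr_lift_psum[OF F ps(1)] using FU(1) glistD[OF ps(1)] by (intro car_psum[OF U]) auto
  fix v assume "v \<in> car G"
  then obtain qs where qs: "glist qs" "v = psum gc qs" using G_list by blast
  show "gr_lift H F (u + v) = gr_lift H F u + gr_lift H F v"
    using gr_lift_psum[OF F, of "ps @ qs"] gr_lift_psum[OF F] ps qs by simp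
next
  fix c u assume "u \<in> car G"
  then obtain ps where ps: "glist ps" "u = psum gc ps" using G_list by blast
  interpret U: vector_space "scl U" using U by (simp add: is_vspace_def)
  let ?qs = "map (\<lambda>(j, x). (j, c \<odot> x)) ps"
  have g: "glist ?qs" using ps(1) C_scl by (auto simp: glist_def)
  have "scl G c u = psum gc ?qs"
    unfolding ps(2) psum_map gc_scl G_sel(1)
    by (induction ps) (auto simp: fun_scale_def fun_eq_iff algebra_simps)
  moreover have "psum F ?qs = scl U c (psum F ps)"
    unfolding psum_map using ps(1) FU(2) by (induction ps) (auto simp: glist_def U.scale_right_distrib)
  ultimately show "gr_lift H F (scl G c u) = scl U c (gr_lift H F u)"
    using gr_lift_psum[OF F g] gr_lift_psum[OF F ps(1)] ps(2) by simp
qed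

lemma C_mul: "x \<in> C i \<Longrightarrow> y \<in> C j \<Longrightarrow> x \<cdot> y \<in> C (i + j)"
  using fil_mul[of x "int i" y "int j"] by (simp add: C_fil)

lemma mul_right_admissible: assumes x: "x \<in> C i" shows "admissible (\<lambda>j y. gc (i + j) (x \<cdot> y))"
  unfolding admissible_def
proof (intro conjI allI ballI)
  show "gc (i + j) (x \<cdot> (y + z)) = gc (i + j) (x \<cdot> y) + gc (i + j) (x \<cdot> z)"
    if "y \<in> C j" "z \<in> C j" for j y z
    using that x by (simp add: mul_add C_V gc_add)
  show "gc (i + j) (x \<cdot> y) = 0" if y: "y \<in> fil (int j - 1)" for j y
    using fil_mul[OF x[unfolded C_fil] y] by (simp add: gc_eq_0 algebra_simps)
qed

lemma mul_right_lin: assumes x: "x \<in> C i"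
  shows "lin_map G G (gr_lift H (\<lambda>j y. gc (i + j) (x \<cdot> y)))"
  using x by (intro gr_lift_lin mul_right_admissible G_vspace) (auto simp: mul_scl C_V gc_scl G_sel(1) intro: gc_G C_mul)

lemma mul_left_admissible: assumes v: "v \<in> car G"
  shows "admissible (\<lambda>i x. gr_lift H (\<lambda>j y. gc (i + j) (x \<cdot> y)) v)"
proof -
  obtain qs where qs: "glist qs" "v = psum gc qs" using G_list[OF v] by blast
  have e: "gr_lift H (\<lambda>j y. gc (i + j) (x \<cdot> y)) v = psum (\<lambda>j y. gc (i + j) (x \<cdot> y)) qs" if "x \<in> C i" for i x
    unfolding qs(2) by (rule gr_lift_psum[OF mul_right_admissible[OF that] qs(1)])
  show ?thesis
    unfolding admissible_def
  proof (intro conjI allI ballI)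
    fix i x y assume xy: "x \<in> C i" "y \<in> C i"
    show "gr_lift H (\<lambda>j z. gc (i + j) ((x + y) \<cdot> z)) v
      = gr_lift H (\<lambda>j z. gc (i + j) (x \<cdot> z)) v + gr_lift H (\<lambda>j z. gc (i + j) (y \<cdot> z)) v"
      unfolding e[OF xy(1)] e[OF xy(2)] e[OF C_add[OF xy]] psum_add[symmetric]
      using C_V[OF xy(1)] C_V[OF xy(2)] C_V[OF glistD[OF qs(1)]]
      by (intro psum_cong) (simp add: mul_add gc_add)
  next
    fix i x assume x: "x \<in> fil (int i - 1)"
    show "gr_lift H (\<lambda>j z. gc (i + j) (x \<cdot> z)) v = 0"
      unfolding e[OF fil_C[OF x]]
    proof (rule psum_0)
      fix j z assume "(j, z) \<in> set qs"
      then have "z \<in> fil (int j)" using glistD[OF qs(1)] C_fil by blast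
      from fil_mul[OF x this] show "gc (i + j) (x \<cdot> z) = 0" by (simp add: gc_eq_0 algebra_simps)
    qed
  qed
qed

lemma G_prd_gc: "x \<in> C i \<Longrightarrow> y \<in> C j \<Longrightarrow> prd G (gc i x) (gc j y) = gc (i + j) (x \<cdot> y)"
  unfolding G_sel(6)
  by (simp add: gr_lift_gc[OF mul_left_admissible[OF gc_G]] gr_lift_gc[OF mul_right_admissible])

lemma G_prd_lin1: assumes v: "v \<in> car G" shows "lin_map G G (\<lambda>u. prd G u v)"
  unfolding G_sel(6)
proof (rule gr_lift_lin[OF mul_left_admissible[OF v] G_vspace])
  fix i x assume x: "x \<in> C i"
  show "gr_lift H (\<lambda>j y. gc (i + j) (x \<cdot> y)) v \<in> car G" using lin_map_car[OF mul_right_lin[OF x] v] .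
  fix c
  obtain qs where qs: "glist qs" "v = psum gc qs" using G_list[OF v] by blast
  have "gr_lift H (\<lambda>j y. gc (i + j) ((c \<odot> x) \<cdot> y)) v = psum (\<lambda>j y. fun_scale c (gc (i + j) (x \<cdot> y))) qs"
    unfolding qs(2) gr_lift_psum[OF mul_right_admissible[OF C_scl[OF x]] qs(1)]
    using C_V[OF x] C_V[OF glistD[OF qs(1)]] by (intro psum_cong) (simp add: mul_scl gc_scl)
  also have "\<dots> = fun_scale c (psum (\<lambda>j y. gc (i + j) (x \<cdot> y)) qs)"
    by (induction qs) (auto simp: fun_scale_def fun_eq_iff algebra_simps)
  finally show "gr_lift H (\<lambda>j y. gc (i + j) ((c \<odot> x) \<cdot> y)) v
      = scl G c (gr_lift H (\<lambda>j y. gc (i + j) (x \<cdot> y)) v)"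
    unfolding G_sel(1) using gr_lift_psum[OF mul_right_admissible[OF x] qs(1)] qs(2) by simp
qed

lemma G_prd_lin2: assumes u: "u \<in> car G" shows "lin_map G G (prd G u)"
proof -
  obtain ps where ps: "glist ps" "u = psum gc ps" using G_list[OF u] by blast
  have e: "prd G u v = psum (\<lambda>i x. gr_lift H (\<lambda>j y. gc (i + j) (x \<cdot> y)) v) ps" if "v \<in> car G" for v
    unfolding G_sel(6) ps(2) by (rule gr_lift_psum[OF mul_left_admissible[OF that] ps(1)])
  have "lin_map G G (\<lambda>v. psum (\<lambda>i x. gr_lift H (\<lambda>j y. gc (i + j) (x \<cdot> y)) v) ps)"
    using ps(1)
  proof (induction ps)
    case Nil
    show ?case using lin_map_zero[OF G_vspace G_vspace] by (simp only: psum_simps)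
  next
    case (Cons p ps)
    then have g: "glist ps" "snd p \<in> C (fst p)" by (auto simp: glist_def split_beta)
    show ?case
      using lin_map_plus[OF G_vspace mul_right_lin[OF g(2)] Cons.IH[OF g(1)]] by (simp only: psum_simps)
  qed
  then show ?thesis by (auto simp: lin_map_def e car_add[OF G_vspace] car_scl[OF G_vspace])
qed

lemma counit_admissible: "admissible (\<lambda>j x. if j = 0 then \<epsilon> x else 0)"
  by (auto simp: admissible_def fil_neg lin_map_add[OF cu_lform] C_V)

lemma G_counit_gc: "x \<in> C j \<Longrightarrow> counit G (gc j x) = (if j = 0 then \<epsilon> x else 0)"
  unfolding G_sel using gr_lift_gc[OF counit_admissible, of x j] by simp

lemma G_counit_lin: "lin_map G ground (counit G)"
  unfolding G_sel
  by (rule gr_lift_lin[OF counit_admissible is_vspace_ground]) (auto simp: lin_map_scl[OF cu_lform] C_V)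

lemma G_span_hom: "car G = fs.span (\<Union>j. gc j ` (C j \<inter> (\<Union>m. D m)))" (is "_ = fs.span ?S")
proof
  have "gc j x \<in> fs.span ?S" if x: "x \<in> C j" for j x
  proof (rule fil_hom_induct[of x "int j"])
    show "x \<in> fil (int j)" using x C_fil by simp
    show "gc j y \<in> fs.span ?S" if "y \<in> fil (int j)" "y \<in> D m" for m y
      using that C_fil by (intro fs.span_base) blast
    show "gc j 0 \<in> fs.span ?S" unfolding gc_zero by (rule fs.span_zero)
    show "gc j (y + z) \<in> fs.span ?S" if "gc j y \<in> fs.span ?S" "gc j z \<in> fs.span ?S" for y z
      unfolding gc_add using that by (rule fs.span_add)
  qed
  then show "car G \<subseteq> fs.span ?S" unfolding G_sel by (intro fs.span_minimal) auto
  show "fs.span ?S \<subseteq> car G" unfolding G_sel by (intro fs.span_mono) blast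
qed

lemma G_lin_eqI:
  assumes "lin_map G U f" "lin_map G U g"
    "\<And>j x m. x \<in> C j \<Longrightarrow> x \<in> D m \<Longrightarrow> f (gc j x) = g (gc j x)" "u \<in> car G"
  shows "f u = g u"
  using lin_map_span_eq[OF fs.vector_space_axioms assms(1,2) G_sel(1) G_span_hom _ assms(4)] assms(3) by auto

section \<open>The graded dual and its primitive elements\<close>

abbreviation DS where "DS \<equiv> dual_space G"
abbreviation A where "A \<equiv> graded_dual G"
abbreviation gform where "gform \<equiv> lin_map G ground"

interpretation fd: vector_space "fun_scale :: 'k \<Rightarrow> (('k, 'a) gr \<Rightarrow> 'k) \<Rightarrow> _"
  by (rule vector_space_fun_scale)

lemma DS_sel: "scl DS = fun_scale" "car DS = fd.span (\<Union>m. dual_deg G m)"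
  by (simp_all add: dual_space_def)

lemma DS_vspace: "is_vspace DS"
  by (simp add: is_vspace_def DS_sel fd.vector_space_axioms)

lemma dual_deg_DS: "f \<in> dual_deg G m \<Longrightarrow> f \<in> car DS"
  unfolding DS_sel by (intro fd.span_base) blast

lemma dual_degD: assumes "f \<in> dual_deg G m"
  shows "gform f" "u \<notin> car G \<Longrightarrow> f u = 0" "l \<noteq> m \<Longrightarrow> u \<in> hdeg G l \<Longrightarrow> f u = 0"
  using assms by (auto simp: dual_deg_def)

lemma dual_deg_subspace: "fd.subspace (dual_deg G m)"
  by (auto simp: fd.subspace_def dual_deg_def lin_map_def fun_scale_def algebra_simps)

lemma DS_form: "f \<in> car DS \<Longrightarrow> gform f \<and> (\<forall>u. u \<notin> car G \<longrightarrow> f u = 0)"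
proof -
  have "car DS \<subseteq> {f. gform f \<and> (\<forall>u. u \<notin> car G \<longrightarrow> f u = 0)}"
    unfolding DS_sel
  proof (rule fd.span_minimal)
    show "(\<Union>m. dual_deg G m) \<subseteq> {f. gform f \<and> (\<forall>u. u \<notin> car G \<longrightarrow> f u = 0)}"
      by (auto simp: dual_deg_def)
    show "fd.subspace {f. gform f \<and> (\<forall>u. u \<notin> car G \<longrightarrow> f u = 0)}"
      by (auto simp: fd.subspace_def lin_map_def fun_scale_def algebra_simps)
  qed
  then show "f \<in> car DS \<Longrightarrow> gform f \<and> (\<forall>u. u \<notin> car G \<longrightarrow> f u = 0)" by blast
qed

lemma pairing_bilin: "bilin_map DS DS ground (\<lambda>g h. g a * h b)"
  by (auto simp: bilin_map_def lin_map_def DS_sel fun_scale_def algebra_simps)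

abbreviation pairing where "pairing a b \<equiv> tensor_lift DS DS (\<lambda>g h. g a * h b)"

lemma pairing_lin: "lin_map (tensor_space DS DS) ground (pairing a b)"
  by (rule tensor_lift_lin[OF DS_vspace DS_vspace is_vspace_ground pairing_bilin])

lemma pairing_pure: "g \<in> car DS \<Longrightarrow> h \<in> car DS \<Longrightarrow> pairing a b (pure_tensor DS DS g h) = g a * h b"
  using tensor_lift_psum[OF DS_vspace DS_vspace is_vspace_ground pairing_bilin, of "[(g, h)]" a b] by simp

text \<open>Evaluations at points of \<open>gr H\<close> separate the points of the graded dual.\<close>

lemma pairing_unique:
  assumes "s \<in> car (tensor_space DS DS)" "t \<in> car (tensor_space DS DS)"
    "\<And>a b. a \<in> car G \<Longrightarrow> b \<in> car G \<Longrightarrow> pairing a b s = pairing a b t"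
  shows "s = t"
proof -
  have "s - t \<in> car (tensor_space DS DS)" using car_diff[OF is_vspace_tensor assms(1,2)] .
  then obtain ps where ps: "set ps \<subseteq> car DS \<times> car DS" "s - t = psum (pure_tensor DS DS) ps"
    using tensor_space_list[OF DS_vspace] by blast
  have "psum (pure_tensor DS DS) ps = 0"
  proof (rule psum_pure_eq_0[OF DS_vspace DS_vspace ps(1), where \<Phi> = "(\<lambda>a (g :: ('k, 'a) gr \<Rightarrow> 'k). g a) ` car G"
        and \<Psi> = "(\<lambda>a (g :: ('k, 'a) gr \<Rightarrow> 'k). g a) ` car G"])
    show "lin_map DS ground \<phi>" if "\<phi> \<in> (\<lambda>a g. g a) ` car G" for \<phi>
      using that by (auto simp: lin_map_def DS_sel fun_scale_def)
    show "lin_map DS ground \<phi>" if "\<phi> \<in> (\<lambda>a g. g a) ` car G" for \<phi>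
      using that by (auto simp: lin_map_def DS_sel fun_scale_def)
    show "g = 0" if "g \<in> car DS" "\<And>\<phi>. \<phi> \<in> (\<lambda>a g. g a) ` car G \<Longrightarrow> \<phi> g = 0" for g
      using DS_form[OF that(1)] that(2) by (auto simp: fun_eq_iff)
    show "g = 0" if "g \<in> car DS" "\<And>\<phi>. \<phi> \<in> (\<lambda>a g. g a) ` car G \<Longrightarrow> \<phi> g = 0" for g
      using DS_form[OF that(1)] that(2) by (auto simp: fun_eq_iff)
    fix \<phi> \<psi> assume "\<phi> \<in> (\<lambda>a (g :: ('k, 'a) gr \<Rightarrow> 'k). g a) ` car G" "\<psi> \<in> (\<lambda>a (g :: ('k, 'a) gr \<Rightarrow> 'k). g a) ` car G"
    then obtain a b where ab: "a \<in> car G" "b \<in> car G" "\<phi> = (\<lambda>g. g a)" "\<psi> = (\<lambda>g. g b)" by blast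
    have "psum (\<lambda>g h. \<phi> g * \<psi> h) ps = pairing a b (s - t)"
      unfolding ps(2) ab using tensor_lift_psum[OF DS_vspace DS_vspace is_vspace_ground pairing_bilin ps(1)] by simp
    also have "\<dots> = 0" using lin_map_diff[OF is_vspace_tensor pairing_lin assms(1,2)] assms(3)[OF ab(1,2)] by simp
    finally show "psum (\<lambda>g h. \<phi> g * \<psi> h) ps = 0" .
  qed
  then show ?thesis using ps(2) by simp
qed

text \<open>Elements of the dual are functions that vanish outside the carrier.\<close>

definition gr_form :: "(nat \<Rightarrow> 'a \<Rightarrow> 'k) \<Rightarrow> ('k, 'a) gr \<Rightarrow> 'k" where
  "gr_form F u = (if u \<in> car G then gr_lift H F u else 0)"

text \<open>A form on \<open>F\<^sub>i\<close> that vanishes on \<open>F\<^sub>i\<^sub>-\<^sub>1\<close>, placed in the summand with index \<open>i\<close> of \<open>gr H\<close>.\<close>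

lemma slot_form:
  assumes f: "kills f (int i - 1)"
  shows "admissible (\<lambda>j x. if j = i then f x else 0)"
    "gform (gr_form (\<lambda>j x. if j = i then f x else 0))"
    "x \<in> C j \<Longrightarrow> gr_form (\<lambda>j x. if j = i then f x else 0) (gc j x) = (if j = i then f x else 0)"
proof -
  let ?F = "\<lambda>j x. if j = i then f x else 0"
  note fl = kills_lform[OF f]
  show a: "admissible ?F"
    using killsD[OF f] by (auto simp: admissible_def lin_map_add[OF fl] C_V)
  have "gform (gr_lift H ?F)"
    by (rule gr_lift_lin[OF a is_vspace_ground]) (auto simp: lin_map_scl[OF fl] C_V)
  then show "gform (gr_form ?F)" using car_add[OF G_vspace] car_scl[OF G_vspace] by (simp add: lin_map_def gr_form_def)
  show "x \<in> C j \<Longrightarrow> gr_form ?F (gc j x) = ?F j x"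
    using gr_lift_gc[OF a] gc_G by (simp add: gr_form_def)
qed

lemma slot_form_deg:
  assumes f: "kills f (int i - 1)" and z: "\<And>l x. l \<noteq> m \<Longrightarrow> x \<in> D l \<Longrightarrow> f x = 0"
  shows "gr_form (\<lambda>j x. if j = i then f x else 0) \<in> dual_deg G m"
proof -
  let ?g = "gr_form (\<lambda>j x. if j = i then f x else 0)"
  have "?g u = 0" if "l \<noteq> m" "u \<in> hdeg G l" for l u
  proof -
    have sub: "hdeg G l \<subseteq> car G" unfolding G_sel by (intro fs.span_mono) blast
    have "lin_map (subsp G (hdeg G l)) ground ?g" using lin_map_subsp[OF slot_form(2)[OF f] sub] .
    moreover have "lin_map (subsp G (hdeg G l)) ground (\<lambda>_. 0)" by (simp add: lin_map_def)
    moreover have "?g x = 0" if "x \<in> (\<Union>j. gc j ` (C j \<inter> D l))" for x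
      using that slot_form(3)[OF f] z[OF \<open>l \<noteq> m\<close>] by auto
    ultimately show ?thesis
      using lin_map_span_eq[OF fs.vector_space_axioms, of "subsp G (hdeg G l)" ground ?g "\<lambda>_. 0"
          "\<Union>j. gc j ` (C j \<inter> D l)" u] that by (simp add: G_sel)
  qed
  then show ?thesis using slot_form(2)[OF f] by (auto simp: dual_deg_def) (simp_all add: gr_form_def)
qed

text \<open>The basis of the graded dual that is dual to the classes of the adapted bases.\<close>

definition gr_coord :: "nat \<Rightarrow> 'a \<Rightarrow> ('k, 'a) gr \<Rightarrow> 'k" where
  "gr_coord p b = gr_form (\<lambda>j x. if j = ht b then coord p b x else 0)"

lemma gr_coord_dual: "b \<in> Bas p \<Longrightarrow> gr_coord p b \<in> dual_deg G p"
  unfolding gr_coord_def using coord_D by (intro slot_form_deg coord_kills) auto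

lemma gr_coord_gc: "b \<in> Bas p \<Longrightarrow> x \<in> C j \<Longrightarrow> gr_coord p b (gc j x) = (if j = ht b then coord p b x else 0)"
  unfolding gr_coord_def by (rule slot_form(3)[OF coord_kills])

lemma Bas_C: "b \<in> Bas p \<Longrightarrow> b \<in> C (ht b)"
  using ht_fil[OF Bas_D, of b p "ht b"] C_fil by simp

lemma gr_coord_expand:
  assumes x: "x \<in> C j" "x \<in> D p"
  shows "(\<Sum>b\<in>Bas p. fun_scale (gr_coord p b (gc j x)) (gc (ht b) b)) = gc j x"
proof -
  let ?B = "{b \<in> Bas p. ht b = j}"
  have "(\<Sum>b\<in>Bas p. fun_scale (gr_coord p b (gc j x)) (gc (ht b) b)) = (\<Sum>b\<in>?B. gc j (coord p b x \<odot> b))"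
    using x by (intro sum.mono_neutral_cong_right) (auto simp: gr_coord_gc gc_scl fs.scale_zero_left)
  also have "\<dots> = gc j (\<Sum>b\<in>?B. coord p b x \<odot> b)" by (simp add: gc_sum)
  also have "\<dots> = gc j x"
  proof -
    have x_eq: "x = (\<Sum>b\<in>?B. coord p b x \<odot> b) + (\<Sum>b\<in>Bas p - ?B. coord p b x \<odot> b)"
      using coord_sum[OF x(2)] sum.subset_diff[of ?B "Bas p" "\<lambda>b. coord p b x \<odot> b"] by (simp add: add.commute)
    have "(\<Sum>b\<in>Bas p - ?B. coord p b x \<odot> b) \<in> fil (int j - 1)"
    proof (rule fil_sum)
      fix b assume b: "b \<in> Bas p - ?B"
      show "coord p b x \<odot> b \<in> fil (int j - 1)"
      proof (cases "ht b > j")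
        case True
        then have "x \<in> fil (int (ht b) - 1)" using x(1) fil_mono[of "int j" "int (ht b) - 1"] C_fil by auto
        then have "coord p b x = 0" using killsD[OF coord_kills] b by blast
        then show ?thesis by simp
      next
        case False
        then have "int (ht b) \<le> int j - 1" using b by auto
        then have "b \<in> fil (int j - 1)" using Bas_C[of b p] b fil_mono C_fil by blast
        then show ?thesis by (rule fil_scl)
      qed
    qed
    then have "gc j (\<Sum>b\<in>Bas p - ?B. coord p b x \<odot> b) = 0" by (simp only: gc_eq_0)
    then show ?thesis
      using gc_add[of j "\<Sum>b\<in>?B. coord p b x \<odot> b" "\<Sum>b\<in>Bas p - ?B. coord p b x \<odot> b"]
      unfolding x_eq[symmetric] by simp
  qed
  finally show ?thesis .
qed

text \<open>By finite-dimensionality of the \<open>H\<^sub>p\<close>, the form \<open>(a, b) \<mapsto> f (a b)\<close> is a finite sum of products of forms: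
  take its matrix entries with respect to the dual bases as coefficients.\<close>

lemma coproduct_exists:
  assumes f: "f \<in> dual_deg G m"
  shows "\<exists>t. t \<in> car (tensor_space DS DS) \<and> (\<forall>a\<in>car G. \<forall>b\<in>car G. pairing a b t = f (prd G a b))"
proof -
  note fl = dual_degD(1)[OF f]
  let ?c = "\<lambda>b b'. f (prd G (gc (ht b) b) (gc (ht b') b'))"
  define S where "S = (SIGMA p:{..m}. Bas p \<times> Bas (m - p))"
  have finS: "finite S" by (simp add: S_def)
  let ?t = "\<lambda>(p, b, b'). fun_scale (?c b b') (pure_tensor DS DS (gr_coord p b) (gr_coord (m - p) b'))"
  have b_DS: "gr_coord p b \<in> car DS" if "b \<in> Bas p" for p b using dual_deg_DS[OF gr_coord_dual[OF that]] .
  have tT: "?t s \<in> car (tensor_space DS DS)" if "s \<in> S" for s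
  proof -
    obtain p b b' where s: "s = (p, b, b')" "b \<in> Bas p" "b' \<in> Bas (m - p)" using \<open>s \<in> S\<close> by (auto simp: S_def)
    have "pure_tensor DS DS (gr_coord p b) (gr_coord (m - p) b') \<in> car (tensor_space DS DS)"
      by (rule pure_tensor_in[OF b_DS[OF s(2)] b_DS[OF s(3)]])
    from car_scl[OF is_vspace_tensor this, of "?c b b'"] show ?thesis by (simp add: s(1))
  qed
  define t where "t = sum ?t S"
  have t: "t \<in> car (tensor_space DS DS)" unfolding t_def using tT by (rule car_sum[OF is_vspace_tensor])
  let ?E = "\<lambda>a b. \<Sum>(p, e, e')\<in>S. ?c e e' * (gr_coord p e a * gr_coord (m - p) e' b)"
  have E: "pairing a b t = ?E a b" for a b
  proof -
    have "pairing a b t = (\<Sum>s\<in>S. pairing a b (?t s))"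
      unfolding t_def using tT by (rule lin_map_sum[OF is_vspace_tensor pairing_lin])
    also have "\<dots> = ?E a b"
    proof (rule sum.cong[OF refl])
      fix s assume "s \<in> S"
      then obtain p e e' where s: "s = (p, e, e')" "e \<in> Bas p" "e' \<in> Bas (m - p)" by (auto simp: S_def)
      have "pure_tensor DS DS (gr_coord p e) (gr_coord (m - p) e') \<in> car (tensor_space DS DS)"
        by (rule pure_tensor_in[OF b_DS[OF s(2)] b_DS[OF s(3)]])
      from lin_map_scl[OF pairing_lin this, of a b "?c e e'"] pairing_pure[OF b_DS[OF s(2)] b_DS[OF s(3)], of a b]
      show "pairing a b (?t s) = (case s of (p, e, e') \<Rightarrow> ?c e e' * (gr_coord p e a * gr_coord (m - p) e' b))"
        by (simp add: s(1))
    qed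
    finally show ?thesis .
  qed
  have bf: "gform (gr_coord p b)" if "b \<in> Bas p" for p b using dual_degD(1)[OF gr_coord_dual[OF that]] .
  have lin1: "gform (\<lambda>a. ?E a b)" for b
  proof -
    have "?E a b = (\<Sum>s\<in>S. (case s of (p, e, e') \<Rightarrow> ?c e e' * gr_coord (m - p) e' b) * (case s of (p, e, e') \<Rightarrow> gr_coord p e a))" for a
      by (intro sum.cong refl) (auto simp: algebra_simps)
    moreover have "gform (\<lambda>a. \<Sum>s\<in>S. (case s of (p, e, e') \<Rightarrow> ?c e e' * gr_coord (m - p) e' b) * (case s of (p, e, e') \<Rightarrow> gr_coord p e a))"
      by (rule lin_map_ground_sum) (use bf in \<open>auto simp: S_def\<close>)
    ultimately show ?thesis by simp
  qed
  have lin2: "gform (?E a)" for a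
  proof -
    have "?E a b = (\<Sum>s\<in>S. (case s of (p, e, e') \<Rightarrow> ?c e e' * gr_coord p e a) * (case s of (p, e, e') \<Rightarrow> gr_coord (m - p) e' b))" for b
      by (intro sum.cong refl) (auto simp: algebra_simps)
    moreover have "gform (\<lambda>b. \<Sum>s\<in>S. (case s of (p, e, e') \<Rightarrow> ?c e e' * gr_coord p e a) * (case s of (p, e, e') \<Rightarrow> gr_coord (m - p) e' b))"
      by (rule lin_map_ground_sum) (use bf in \<open>auto simp: S_def\<close>)
    ultimately show ?thesis by simp
  qed
  have base: "?E (gc j x) (gc k y) = f (prd G (gc j x) (gc k y))"
    if x: "x \<in> C j" "x \<in> D p" and y: "y \<in> C k" "y \<in> D q" for j x p k y q
  proof -
    let ?u = "gc j x" and ?v = "gc k y"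
    have uG: "?u \<in> car G" "?v \<in> car G" using gc_G x y by auto
    have z: "gr_coord r e ?u = 0" if "e \<in> Bas r" "r \<noteq> p" for r e
      using dual_degD(3)[OF gr_coord_dual[OF that(1)] _ gc_G_deg[OF x]] that(2) by auto
    have z': "gr_coord r e ?v = 0" if "e \<in> Bas r" "r \<noteq> q" for r e
      using dual_degD(3)[OF gr_coord_dual[OF that(1)] _ gc_G_deg[OF y]] that(2) by auto
    show ?thesis
    proof (cases "p + q = m")
      case False
      have "prd G ?u ?v \<in> hdeg G (p + q)"
        unfolding G_prd_gc[OF x(1) y(1)] by (rule gc_G_deg[OF C_mul[OF x(1) y(1)] mul_D[OF x(2) y(2)]])
      then have "f (prd G ?u ?v) = 0" using dual_degD(3)[OF f False] by blast
      moreover have "?E ?u ?v = 0"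
      proof (rule sum.neutral, clarify)
        fix r e e' assume "(r, e, e') \<in> S"
        then have r: "r \<le> m" "e \<in> Bas r" "e' \<in> Bas (m - r)" by (auto simp: S_def)
        have "r \<noteq> p \<or> m - r \<noteq> q" using r(1) False by auto
        then show "?c e e' * (gr_coord r e ?u * gr_coord (m - r) e' ?v) = 0" using z[OF r(2)] z'[OF r(3)] by auto
      qed
      ultimately show ?thesis by simp
    next
      case True
      then have q: "q = m - p" "p \<le> m" by auto
      have BG: "gc (ht e) e \<in> car G" if "e \<in> Bas r" for e r using gc_G[OF Bas_C[OF that]] .
      have "?E ?u ?v = (\<Sum>r\<le>m. \<Sum>e\<in>Bas r. \<Sum>e'\<in>Bas (m - r). ?c e e' * (gr_coord r e ?u * gr_coord (m - r) e' ?v))"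
        unfolding S_def by (simp add: sum.Sigma sum.cartesian_product)
      also have "\<dots> = (\<Sum>r\<in>{p}. \<Sum>e\<in>Bas r. \<Sum>e'\<in>Bas (m - r). ?c e e' * (gr_coord r e ?u * gr_coord (m - r) e' ?v))"
        using q z by (intro sum.mono_neutral_right) (auto intro!: sum.neutral)
      finally have 1: "?E ?u ?v = (\<Sum>e\<in>Bas p. \<Sum>e'\<in>Bas q. ?c e e' * (gr_coord p e ?u * gr_coord q e' ?v))"
        using q by simp
      have sG: "fun_scale c (gc (ht e) e) \<in> car G" if "e \<in> Bas r" for c e r
        using car_scl[OF G_vspace BG[OF that], of c] by (simp add: G_sel(1))
      have PG: "prd G a b \<in> car G" if "a \<in> car G" "b \<in> car G" for a b
        using lin_map_car[OF G_prd_lin2[OF that(1)] that(2)] .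
      have "f (prd G ?u ?v) = f (prd G (\<Sum>e\<in>Bas p. fun_scale (gr_coord p e ?u) (gc (ht e) e)) ?v)"
        unfolding gr_coord_expand[OF x] ..
      also have "\<dots> = (\<Sum>e\<in>Bas p. f (prd G (fun_scale (gr_coord p e ?u) (gc (ht e) e)) ?v))"
        using lin_map_sum[OF G_vspace lin_map_comp[OF G_prd_lin1[OF uG(2)] fl], of "Bas p"
          "\<lambda>e. fun_scale (gr_coord p e ?u) (gc (ht e) e)"] sG by simp
      also have "\<dots> = (\<Sum>e\<in>Bas p. gr_coord p e ?u * f (prd G (gc (ht e) e) ?v))"
        using lin_map_scl[OF lin_map_comp[OF G_prd_lin1[OF uG(2)] fl] BG] by (simp add: G_sel(1))
      also have "\<dots> = (\<Sum>e\<in>Bas p. gr_coord p e ?u * (\<Sum>e'\<in>Bas q. gr_coord q e' ?v * ?c e e'))"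
      proof (rule sum.cong[OF refl])
        fix e assume e: "e \<in> Bas p"
        note L = lin_map_comp[OF G_prd_lin2[OF BG[OF e]] fl]
        have "f (prd G (gc (ht e) e) ?v) = f (prd G (gc (ht e) e) (\<Sum>e'\<in>Bas q. fun_scale (gr_coord q e' ?v) (gc (ht e') e')))"
          unfolding gr_coord_expand[OF y] ..
        also have "\<dots> = (\<Sum>e'\<in>Bas q. f (prd G (gc (ht e) e) (fun_scale (gr_coord q e' ?v) (gc (ht e') e'))))"
          using lin_map_sum[OF G_vspace L, of "Bas q" "\<lambda>e'. fun_scale (gr_coord q e' ?v) (gc (ht e') e')"] sG by simp
        also have "\<dots> = (\<Sum>e'\<in>Bas q. gr_coord q e' ?v * ?c e e')"
          using lin_map_scl[OF L BG] by (simp add: G_sel(1))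
        finally show "gr_coord p e ?u * f (prd G (gc (ht e) e) ?v)
            = gr_coord p e ?u * (\<Sum>e'\<in>Bas q. gr_coord q e' ?v * ?c e e')" by simp
      qed
      finally show ?thesis unfolding 1 by (simp add: sum_distrib_left algebra_simps)
    qed
  qed
  have "pairing a b t = f (prd G a b)" if a: "a \<in> car G" and b: "b \<in> car G" for a b
  proof -
    have s1: "?E a (gc k y) = f (prd G a (gc k y))" if y: "y \<in> C k" "y \<in> D q" for k y q
      by (rule G_lin_eqI[OF lin1 lin_map_comp[OF G_prd_lin1[OF gc_G[OF y(1)]] fl] _ a]) (rule base[OF _ _ y])
    have "?E a b = f (prd G a b)"
      by (rule G_lin_eqI[OF lin2 lin_map_comp[OF G_prd_lin2[OF a] fl] _ b]) (rule s1)
    then show ?thesis unfolding E .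
  qed
  then show ?thesis using t by blast
qed

lemma A_sel: "scl A = fun_scale" "car A = car DS" "hunit A = (\<lambda>x. if x \<in> car G then counit G x else 0)"
    "hdeg A = dual_deg G"
  by (simp_all add: graded_dual_def)

lemma A_coprd:
  assumes f: "f \<in> dual_deg G m"
  shows "coprd A f = t \<longleftrightarrow> t \<in> car (tensor_space DS DS) \<and>
    (\<forall>a\<in>car G. \<forall>b\<in>car G. pairing a b t = f (prd G a b))"
proof -
  let ?P = "\<lambda>t. t \<in> car (tensor_space DS DS) \<and> (\<forall>a\<in>car G. \<forall>b\<in>car G. pairing a b t = f (prd G a b))"
  have c: "coprd A f = (THE t. ?P t)" by (simp add: graded_dual_def)
  have "\<exists>!t. ?P t"
  proof (rule ex_ex1I[OF coproduct_exists[OF f]])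
    fix s t assume "?P s" "?P t"
    then show "s = t" by (intro pairing_unique) auto
  qed
  then have P: "?P (coprd A f)" unfolding c by (rule theI')
  show ?thesis
  proof
    assume "?P t"
    then show "coprd A f = t" using P by (intro pairing_unique) auto
  qed (use P in blast)
qed

lemma hunit_A: "hunit A \<in> dual_deg G 0"
proof -
  have "hunit A = gr_form (\<lambda>j x. if j = 0 then \<epsilon> x else 0)" by (simp add: A_sel gr_form_def G_sel fun_eq_iff)
  also have "\<dots> \<in> dual_deg G 0"
    using slot_form_deg[of \<epsilon> 0 0] cu_lform cu_D by (auto simp: kills_def fil_neg)
  finally show ?thesis .
qed

text \<open>For forms on \<open>gr H\<close> primitivity means being an \<open>\<epsilon>\<close>-derivation.\<close>

lemma primitive_iff:
  assumes f: "f \<in> dual_deg G m"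
  shows "f \<in> primitives A \<longleftrightarrow> (\<forall>a\<in>car G. \<forall>b\<in>car G. f (prd G a b) = counit G a * f b + f a * counit G b)"
proof -
  have pA: "pure_tensor A A = pure_tensor DS DS" by (rule pure_tensor_scl_eq) (simp_all add: A_sel DS_sel)
  note D = dual_deg_DS[OF hunit_A] dual_deg_DS[OF f]
  let ?s = "pure_tensor DS DS (hunit A) f" and ?t = "pure_tensor DS DS f (hunit A)"
  have T: "?s \<in> car (tensor_space DS DS)" "?t \<in> car (tensor_space DS DS)" using pure_tensor_in D by blast+
  have "pairing a b (?s + ?t) = counit G a * f b + f a * counit G b" if "a \<in> car G" "b \<in> car G" for a b
    using lin_map_add[OF pairing_lin T, of a b] pairing_pure D that by (simp add: A_sel)
  then have "coprd A f = ?s + ?t \<longleftrightarrow> (\<forall>a\<in>car G. \<forall>b\<in>car G. f (prd G a b) = counit G a * f b + f a * counit G b)"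
    unfolding A_coprd[OF f] using car_add[OF is_vspace_tensor T] by (auto simp: eq_commute)
  then show ?thesis using D by (simp add: primitives_def pA A_sel(2))
qed

definition prim_form :: "'a \<Rightarrow> ('k, 'a) gr \<Rightarrow> 'k" where
  "prim_form x = gr_form (\<lambda>j y. if j = ht x then gen_form x y else 0)"

lemma prim_form_gc: "x \<in> Gens \<Longrightarrow> y \<in> C j \<Longrightarrow> prim_form x (gc j y) = (if j = ht x then gen_form x y else 0)"
  unfolding prim_form_def by (rule slot_form(3)[OF gen_form_kills])

lemma prim_form_dual: "x \<in> Gens \<Longrightarrow> prim_form x \<in> dual_deg G (dg x)"
  unfolding prim_form_def using gen_form_D by (intro slot_form_deg gen_form_kills) auto

lemma prim_form_primitive: assumes x: "x \<in> Gens" shows "prim_form x \<in> primitives A"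
  unfolding primitive_iff[OF prim_form_dual[OF x]]
proof (intro ballI)
  fix u v assume u: "u \<in> car G" and v: "v \<in> car G"
  note fl = dual_degD(1)[OF prim_form_dual[OF x]]
  have lr: "gform (\<lambda>a. counit G a * c + prim_form x a * d)" for c d
    using G_counit_lin fl by (auto simp: lin_map_def algebra_simps)
  have lr': "gform (\<lambda>a. c * prim_form x a + d * counit G a)" for c d
    using G_counit_lin fl by (auto simp: lin_map_def algebra_simps)
  have base: "prim_form x (prd G (gc j y) (gc k z)) = counit G (gc j y) * prim_form x (gc k z) + prim_form x (gc j y) * counit G (gc k z)"
    if y: "y \<in> C j" "y \<in> D p" and z: "z \<in> C k" "z \<in> D q" for j y p k z q
  proof (cases "j + k = ht x")
    case True
    have 1: "gen_form x (y \<cdot> z) = \<epsilon> y * gen_form x z + gen_form x y * \<epsilon> z"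
      using gen_form_prod[OF x, of y "int j" p z "int k" q] y z True by (simp add: C_fil)
    have "gen_form x z = 0" if "j > 0"
      using killsD[OF gen_form_kills[OF x]] z(1) fil_mono[of "int k" "int (ht x) - 1"] True that by (auto simp: C_fil)
    moreover have "gen_form x y = 0" if "k > 0"
      using killsD[OF gen_form_kills[OF x]] y(1) fil_mono[of "int j" "int (ht x) - 1"] True that by (auto simp: C_fil)
    moreover have "y \<cdot> z \<in> C (ht x)" using C_mul[OF y(1) z(1)] True by simp
    ultimately show ?thesis
      using True 1 y z by (auto simp: G_prd_gc prim_form_gc[OF x] G_counit_gc)
  next
    case False
    then show ?thesis using y z by (auto simp: G_prd_gc prim_form_gc[OF x] C_mul G_counit_gc)
  qed
  have s1: "prim_form x (prd G u (gc k z)) = counit G u * prim_form x (gc k z) + prim_form x u * counit G (gc k z)"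
    if z: "z \<in> C k" "z \<in> D q" for k z q
    by (rule G_lin_eqI[OF lin_map_comp[OF G_prd_lin1[OF gc_G[OF z(1)]] fl] lr _ u]) (rule base[OF _ _ z])
  show "prim_form x (prd G u v) = counit G u * prim_form x v + prim_form x u * counit G v"
    by (rule G_lin_eqI[OF lin_map_comp[OF G_prd_lin2[OF u] fl] lr' _ v]) (rule s1)
qed

lemma prim_form_delta:
  assumes "x \<in> Gens" "y \<in> Gens" "dg x = dg y"
  shows "prim_form x (gc (ht y) y) = (if x = y then 1 else 0)"
proof -
  have "y \<in> C (ht y)" using Gens_fil[OF assms(2)] C_fil by simp
  then show ?thesis
    using prim_form_gc[OF assms(1)] gen_form_self[OF assms(1)] gen_form_other[OF assms(1), of y] Gens_Xs[OF assms(2)] assms(3)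
    by auto
qed

text \<open>A primitive form kills products of elements of positive degree; so it factors through \<open>I / I\<^sup>2\<close>, which
  is spanned by the generators.\<close>

lemma primitive_vanish:
  assumes f: "f \<in> dual_deg G m" "f \<in> primitives A" and m: "m > 0"
    and gens: "\<And>x. x \<in> Gens \<Longrightarrow> dg x = m \<Longrightarrow> f (gc (ht x) x) = 0"
  shows "f = 0"
proof -
  note fl = dual_degD(1)[OF f(1)]
  have prim: "f (prd G a b) = counit G a * f b + f a * counit G b" if "a \<in> car G" "b \<in> car G" for a b
    using f primitive_iff that by blast
  have f0: "f 0 = 0" using lin_map_0[OF G_vspace fl] .
  have top: "f (gc j y) = 0" if y: "y \<in> C j" "y \<in> D m" for j y
  proof -
    let ?S = "{y \<in> fil (int j) \<inter> D m. f (gc j y) = 0}"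
    have sub: "vs.subspace ?S"
      using fil_subspace[of "int j"] D_subspace[of m] lin_map_add[OF fl gc_G gc_G] lin_map_scl[OF fl gc_G]
      by (auto simp: vs.subspace_def gc_add gc_scl gc_zero f0 C_fil G_sel(1))
    have "Xs (int j) m \<subseteq> ?S"
    proof
      fix x assume x: "x \<in> Xs (int j) m"
      have "x \<in> Gens" "ht x = j" "dg x = m" using GensI[OF x m] by auto
      then show "x \<in> ?S" using gens Xs_fil[OF x] Xs_D[OF x] by auto
    qed
    moreover have "Dec (int j) m \<subseteq> ?S"
      unfolding Dec_def
    proof (rule vs.span_minimal[OF _ sub], rule Un_least)
      have low: "y \<in> ?S" if "y \<in> fil (int j - 1)" "y \<in> D m" for y
        using that gc_eq_0[of j y] f0 fil_mono[of "int j - 1" "int j"] by auto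
      then show "fil (int j - 1) \<inter> D m \<subseteq> ?S" by blast
      have "u \<cdot> v \<in> ?S" if *: "u \<in> fil a" "u \<in> D p" "v \<in> fil b" "v \<in> D q" "0 < p" "0 < q"
        "p + q = m" "a + b \<le> int j" for u v a b p q
      proof (cases "a + b = int j \<and> a \<ge> 0 \<and> b \<ge> 0")
        case True
        then obtain a' b' where ab: "a = int a'" "b = int b'" "j = a' + b'"
          by (metis nat_0_le of_nat_add of_nat_eq_iff)
        have C: "u \<in> C a'" "v \<in> C b'" using * ab C_fil by auto
        have "f (gc j (u \<cdot> v)) = f (prd G (gc a' u) (gc b' v))" using G_prd_gc[OF C] ab by simp
        also have "\<dots> = 0"
          using prim[OF gc_G[OF C(1)] gc_G[OF C(2)]] G_counit_gc[OF C(1)] G_counit_gc[OF C(2)]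
            cu_D[OF *(2,5)] cu_D[OF *(4,6)] by simp
        finally show ?thesis using fil_mul[OF *(1,3)] mul_D[OF *(2,4)] *(7) True by auto
      next
        case False
        have "u \<cdot> v \<in> fil (int j - 1)"
        proof (cases "a < 0 \<or> b < 0")
          case True
          then have "u = 0 \<or> v = 0" using * fil_neg by auto
          then show ?thesis using * by auto
        next
          case F: False
          then have "a + b \<le> int j - 1" using False *(8) by auto
          then show ?thesis using fil_mul[OF *(1,3)] fil_mono by blast
        qed
        then show ?thesis using low mul_D[OF *(2,4)] *(7) by simp
      qed
      then show "{u \<cdot> v |u v a b p q. u \<in> fil a \<and> u \<in> D p \<and> v \<in> fil b \<and> v \<in> D q \<and> 0 < p \<and> 0 < q
          \<and> p + q = m \<and> a + b \<le> int j} \<subseteq> ?S" by auto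
    qed
    ultimately have "vs.span (Xs (int j) m \<union> Dec (int j) m) \<subseteq> ?S" using sub by (intro vs.span_minimal) auto
    moreover have "y \<in> vs.span (Xs (int j) m \<union> Dec (int j) m)" using Xs_span[of "int j" m] y C_fil by auto
    ultimately show ?thesis by blast
  qed
  have "f u = 0" for u
  proof (cases "u \<in> car G")
    case True
    show ?thesis
    proof (rule G_lin_eqI[OF fl _ _ True, of "\<lambda>_. 0"])
      show "gform (\<lambda>_. 0)" by (simp add: lin_map_def)
      show "f (gc j x) = 0" if x: "x \<in> C j" "x \<in> D l" for j x l
      proof (cases "l = m")
        case True
        then show ?thesis using top x by blast
      next
        case False
        then show ?thesis using dual_degD(3)[OF f(1) False gc_G_deg[OF x]] by simp
      qed
    qed
  qed (use dual_degD(2)[OF f(1)] in simp)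
  then show ?thesis by (simp add: fun_eq_iff)
qed

text \<open>The forms dual to the generators of degree \<open>m\<close> are a basis of the primitive elements of degree \<open>m\<close>.\<close>

lemma prim_dim_eq:
  assumes m: "m > 0"
  shows "prim_dim H m = card {x \<in> Gens. dg x = m}"
proof -
  let ?X = "{x \<in> Gens. dg x = m}" and ?P = "primitives A \<inter> dual_deg G m"
  have delta: "prim_form x (gc (ht y) y) = (if x = y then 1 else 0)" if "x \<in> ?X" "y \<in> ?X" for x y
    using prim_form_delta that by auto
  have inj: "inj_on prim_form ?X"
  proof (rule inj_onI)
    fix x y assume xy: "x \<in> ?X" "y \<in> ?X" "prim_form x = prim_form y"
    then show "x = y" using delta[of x y] delta[of y y] by (auto split: if_splits)
  qed
  have sub: "fd.subspace ?P"
  proof -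
    have e: "?P = {f \<in> dual_deg G m. \<forall>a\<in>car G. \<forall>b\<in>car G. f (prd G a b) = counit G a * f b + f a * counit G b}"
      using primitive_iff by blast
    show ?thesis unfolding e using dual_deg_subspace[of m]
      by (auto simp: fd.subspace_def fun_scale_def algebra_simps)
  qed
  have fhP: "prim_form ` ?X \<subseteq> ?P" using prim_form_dual prim_form_primitive by auto
  have fin: "finite ?X" by (rule Gens_deg_finite)
  have "fd.independent (prim_form ` ?X)"
  proof
    assume "fd.dependent (prim_form ` ?X)"
    then obtain u v where uv: "v \<in> prim_form ` ?X" "u v \<noteq> 0" "(\<Sum>v\<in>prim_form ` ?X. fun_scale (u v) v) = 0"
      using fd.dependent_finite[of "prim_form ` ?X"] fin by blast
    obtain x where x: "x \<in> ?X" "v = prim_form x" using uv(1) by blast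
    have "0 = (\<Sum>y\<in>?X. fun_scale (u (prim_form y)) (prim_form y)) (gc (ht x) x)"
      using uv(3) by (simp add: sum.reindex[OF inj])
    also have "\<dots> = (\<Sum>y\<in>?X. u (prim_form y) * prim_form y (gc (ht x) x))"
      by (rule sum_fun_scale_apply)
    also have "\<dots> = (\<Sum>y\<in>?X. if y = x then u (prim_form x) else 0)"
      using delta x by (intro sum.cong) auto
    also have "\<dots> = u (prim_form x)" using fin x by simp
    finally show False using uv(2) x by simp
  qed
  moreover have "?P \<subseteq> fd.span (prim_form ` ?X)"
  proof
    fix f assume f: "f \<in> ?P"
    let ?s = "\<Sum>x\<in>?X. fun_scale (f (gc (ht x) x)) (prim_form x)"
    have s: "?s \<in> fd.span (prim_form ` ?X)" by (intro fd.span_sum fd.span_scale fd.span_base) blast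
    have "?s \<in> ?P" using s fd.span_minimal[OF fhP sub] by blast
    then have d: "f - ?s \<in> ?P" using fd.subspace_diff[OF sub f] by blast
    have app: "?s z = (\<Sum>x\<in>?X. f (gc (ht x) x) * prim_form x z)" for z
      by (rule sum_fun_scale_apply)
    have "f - ?s = 0"
    proof (rule primitive_vanish[OF _ _ m])
      show "f - ?s \<in> dual_deg G m" "f - ?s \<in> primitives A" using d by auto
      fix y assume y: "y \<in> Gens" "dg y = m"
      have "?s (gc (ht y) y) = (\<Sum>x\<in>?X. if x = y then f (gc (ht y) y) else 0)"
        unfolding app using delta y by (intro sum.cong) auto
      then show "(f - ?s) (gc (ht y) y) = 0" using fin y by simp
    qed
    then show "f \<in> fd.span (prim_form ` ?X)" using s by simp
  qed
  ultimately have "card (prim_form ` ?X) = fd.dim ?P" using fd.basis_card_eq_dim[OF fhP] by blast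
  then show ?thesis using card_image[OF inj] by (simp add: prim_dim_def Let_def vdim_def A_sel)
qed

section \<open>The product formula\<close>

lemma partial_product:
  fixes c :: 'k
  shows "(\<Prod>i\<le>N. inverse ((1 - fps_const c * fps_X ^ Suc i) ^ prim_dim H (Suc i))) =
    Abs_fps (\<lambda>m. \<Sum>M\<in>wmon dg {x \<in> Gens. dg x \<le> Suc N} m. c ^ size M)"
proof -
  let ?X = "\<lambda>i. {x \<in> Gens. dg x = i}"
  have X: "{x \<in> Gens. dg x \<le> Suc N} = (\<Union>i\<in>{..N}. ?X (Suc i))"
  proof (intro equalityI subsetI)
    fix x assume x: "x \<in> {x \<in> Gens. dg x \<le> Suc N}"
    then have "dg x = Suc (dg x - 1)" "dg x - 1 \<in> {..N}" using Gens_dg[of x] by auto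
    then show "x \<in> (\<Union>i\<in>{..N}. ?X (Suc i))" using x by blast
  qed auto
  have fin: "finite {x \<in> Gens. dg x \<le> Suc N}" unfolding X using Gens_deg_finite by blast
  have "(\<Prod>i\<le>N. inverse ((1 - fps_const c * fps_X ^ Suc i) ^ prim_dim H (Suc i)))
      = (\<Prod>i\<le>N. \<Prod>x\<in>?X (Suc i). inverse (1 - fps_const c * fps_X ^ dg x))"
    by (intro prod.cong refl, subst fps_inverse_power) (simp add: prim_dim_eq del: power_Suc)
  also have "\<dots> = (\<Prod>x\<in>{x \<in> Gens. dg x \<le> Suc N}. inverse (1 - fps_const c * fps_X ^ dg x))"
    unfolding X using Gens_deg_finite by (intro prod.UNION_disjoint[symmetric]) auto
  also have "\<dots> = Abs_fps (\<lambda>m. \<Sum>M\<in>wmon dg {x \<in> Gens. dg x \<le> Suc N} m. c ^ size M)"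
    using fin Gens_dg by (intro prod_inverse_eq_wmon) auto
  finally show ?thesis .
qed

text \<open>In a fixed degree \<open>m\<close> only generators of degree at most \<open>m\<close> matter, so the coefficients of the partial
  products are eventually constant.\<close>

lemma trace_product:
  "(\<lambda>i. inverse ((1 - fps_const c * fps_X ^ Suc i) ^ prim_dim H (Suc i)))
     has_prod Abs_fps (\<lambda>m. trace_on (subsp H (D m)) (adams H c))"
proof -
  let ?f = "\<lambda>i. inverse ((1 - fps_const c * fps_X ^ Suc i) ^ prim_dim H (Suc i))"
  let ?p = "Abs_fps (\<lambda>m. trace_on (subsp H (D m)) (adams H c))"
  have "(\<lambda>N. \<Prod>i\<le>N. ?f i) \<longlonglongrightarrow> ?p"
  proof (rule tendsto_fpsI)
    fix m
    have "fps_nth (\<Prod>i\<le>N. ?f i) m = fps_nth ?p m" if "N \<ge> m" for N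
    proof -
      have "Mon m = wmon dg {x \<in> Gens. dg x \<le> Suc N} m" using that by (intro Mon_wmon) simp
      then show ?thesis unfolding partial_product trace_adams by simp
    qed
    then show "eventually (\<lambda>N. fps_nth (\<Prod>i\<le>N. ?f i) m = fps_nth ?p m) sequentially"
      unfolding eventually_sequentially by blast
  qed
  moreover have "?p \<noteq> 0"
  proof
    assume "?p = 0"
    then have "fps_nth ?p 0 = 0" by simp
    moreover have "Mon 0 = {{#}}"
    proof -
      have "M = {#}" if "M \<in> Mon 0" for M using size_le_DG[of M] that by (auto simp: Mon_def)
      moreover have "{#} \<in> Mon 0" by (simp add: Mon_def)
      ultimately show ?thesis by blast
    qed
    ultimately show False by (simp add: trace_adams)
  qed
  ultimately show ?thesis by (simp add: has_prod_def raw_has_prod_def)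
qed

end

theorem corollary11:
  fixes H :: "('k::field_char_0, 'a::ab_group_add) hopf" and n :: 'k
  assumes "graded_connected_hopf_algebra H"
    and "\<And>m. finite_dim (subsp H (hdeg H m))"
  shows "(\<lambda>i. inverse ((1 - fps_const n * fps_X ^ Suc i) ^ prim_dim H (Suc i)))
           has_prod Abs_fps (\<lambda>m. trace_on (subsp H (hdeg H m)) (adams H n))"
proof -
  interpret locally_finite_hopf_algebra H
    using assms by (simp add: locally_finite_hopf_algebra_def locally_finite_hopf_algebra_axioms_def)
  show ?thesis by (rule trace_product)
qed

end
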